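(* Let $\epsilon>0$ and let $E\subset[0,3/2-\epsilon]\subset\mathbb{R}$ be a measurable set with Lebesgue measure $m(E)=1$. Let $m\geq 1$ and let $F\subset\mathbb{R}^m$ be a bounded measurable set with Lebesgue measure $1$. If $E\times F\subset\mathbb{R}\times\mathbb{R}^m$ is spectral, then both $E$ (in $\mathbb{R}$) and $F$ (in $\mathbb{R}^m$) are spectral.
   Context: A bounded measurable set $\Omega\subset\mathbb{R}^d$ of positive Lebesgue measure is called spectral if there exists a countable set $\Lambda\subset\mathbb{R}^d$ such that $\{x\mapsto \exp(2\pi i\langle\lambda,x\rangle)\}_{\lambda\in\Lambda}$ is an orthogonal basis of $L^2(\Omega)$; $\Lambda$ is then called a spectrum of $\Omega$. *)

theory Defs
  imports "HOL-Analysis.Analysis"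
begin

definition expo :: "'a::euclidean_space \<Rightarrow> 'a \<Rightarrow> complex" where
  "expo l x = exp (2 * pi * \<i> * complex_of_real (l \<bullet> x))"

definition L2_on :: "'a::euclidean_space set \<Rightarrow> ('a \<Rightarrow> complex) \<Rightarrow> bool" where
  "L2_on \<Omega> f \<longleftrightarrow> set_borel_measurable lebesgue \<Omega> f \<and>
      set_integrable lebesgue \<Omega> (\<lambda>x. (cmod (f x))\<^sup>2)"

definition is_spectrum :: "'a::euclidean_space set \<Rightarrow> 'a set \<Rightarrow> bool" where
  "is_spectrum \<Omega> \<Lambda> \<longleftrightarrow>
     (\<forall>l\<in>\<Lambda>. \<forall>k\<in>\<Lambda>. l \<noteq> k \<longrightarrow>
        (LINT x:\<Omega>|lebesgue. expo l x * cnj (expo k x)) = 0) \<and>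
     (\<forall>f. L2_on \<Omega> f \<longrightarrow> (\<forall>e>0. \<exists>S c. finite S \<and> S \<subseteq> \<Lambda> \<and>
        (LINT x:\<Omega>|lebesgue. (cmod (f x - (\<Sum>l\<in>S. c l * expo l x)))\<^sup>2) < e))"

definition spectral :: "'a::euclidean_space set \<Rightarrow> bool" where
  "spectral \<Omega> \<longleftrightarrow> \<Omega> \<in> sets lebesgue \<and> bounded \<Omega> \<and> emeasure lebesgue \<Omega> > 0 \<and>
     (\<exists>\<Lambda>. countable \<Lambda> \<and> is_spectrum \<Omega> \<Lambda>)"

end

theory Submission
  imports Defs
begin

text \<open>
  Orthogonality and completeness of \<open>\<Lambda>\<close> say that
  \<open>\<Sum>\<^sub>l \<bar>ft E (x - fst l)\<bar>\<^sup>2 * \<bar>ft F (y - snd l)\<bar>\<^sup>2 = 1\<close> for all \<open>x\<close>, \<open>y\<close>. For fixed \<open>y\<close> this is a weighted tiling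
  of the line by \<open>\<bar>ft E\<bar>\<^sup>2\<close>, whose Fourier transform is the autocorrelation of \<open>E\<close>. Because \<open>E\<close> has measure \<open>1\<close> and
  lies in an interval shorter than \<open>3/2\<close>, that autocorrelation is positive on \<open>(-1, 1)\<close>. By a local form of Wiener's
  lemma the Fourier transform of the weights then vanishes on \<open>(-1, 1)\<close> except at \<open>0\<close>, so the weights also tile with
  the square of \<open>sin (\<pi> x) / (\<pi> x)\<close>: in effect \<open>E\<close> may be replaced by \<open>[0, 1]\<close>.

  Evaluating this new tiling at the points of \<open>\<Lambda>\<close> shows that \<open>fst l - fst k\<close> is a nonzero integer whenever
  \<open>ft F (snd l - snd k) \<noteq> 0\<close> and \<open>l \<noteq> k\<close>, and that for each \<open>l \<in> \<Lambda>\<close> and each integer \<open>n\<close> the exponential of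
  frequency \<open>snd l\<close> lies in the closed span of those of frequency \<open>snd k\<close> with \<open>k \<in> \<Lambda>\<close>, \<open>fst k = fst l + n\<close>. The first
  fact turns the tiling by \<open>\<bar>ft E\<bar>\<^sup>2\<close> into one by the integers, which are thus a spectrum of \<open>E\<close>; the second shows that
  the points of \<open>\<Lambda>\<close> with first coordinate in \<open>[0, 1)\<close> project to a spectrum of \<open>F\<close>.
\<close>

section \<open>Orthogonal systems of bounded functions\<close>

text \<open>At length 3/2 positivity of the autocorrelation can fail: [0, 1/2] together with
  [1, 3/2] has measure 1, and its autocorrelation vanishes at 1/2. The lower bound available on
  [-a, a] tends to 0 as a tends to 1, so \<open>E\<close> is first replaced by [0, a] with a < 1,
  and a tends to 1 only afterwards.

  The weights have infinite total mass, so their Fourier transform exists only as a distribution. To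
  avoid distributions, the weights are smoothed to a bounded function \<open>defect\<close>, and
  statements about its transform are rephrased: convolution with a given absolutely summable
  sequence of masses on the lattice \<open>freq n\<close> is 0. These masses are Fourier
  coefficients of correlations of sets, on a window so long that periodic extension does no harm.
  Division by the autocorrelation of \<open>E\<close> is carried out near one frequency at a time,
  and a compact range of frequencies is covered by finitely many pieces of one common size.\<close>

lemma has_sum_nonnegI:
  fixes f :: "'i \<Rightarrow> real"
  assumes "\<And>i. i \<in> I \<Longrightarrow> f i \<ge> 0"
    and upper: "\<And>S. finite S \<Longrightarrow> S \<subseteq> I \<Longrightarrow> sum f S \<le> s"
    and lower: "\<And>e. e > 0 \<Longrightarrow> \<exists>S. finite S \<and> S \<subseteq> I \<and> s - e < sum f S"
  shows "(f has_sum s) I"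
  unfolding has_sum_def
proof (rule tendstoI)
  fix e :: real assume "e > 0"
  then obtain S where S: "finite S" "S \<subseteq> I" "s - e < sum f S"
    using lower by blast
  have "dist (sum f T) s < e" if T: "finite T" "S \<subseteq> T" "T \<subseteq> I" for T
  proof -
    have "sum f S \<le> sum f T"
      using T assms(1) by (intro sum_mono2) auto
    then show ?thesis
      using upper[OF T(1,3)] S(3) \<open>e > 0\<close> by (simp add: dist_real_def)
  qed
  with S show "\<forall>\<^sub>F T in finite_subsets_at_top I. dist (sum f T) s < e"
    unfolding eventually_finite_subsets_at_top by blast
qed

lemma has_sum_finite_lower:
  fixes f :: "'i \<Rightarrow> real"
  assumes "(f has_sum s) I" "e > 0"
  obtains S where "finite S" "S \<subseteq> I" "\<And>T. finite T \<Longrightarrow> S \<subseteq> T \<Longrightarrow> T \<subseteq> I \<Longrightarrow> \<bar>sum f T - s\<bar> < e"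
proof -
  have "eventually (\<lambda>S. dist (sum f S) s < e) (finite_subsets_at_top I)"
    using assms unfolding has_sum_def by (rule tendstoD)
  then obtain S where "finite S" "S \<subseteq> I" "\<forall>T. finite T \<and> S \<subseteq> T \<and> T \<subseteq> I \<longrightarrow> dist (sum f T) s < e"
    unfolding eventually_finite_subsets_at_top by blast
  then show ?thesis
    by (intro that[of S]) (auto simp: dist_real_def)
qed

text \<open>Bounded measurable functions are closed under products and, over a finite measure,
  always integrable, so inner products can be manipulated without side conditions. Exponentials and
  indicators are of this kind; general square-integrable functions are reached through
  \<open>closed_span_L2\<close>.\<close>

definition bmeas :: "'a measure \<Rightarrow> ('a \<Rightarrow> complex) \<Rightarrow> bool" where
  "bmeas N f \<longleftrightarrow> f \<in> borel_measurable N \<and> (\<exists>C. \<forall>x\<in>space N. cmod (f x) \<le> C)"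

definition ip :: "'a measure \<Rightarrow> ('a \<Rightarrow> complex) \<Rightarrow> ('a \<Rightarrow> complex) \<Rightarrow> complex" where
  "ip N f g = (LINT x|N. f x * cnj (g x))"

definition sqn :: "'a measure \<Rightarrow> ('a \<Rightarrow> complex) \<Rightarrow> real" where
  "sqn N f = (LINT x|N. (cmod (f x))\<^sup>2)"

lemma bmeasI: "f \<in> borel_measurable N \<Longrightarrow> (\<And>x. x \<in> space N \<Longrightarrow> cmod (f x) \<le> C) \<Longrightarrow> bmeas N f"
  unfolding bmeas_def by blast

lemma bmeas_measurable: "bmeas N f \<Longrightarrow> f \<in> borel_measurable N"
  by (simp add: bmeas_def)

lemma bmeas_const [simp]: "bmeas N (\<lambda>x. c)"
  by (rule bmeasI[where C = "cmod c"]) auto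

lemma bmeas_mult [intro]: "bmeas N f \<Longrightarrow> bmeas N g \<Longrightarrow> bmeas N (\<lambda>x. f x * g x)"
proof -
  assume f: "bmeas N f" and g: "bmeas N g"
  then obtain C D where "\<forall>x\<in>space N. cmod (f x) \<le> C" "\<forall>x\<in>space N. cmod (g x) \<le> D"
    unfolding bmeas_def by blast
  then have "cmod (f x * g x) \<le> \<bar>C\<bar> * \<bar>D\<bar>" if "x \<in> space N" for x
    unfolding norm_mult using that by (intro mult_mono) force+
  then show ?thesis
    using f g by (intro bmeasI borel_measurable_times) (auto simp: bmeas_def)
qed

lemma bmeas_add [intro]: "bmeas N f \<Longrightarrow> bmeas N g \<Longrightarrow> bmeas N (\<lambda>x. f x + g x)"
proof -
  assume f: "bmeas N f" and g: "bmeas N g"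
  then obtain C D where "\<forall>x\<in>space N. cmod (f x) \<le> C" "\<forall>x\<in>space N. cmod (g x) \<le> D"
    unfolding bmeas_def by blast
  then have "cmod (f x + g x) \<le> C + D" if "x \<in> space N" for x
    using that by (intro order_trans[OF norm_triangle_ineq] add_mono) auto
  then show ?thesis
    using f g by (intro bmeasI borel_measurable_add) (auto simp: bmeas_def)
qed

lemma bmeas_cnj [intro]: "bmeas N f \<Longrightarrow> bmeas N (\<lambda>x. cnj (f x))"
  unfolding bmeas_def by (auto intro!: borel_measurable_continuous_on[of cnj] continuous_intros)

lemma bmeas_diff [intro]: "bmeas N f \<Longrightarrow> bmeas N g \<Longrightarrow> bmeas N (\<lambda>x. f x - g x)"
  using bmeas_add[of N f "\<lambda>x. (-1) * g x"] bmeas_mult[of N "\<lambda>x. -1" g] by simp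

lemma bmeas_sum [intro]: "(\<And>i. i \<in> S \<Longrightarrow> bmeas N (f i)) \<Longrightarrow> bmeas N (\<lambda>x. \<Sum>i\<in>S. f i x)"
  by (induction S rule: infinite_finite_induct) (auto intro!: bmeas_add)

lemma cnj_ip: "cnj (ip N f g) = ip N g f"
proof -
  have "cnj (ip N f g) = (LINT x|N. cnj (f x * cnj (g x)))"
    unfolding ip_def by (rule Bochner_Integration.integral_cnj[symmetric])
  also have "(\<lambda>x. cnj (f x * cnj (g x))) = (\<lambda>x. g x * cnj (f x))"
    by auto
  finally show ?thesis
    unfolding ip_def .
qed

lemma ip_self: "ip N f f = complex_of_real (sqn N f)"
  unfolding ip_def sqn_def integral_complex_of_real[symmetric] complex_norm_square by simp

lemma sqn_nonneg [simp]: "sqn N f \<ge> 0"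
  unfolding sqn_def by simp

context finite_measure
begin

lemma bmeas_integrable: "bmeas M f \<Longrightarrow> integrable M f"
  unfolding bmeas_def by (auto intro!: integrable_const_bound)

lemma bmeas_integrable_sq: "bmeas M f \<Longrightarrow> integrable M (\<lambda>x. (cmod (f x))\<^sup>2)"
proof -
  assume "bmeas M f"
  then have "integrable M (\<lambda>x. f x * cnj (f x))"
    by (intro bmeas_integrable bmeas_mult bmeas_cnj)
  then have "integrable M (\<lambda>x. complex_of_real ((cmod (f x))\<^sup>2))"
    by (simp add: complex_norm_square del: of_real_power)
  then show ?thesis
    by (simp only: complex_of_real_integrable_eq)
qed

lemma ip_add_left: "bmeas M f \<Longrightarrow> bmeas M g \<Longrightarrow> bmeas M h \<Longrightarrow> ip M (\<lambda>x. f x + g x) h = ip M f h + ip M g h"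
  unfolding ip_def
  by (simp add: algebra_simps)
    (intro Bochner_Integration.integral_add bmeas_integrable bmeas_mult bmeas_cnj; assumption)

lemma ip_cmult_left: "ip M (\<lambda>x. c * f x) h = c * ip M f h"
  unfolding ip_def by (simp add: mult.assoc)

lemma ip_add_right: "bmeas M f \<Longrightarrow> bmeas M g \<Longrightarrow> bmeas M h \<Longrightarrow> ip M h (\<lambda>x. f x + g x) = ip M h f + ip M h g"
  using ip_add_left[of f g h] by (metis cnj_ip complex_cnj_add)

lemma ip_cmult_right: "ip M h (\<lambda>x. c * f x) = cnj c * ip M h f"
  using ip_cmult_left[of c f h] by (metis cnj_ip complex_cnj_mult)

lemma ip_diff_left: "bmeas M f \<Longrightarrow> bmeas M g \<Longrightarrow> bmeas M h \<Longrightarrow> ip M (\<lambda>x. f x - g x) h = ip M f h - ip M g h"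
  using ip_add_left[of f "\<lambda>x. (-1) * g x" h] ip_cmult_left[of "-1" g h] bmeas_mult[of M "\<lambda>x. -1" g] by simp

lemma ip_diff_right: "bmeas M f \<Longrightarrow> bmeas M g \<Longrightarrow> bmeas M h \<Longrightarrow> ip M h (\<lambda>x. f x - g x) = ip M h f - ip M h g"
  using ip_diff_left[of f g h] by (metis cnj_ip complex_cnj_diff)

lemma ip_sum_left:
  "finite S \<Longrightarrow> (\<And>i. i \<in> S \<Longrightarrow> bmeas M (f i)) \<Longrightarrow> bmeas M h \<Longrightarrow>
    ip M (\<lambda>x. \<Sum>i\<in>S. f i x) h = (\<Sum>i\<in>S. ip M (f i) h)"
proof (induction S rule: finite_induct)
  case empty
  then show ?case by (simp add: ip_def)
next
  case (insert i S)
  then have "ip M (\<lambda>x. f i x + (\<Sum>i\<in>S. f i x)) h = ip M (f i) h + ip M (\<lambda>x. \<Sum>i\<in>S. f i x) h"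
    by (intro ip_add_left bmeas_sum) auto
  with insert show ?case by simp
qed

lemma ip_sum_right:
  "finite S \<Longrightarrow> (\<And>i. i \<in> S \<Longrightarrow> bmeas M (f i)) \<Longrightarrow> bmeas M h \<Longrightarrow>
    ip M h (\<lambda>x. \<Sum>i\<in>S. f i x) = (\<Sum>i\<in>S. ip M h (f i))"
  using ip_sum_left[of S f h] by (metis (no_types, lifting) cnj_ip cnj_sum sum.cong)

text \<open>Completing the square in each coefficient. The optimal coefficients give Bessel's
  inequality and the approximation in \<open>parseval_appr\<close>; dropping the last, nonnegative
  sum for arbitrary \<open>c\<close> gives the lower bound in \<open>parseval\<close>.\<close>

lemma bessel_identity:
  assumes S: "finite S" and f: "bmeas M f" and \<phi>: "\<And>i. i \<in> S \<Longrightarrow> bmeas M (\<phi> i)" and m: "m > 0"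
    and orth: "\<And>i j. i \<in> S \<Longrightarrow> j \<in> S \<Longrightarrow> ip M (\<phi> i) (\<phi> j) = (if i = j then complex_of_real m else 0)"
  shows "sqn M (\<lambda>x. f x - (\<Sum>i\<in>S. c i * \<phi> i x)) =
    sqn M f - (\<Sum>i\<in>S. (cmod (ip M f (\<phi> i)))\<^sup>2) / m + m * (\<Sum>i\<in>S. (cmod (c i - ip M f (\<phi> i) / m))\<^sup>2)"
proof -
  define s where "s x = (\<Sum>i\<in>S. c i * \<phi> i x)" for x
  define a where "a i = ip M f (\<phi> i)" for i
  have bs: "bmeas M s"
    unfolding s_def using \<phi> by (intro bmeas_sum bmeas_mult) auto
  have b\<phi>: "bmeas M (\<lambda>x. c i * \<phi> i x)" if "i \<in> S" for i
    using \<phi>[OF that] by (intro bmeas_mult) simp_all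
  have right: "ip M h s = (\<Sum>i\<in>S. cnj (c i) * ip M h (\<phi> i))" if "bmeas M h" for h
    unfolding s_def using ip_sum_right[OF S b\<phi> that] by (simp add: ip_cmult_right)
  have left: "ip M s h = (\<Sum>i\<in>S. c i * ip M (\<phi> i) h)" if "bmeas M h" for h
    unfolding s_def using ip_sum_left[OF S b\<phi> that] by (simp add: ip_cmult_left)
  have ss: "ip M s s = (\<Sum>i\<in>S. c i * (cnj (c i) * m))"
    unfolding left[OF bs]
  proof (intro sum.cong refl)
    fix i assume i: "i \<in> S"
    have "ip M (\<phi> i) s = (\<Sum>j\<in>S. if j = i then cnj (c i) * m else 0)"
      unfolding right[OF \<phi>[OF i]] using i by (intro sum.cong) (auto simp: orth)
    then show "c i * ip M (\<phi> i) s = c i * (cnj (c i) * m)"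
      using S i by simp
  qed
  have "complex_of_real (sqn M (\<lambda>x. f x - s x)) = ip M f f - ip M f s - ip M s f + ip M s s"
    unfolding ip_self[symmetric]
    by (simp only: ip_diff_left[OF f bs bmeas_diff[OF f bs]] ip_diff_right[OF f bs f] ip_diff_right[OF f bs bs])
      simp
  also have "ip M s f = cnj (ip M f s)"
    by (simp add: cnj_ip)
  finally have "sqn M (\<lambda>x. f x - s x) = Re (ip M f f - ip M f s - cnj (ip M f s) + ip M s s)"
    by (metis Re_complex_of_real)
  also have "\<dots> = sqn M f - 2 * Re (ip M f s) + Re (ip M s s)"
    by (simp add: ip_self)
  also have "\<dots> = sqn M f + (\<Sum>i\<in>S. Re (c i * (cnj (c i) * m)) - 2 * Re (cnj (c i) * a i))"
    unfolding ss right[OF f] a_def[symmetric] sum_subtractf sum_distrib_left[symmetric] Re_sum[symmetric]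
    by linarith
  also have "(\<Sum>i\<in>S. Re (c i * (cnj (c i) * m)) - 2 * Re (cnj (c i) * a i)) =
    (\<Sum>i\<in>S. m * (cmod (c i - a i / m))\<^sup>2 - (cmod (a i))\<^sup>2 / m)"
  proof (intro sum.cong refl)
    fix i
    show "Re (c i * (cnj (c i) * m)) - 2 * Re (cnj (c i) * a i) = m * (cmod (c i - a i / m))\<^sup>2 - (cmod (a i))\<^sup>2 / m"
      using m unfolding cmod_power2 by (simp add: field_simps power2_eq_square)
  qed
  finally show ?thesis
    by (simp add: sum_subtractf sum_distrib_left sum_divide_distrib s_def a_def)
qed

end

text \<open>The vectors are left unnormalised: exponentials on a set of measure \<open>m\<close> all
  have squared norm \<open>m\<close>.\<close>

locale orth_system = finite_measure +
  fixes I :: "'i set" and \<phi> :: "'i \<Rightarrow> 'a \<Rightarrow> complex" and m :: real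
  assumes m_pos: "m > 0"
    and bmeas_phi: "\<And>i. i \<in> I \<Longrightarrow> bmeas M (\<phi> i)"
    and orth: "\<And>i j. i \<in> I \<Longrightarrow> j \<in> I \<Longrightarrow> ip M (\<phi> i) (\<phi> j) = (if i = j then complex_of_real m else 0)"
begin

lemma bessel_eq:
  assumes "finite S" "S \<subseteq> I" "bmeas M f"
  shows "sqn M (\<lambda>x. f x - (\<Sum>i\<in>S. c i * \<phi> i x)) =
    sqn M f - (\<Sum>i\<in>S. (cmod (ip M f (\<phi> i)))\<^sup>2) / m + m * (\<Sum>i\<in>S. (cmod (c i - ip M f (\<phi> i) / m))\<^sup>2)"
proof (rule bessel_identity[OF assms(1,3) _ m_pos])
  show "bmeas M (\<phi> i)" if "i \<in> S" for i
    using bmeas_phi that assms(2) by blast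
  show "ip M (\<phi> i) (\<phi> j) = (if i = j then complex_of_real m else 0)" if "i \<in> S" "j \<in> S" for i j
    using that assms(2) by (intro orth) auto
qed

lemma bessel:
  assumes "finite S" "S \<subseteq> I" "bmeas M f"
  shows "(\<Sum>i\<in>S. (cmod (ip M f (\<phi> i)))\<^sup>2) \<le> m * sqn M f"
proof -
  have "0 \<le> sqn M f - (\<Sum>i\<in>S. (cmod (ip M f (\<phi> i)))\<^sup>2) / m"
    using bessel_eq[OF assms, of "\<lambda>i. ip M f (\<phi> i) / m"]
      sqn_nonneg[of M "\<lambda>x. f x - (\<Sum>i\<in>S. ip M f (\<phi> i) / m * \<phi> i x)"]
    by simp
  then have "(\<Sum>i\<in>S. (cmod (ip M f (\<phi> i)))\<^sup>2) / m \<le> sqn M f"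
    by simp
  then show ?thesis
    using m_pos by (simp only: pos_divide_le_eq mult.commute)
qed

lemma cauchy_schwarz_coeffs:
  assumes "finite S" "S \<subseteq> I" "bmeas M f" "bmeas M g"
  shows "(\<Sum>i\<in>S. cmod (ip M f (\<phi> i)) * cmod (ip M g (\<phi> i))) \<le> m * sqrt (sqn M f) * sqrt (sqn M g)"
proof -
  have "(\<Sum>i\<in>S. cmod (ip M f (\<phi> i)) * cmod (ip M g (\<phi> i)))\<^sup>2
      \<le> (\<Sum>i\<in>S. (cmod (ip M f (\<phi> i)))\<^sup>2) * (\<Sum>i\<in>S. (cmod (ip M g (\<phi> i)))\<^sup>2)"
    by (rule Cauchy_Schwarz_ineq_sum)
  also have "\<dots> \<le> (m * sqn M f) * (m * sqn M g)"
    using assms m_pos by (intro mult_mono bessel sum_nonneg) auto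
  also have "\<dots> = (m * sqrt (sqn M f) * sqrt (sqn M g))\<^sup>2"
    unfolding power_mult_distrib real_sqrt_pow2[OF sqn_nonneg] by (simp only: power2_eq_square mult_ac)
  finally show ?thesis
    by (rule power2_le_imp_le) (use m_pos in simp)
qed

lemma parseval:
  assumes f: "bmeas M f"
    and appr: "\<And>e. e > 0 \<Longrightarrow> \<exists>S c. finite S \<and> S \<subseteq> I \<and> sqn M (\<lambda>x. f x - (\<Sum>i\<in>S. c i * \<phi> i x)) < e"
  shows "((\<lambda>i. (cmod (ip M f (\<phi> i)))\<^sup>2) has_sum m * sqn M f) I"
proof (rule has_sum_nonnegI)
  fix e :: real assume e: "e > 0"
  then obtain S c where S: "finite S" "S \<subseteq> I" "sqn M (\<lambda>x. f x - (\<Sum>i\<in>S. c i * \<phi> i x)) < e / m"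
    using appr[of "e / m"] m_pos by auto
  have "m * (\<Sum>i\<in>S. (cmod (c i - ip M f (\<phi> i) / m))\<^sup>2) \<ge> 0"
    using m_pos by (intro mult_nonneg_nonneg sum_nonneg) auto
  with bessel_eq[OF S(1,2) f, of c] S(3)
  have "sqn M f - (\<Sum>i\<in>S. (cmod (ip M f (\<phi> i)))\<^sup>2) / m < e / m"
    by linarith
  then have "m * (sqn M f - (\<Sum>i\<in>S. (cmod (ip M f (\<phi> i)))\<^sup>2) / m) < m * (e / m)"
    using m_pos by (intro mult_strict_left_mono)
  then have "m * sqn M f - e < (\<Sum>i\<in>S. (cmod (ip M f (\<phi> i)))\<^sup>2)"
    using m_pos by (simp add: right_diff_distrib)
  with S show "\<exists>S. finite S \<and> S \<subseteq> I \<and> m * sqn M f - e < (\<Sum>i\<in>S. (cmod (ip M f (\<phi> i)))\<^sup>2)"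
    by blast
qed (use f in \<open>auto intro: bessel\<close>)

lemma parseval_appr:
  assumes f: "bmeas M f" and e: "e > 0" and "finite S" "S \<subseteq> I"
    and "m * sqn M f - m * e < (\<Sum>i\<in>S. (cmod (ip M f (\<phi> i)))\<^sup>2)"
  shows "sqn M (\<lambda>x. f x - (\<Sum>i\<in>S. ip M f (\<phi> i) / m * \<phi> i x)) < e"
proof -
  have "m * (sqn M f - e) < m * ((\<Sum>i\<in>S. (cmod (ip M f (\<phi> i)))\<^sup>2) / m)"
    using assms(5) m_pos by (simp add: right_diff_distrib)
  then have "sqn M f - e < (\<Sum>i\<in>S. (cmod (ip M f (\<phi> i)))\<^sup>2) / m"
    using m_pos by (simp only: mult_less_cancel_left_pos)
  then show ?thesis
    using bessel_eq[OF assms(3,4) f, of "\<lambda>i. ip M f (\<phi> i) / m"] by simp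
qed

text \<open>Parseval for \<open>f + c * g\<close>, with \<open>c\<close> running through the four
  fourth roots of unity, recombined by polarisation.\<close>

lemma parseval_polarised:
  assumes f: "bmeas M f" and g: "bmeas M g"
    and appr: "\<And>f e. bmeas M f \<Longrightarrow> e > 0 \<Longrightarrow>
      \<exists>S c. finite S \<and> S \<subseteq> I \<and> sqn M (\<lambda>x. f x - (\<Sum>i\<in>S. c i * \<phi> i x)) < e"
  shows "((\<lambda>i. ip M f (\<phi> i) * cnj (ip M g (\<phi> i))) has_sum (m * ip M f g)) I"
proof -
  have pol: "4 * (a * cnj b) = of_real ((cmod (a + b))\<^sup>2) - of_real ((cmod (a - b))\<^sup>2)
      + \<i> * of_real ((cmod (a + \<i> * b))\<^sup>2) - \<i> * of_real ((cmod (a - \<i> * b))\<^sup>2)" for a b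
    unfolding complex_norm_square complex_cnj_add complex_cnj_diff complex_cnj_mult complex_cnj_i
    by (simp add: algebra_simps)
  have comb: "bmeas M (\<lambda>x. f x + c * g x)" for c
    using f g by (intro bmeas_add bmeas_mult) auto
  have P: "((\<lambda>i. complex_of_real ((cmod (ip M f (\<phi> i) + c * ip M g (\<phi> i)))\<^sup>2))
      has_sum of_real (m * sqn M (\<lambda>x. f x + c * g x))) I" for c
  proof -
    have "ip M (\<lambda>x. f x + c * g x) (\<phi> i) = ip M f (\<phi> i) + c * ip M g (\<phi> i)" if "i \<in> I" for i
      using ip_add_left[OF f bmeas_mult[OF bmeas_const g] bmeas_phi[OF that]] by (simp add: ip_cmult_left)
    then show ?thesis
      using parseval[OF comb[of c] appr[OF comb[of c]]]
      by (subst has_sum_of_real_iff) (simp cong: has_sum_cong)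
  qed
  have E: "complex_of_real (sqn M (\<lambda>x. f x + c * g x))
       = ip M f f + c * ip M g f + cnj c * ip M f g + c * cnj c * ip M g g" for c
  proof -
    have cg: "bmeas M (\<lambda>x. c * g x)"
      using g by (intro bmeas_mult) simp_all
    show ?thesis
      unfolding ip_self[symmetric] ip_add_left[OF f cg comb] ip_add_right[OF f cg f] ip_add_right[OF f cg cg]
        ip_cmult_left ip_cmult_right by (simp add: algebra_simps)
  qed
  have Q: "4 * ip M f g = of_real (sqn M (\<lambda>x. f x + 1 * g x)) - of_real (sqn M (\<lambda>x. f x + (-1) * g x))
      + \<i> * of_real (sqn M (\<lambda>x. f x + \<i> * g x)) - \<i> * of_real (sqn M (\<lambda>x. f x + (-\<i>) * g x))"
    by (subst (1 2 3 4) E) (simp add: algebra_simps)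
  have "((\<lambda>i. 4 * (ip M f (\<phi> i) * cnj (ip M g (\<phi> i)))) has_sum
     (of_real (m * sqn M (\<lambda>x. f x + 1 * g x)) - of_real (m * sqn M (\<lambda>x. f x + (-1) * g x))
      + \<i> * of_real (m * sqn M (\<lambda>x. f x + \<i> * g x)) - \<i> * of_real (m * sqn M (\<lambda>x. f x + (-\<i>) * g x)))) I"
    unfolding pol
    using P[of 1] P[of "-1"] P[of \<i>] P[of "-\<i>"]
    unfolding diff_conv_add_uminus
    by (intro has_sum_add has_sum_uminusI has_sum_cmult_right) simp_all
  also have "of_real (m * sqn M (\<lambda>x. f x + 1 * g x)) - of_real (m * sqn M (\<lambda>x. f x + (-1) * g x))
      + \<i> * of_real (m * sqn M (\<lambda>x. f x + \<i> * g x)) - \<i> * of_real (m * sqn M (\<lambda>x. f x + (-\<i>) * g x))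
     = 4 * (m * ip M f g)"
    using arg_cong[OF Q, of "\<lambda>z. of_real m * z"] by (simp add: algebra_simps)
  finally show ?thesis
    by (subst (asm) has_sum_cmult_right_iff) simp_all
qed

end

section \<open>Completeness of exponentials\<close>

text \<open>Closeness is measured by \<open>sqn\<close> directly, without forming a quotient space.
  As the integral defining \<open>sqn\<close> is 0 by convention for functions that are not square
  integrable, \<open>sqn_triangle\<close> and \<open>closed_span_limit\<close> carry explicit
  integrability hypotheses.\<close>

definition closed_span :: "'a measure \<Rightarrow> 'i set \<Rightarrow> ('i \<Rightarrow> 'a \<Rightarrow> complex) \<Rightarrow> ('a \<Rightarrow> complex) \<Rightarrow> bool" where
  "closed_span N I \<phi> f \<longleftrightarrow>
    (\<forall>e>0. \<exists>S c. finite S \<and> S \<subseteq> I \<and> sqn N (\<lambda>x. f x - (\<Sum>i\<in>S. c i * \<phi> i x)) < e)"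

lemma closed_spanD:
  assumes "closed_span N I \<phi> f" "e > 0"
  obtains S c where "finite S" "S \<subseteq> I" "sqn N (\<lambda>x. f x - (\<Sum>i\<in>S. c i * \<phi> i x)) < e"
  using assms unfolding closed_span_def by blast

lemma sqn_triangle:
  assumes "integrable N (\<lambda>x. (cmod (f x - h x))\<^sup>2)" "integrable N (\<lambda>x. (cmod (h x - g x))\<^sup>2)"
  shows "sqn N (\<lambda>x. f x - g x) \<le> 2 * sqn N (\<lambda>x. f x - h x) + 2 * sqn N (\<lambda>x. h x - g x)"
proof -
  have pt: "(cmod (f x - g x))\<^sup>2 \<le> 2 * (cmod (f x - h x))\<^sup>2 + 2 * (cmod (h x - g x))\<^sup>2" for x
  proof -
    have "cmod (f x - g x) \<le> cmod (f x - h x) + cmod (h x - g x)"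
      using norm_triangle_ineq[of "f x - h x" "h x - g x"] by simp
    then have "(cmod (f x - g x))\<^sup>2 \<le> (cmod (f x - h x) + cmod (h x - g x))\<^sup>2"
      by (intro power_mono) auto
    also have "\<dots> \<le> 2 * (cmod (f x - h x))\<^sup>2 + 2 * (cmod (h x - g x))\<^sup>2"
      using sum_squares_bound[of "cmod (f x - h x)" "cmod (h x - g x)"] by (simp add: power2_sum)
    finally show ?thesis .
  qed
  have "sqn N (\<lambda>x. f x - g x) \<le> (LINT x|N. 2 * (cmod (f x - h x))\<^sup>2 + 2 * (cmod (h x - g x))\<^sup>2)"
    unfolding sqn_def using assms pt by (intro integral_mono') auto
  also have "\<dots> = 2 * sqn N (\<lambda>x. f x - h x) + 2 * sqn N (\<lambda>x. h x - g x)"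
    unfolding sqn_def using assms by simp
  finally show ?thesis .
qed

lemma (in finite_measure) closed_span_limit:
  assumes \<phi>: "\<And>i. i \<in> I \<Longrightarrow> bmeas M (\<phi> i)"
    and lim: "\<And>e. e > 0 \<Longrightarrow> \<exists>g. bmeas M g \<and> closed_span M I \<phi> g \<and>
      integrable M (\<lambda>x. (cmod (f x - g x))\<^sup>2) \<and> sqn M (\<lambda>x. f x - g x) < e"
  shows "closed_span M I \<phi> f"
  unfolding closed_span_def
proof (intro allI impI)
  fix e :: real assume e: "e > 0"
  obtain g where g: "bmeas M g" "closed_span M I \<phi> g" "integrable M (\<lambda>x. (cmod (f x - g x))\<^sup>2)"
    "sqn M (\<lambda>x. f x - g x) < e / 4"
    using lim[of "e / 4"] e by auto
  obtain S c where S: "finite S" "S \<subseteq> I" "sqn M (\<lambda>x. g x - (\<Sum>i\<in>S. c i * \<phi> i x)) < e / 4"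
    using closed_spanD[OF g(2), of "e / 4"] e by auto
  have "bmeas M (\<lambda>x. g x - (\<Sum>i\<in>S. c i * \<phi> i x))"
    using g(1) \<phi> S(2) by (intro bmeas_diff bmeas_sum bmeas_mult) auto
  then have "integrable M (\<lambda>x. (cmod (g x - (\<Sum>i\<in>S. c i * \<phi> i x)))\<^sup>2)"
    by (rule bmeas_integrable_sq)
  then have "sqn M (\<lambda>x. f x - (\<Sum>i\<in>S. c i * \<phi> i x)) < e"
    using sqn_triangle[OF g(3), of "\<lambda>x. \<Sum>i\<in>S. c i * \<phi> i x"] S(3) g(4) by linarith
  with S show "\<exists>S c. finite S \<and> S \<subseteq> I \<and> sqn M (\<lambda>x. f x - (\<Sum>i\<in>S. c i * \<phi> i x)) < e"
    by blast
qed

lemma closed_span_cmult: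
  assumes "closed_span N I \<phi> f"
  shows "closed_span N I \<phi> (\<lambda>x. a * f x)"
  unfolding closed_span_def
proof (intro allI impI)
  fix e :: real assume e: "e > 0"
  \<comment> \<open>The \<open>+ 1\<close> covers the case \<open>a = 0\<close>.\<close>
  have pos: "(cmod a)\<^sup>2 + 1 > 0"
    by (simp add: add_nonneg_pos)
  with e have "e / ((cmod a)\<^sup>2 + 1) > 0"
    by simp
  then obtain S c where S: "finite S" "S \<subseteq> I"
    "sqn N (\<lambda>x. f x - (\<Sum>i\<in>S. c i * \<phi> i x)) < e / ((cmod a)\<^sup>2 + 1)"
    using closed_spanD[OF assms] by blast
  have "sqn N (\<lambda>x. a * f x - (\<Sum>i\<in>S. (a * c i) * \<phi> i x)) = (cmod a)\<^sup>2 * sqn N (\<lambda>x. f x - (\<Sum>i\<in>S. c i * \<phi> i x))"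
  proof -
    have "a * f x - (\<Sum>i\<in>S. (a * c i) * \<phi> i x) = a * (f x - (\<Sum>i\<in>S. c i * \<phi> i x))" for x
      by (simp add: right_diff_distrib sum_distrib_left mult.assoc)
    then show ?thesis
      unfolding sqn_def by (simp add: norm_mult power_mult_distrib)
  qed
  also have "\<dots> \<le> ((cmod a)\<^sup>2 + 1) * sqn N (\<lambda>x. f x - (\<Sum>i\<in>S. c i * \<phi> i x))"
    by (intro mult_right_mono) auto
  also have "\<dots> < e"
    using S(3) pos by (simp add: pos_less_divide_eq mult.commute)
  finally show "\<exists>S c. finite S \<and> S \<subseteq> I \<and> sqn N (\<lambda>x. a * f x - (\<Sum>i\<in>S. c i * \<phi> i x)) < e"
    using S(1,2) by (intro exI[of _ S] exI[of _ "\<lambda>i. a * c i"] conjI)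
qed

lemma (in finite_measure) closed_span_add:
  assumes \<phi>: "\<And>i. i \<in> I \<Longrightarrow> bmeas M (\<phi> i)" and bf: "bmeas M f" and bg: "bmeas M g"
    and f: "closed_span M I \<phi> f" and g: "closed_span M I \<phi> g"
  shows "closed_span M I \<phi> (\<lambda>x. f x + g x)"
  unfolding closed_span_def
proof (intro allI impI)
  fix e :: real assume e: "e > 0"
  then have e4: "e / 4 > 0"
    by simp
  obtain S c where S: "finite S" "S \<subseteq> I" "sqn M (\<lambda>x. f x - (\<Sum>i\<in>S. c i * \<phi> i x)) < e / 4"
    using closed_spanD[OF f e4] by blast
  obtain T d where T: "finite T" "T \<subseteq> I" "sqn M (\<lambda>x. g x - (\<Sum>i\<in>T. d i * \<phi> i x)) < e / 4"
    using closed_spanD[OF g e4] by blast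
  define s where "s x = (\<Sum>i\<in>S. c i * \<phi> i x)" for x
  define t where "t x = (\<Sum>i\<in>T. d i * \<phi> i x)" for x
  have b: "bmeas M s" "bmeas M t"
    unfolding s_def t_def using \<phi> S(2) T(2) by (auto intro!: bmeas_sum bmeas_mult)
  have eq: "(\<Sum>i\<in>S \<union> T. ((if i \<in> S then c i else 0) + (if i \<in> T then d i else 0)) * \<phi> i x) = s x + t x" for x
  proof -
    have "(\<Sum>i\<in>S \<union> T. (if i \<in> S then c i else 0) * \<phi> i x) = s x"
      unfolding s_def using S(1) T(1) by (intro sum.mono_neutral_cong_right) auto
    moreover have "(\<Sum>i\<in>S \<union> T. (if i \<in> T then d i else 0) * \<phi> i x) = t x"
      unfolding t_def using S(1) T(1) by (intro sum.mono_neutral_cong_right) auto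
    ultimately show ?thesis
      by (simp only: distrib_right sum.distrib)
  qed
  have "sqn M (\<lambda>x. (f x + g x) - (s x + t x)) \<le> 2 * sqn M (\<lambda>x. (f x + g x) - (s x + g x)) + 2 * sqn M (\<lambda>x. (s x + g x) - (s x + t x))"
    using b bf bg by (intro sqn_triangle bmeas_integrable_sq bmeas_diff bmeas_add)
  also have "\<dots> < e"
    using S(3) T(3) by (simp add: s_def t_def)
  finally show "\<exists>S c. finite S \<and> S \<subseteq> I \<and> sqn M (\<lambda>x. f x + g x - (\<Sum>i\<in>S. c i * \<phi> i x)) < e"
    using S T by (intro exI[of _ "S \<union> T"] exI[of _ "\<lambda>i. (if i \<in> S then c i else 0) + (if i \<in> T then d i else 0)"]) (simp only: eq, simp)
qed

section \<open>Exponentials and trigonometric polynomials\<close>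

lemma norm_expo [simp]: "cmod (expo l x) = 1"
  by (simp add: expo_def)

lemma expo_add: "expo (l + k) x = expo l x * expo k x"
  by (simp add: expo_def exp_add[symmetric] algebra_simps inner_add_left)

lemma cnj_expo: "cnj (expo l x) = expo (- l) x"
  by (simp add: expo_def exp_cnj)

lemma expo_diff: "expo (l - k) x = expo l x * cnj (expo k x)"
  unfolding cnj_expo by (simp flip: expo_add)

lemma expo_0 [simp]: "expo 0 x = 1"
  by (simp add: expo_def)

lemma expo_add_right: "expo l (x + y) = expo l x * expo l y"
  by (simp add: expo_def exp_add[symmetric] algebra_simps inner_add_right)

lemma expo_eq_cis: "expo l x = cis (2 * pi * (l \<bullet> x))"
  by (simp add: expo_def cis_conv_exp mult_ac)

lemma continuous_on_expo [continuous_intros]: "continuous_on S (expo l)"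
  unfolding expo_def by (intro continuous_intros)

lemma borel_measurable_expo [measurable]: "expo l \<in> borel_measurable borel"
  by (intro borel_measurable_continuous_onI continuous_intros)

text \<open>Trigonometric polynomials with arbitrary real frequencies. The inductive form lets
  closure under products and membership in a closed span be proved by rule induction.\<close>

inductive trig :: "('a::euclidean_space \<Rightarrow> complex) \<Rightarrow> bool" where
  trig_expo: "trig (\<lambda>x. c * expo l x)"
| trig_add: "trig f \<Longrightarrow> trig g \<Longrightarrow> trig (\<lambda>x. f x + g x)"

lemma trig_const: "trig (\<lambda>x. c)"
  using trig_expo[of c 0] by simp

lemma trig_mult:
  assumes "trig f" "trig g"
  shows "trig (\<lambda>x. f x * g x)"
  using assms
proof (induction rule: trig.induct)
  case (trig_expo c l)
  from trig_expo show ?case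
  proof (induction rule: trig.induct)
    case (trig_expo d k)
    have "c * expo l x * (d * expo k x) = c * d * expo (l + k) x" for x :: 'a
      by (simp add: expo_add)
    then show ?case
      by (simp only: trig.trig_expo)
  next
    case (trig_add f g)
    then show ?case
      by (auto simp only: distrib_left intro!: trig.trig_add)
  qed
next
  case (trig_add f g)
  then show ?case
    by (auto simp only: distrib_right intro!: trig.trig_add)
qed

lemma continuous_on_trig: "trig f \<Longrightarrow> continuous_on S f"
  by (induction rule: trig.induct) (auto intro!: continuous_intros)

lemma trig_dense_real:
  fixes G :: "'a::euclidean_space \<Rightarrow> real"
  assumes "compact K" "continuous_on K G" "e > 0"
  obtains p where "trig (\<lambda>x. complex_of_real (p x))" "\<And>x. x \<in> K \<Longrightarrow> \<bar>G x - p x\<bar> < e"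
proof -
  have "\<exists>p. trig (\<lambda>x. complex_of_real (p x)) \<and> (\<forall>x\<in>K. \<bar>G x - p x\<bar> < e)"
  proof (rule Stone_Weierstrass_HOL[where P = "\<lambda>p. trig (\<lambda>x. complex_of_real (p x))"])
    fix f :: "'a \<Rightarrow> real" assume "trig (\<lambda>x. complex_of_real (f x))"
    then have "continuous_on K (\<lambda>x. Re (complex_of_real (f x)))"
      by (intro continuous_intros continuous_on_trig)
    then show "continuous_on K f"
      by simp
  next
    fix x y :: 'a assume xy: "x \<in> K \<and> y \<in> K \<and> x \<noteq> y"
    \<comment> \<open>The phase of \<open>expo l\<close> differs by half a turn between
      \<open>x\<close> and \<open>y\<close>, so the cosine below is -1 at \<open>x\<close> and 1 at
      \<open>y\<close>.\<close>
    define l where "l = (1 / (2 * ((x - y) \<bullet> (x - y)))) *\<^sub>R (x - y)"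
    have l: "l \<bullet> (x - y) = 1 / 2"
      using xy by (simp add: l_def)
    define p where "p z = cos (2 * pi * (l \<bullet> (z - y)))" for z
    have "complex_of_real (p z) = (1/2 * expo l (- y)) * expo l z + (1/2 * cnj (expo l (- y))) * expo (- l) z" for z
    proof -
      have "(1/2 * expo l (- y)) * expo l z + (1/2 * cnj (expo l (- y))) * expo (- l) z
         = (expo l (z - y) + cnj (expo l (z - y))) / 2"
        by (simp add: expo_add_right[of l z "- y", simplified] cnj_expo[symmetric])
      also have "\<dots> = complex_of_real (p z)"
        by (simp add: p_def expo_eq_cis complex_eq_iff)
      finally show ?thesis ..
    qed
    then have "trig (\<lambda>z. complex_of_real (p z))"
      by (simp only: trig.intros)
    moreover have "p x \<noteq> p y"
      by (simp add: p_def l)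
    ultimately show "\<exists>f. trig (\<lambda>x. complex_of_real (f x)) \<and> f x \<noteq> f y"
      by blast
  qed (use assms in \<open>auto intro: trig_const trig_add trig_mult\<close>)
  with that show ?thesis
    by blast
qed

lemma trig_dense:
  fixes G :: "'a::euclidean_space \<Rightarrow> complex"
  assumes K: "compact K" and G: "continuous_on K G" and e: "e > 0"
  obtains p where "trig p" "\<And>x. x \<in> K \<Longrightarrow> cmod (G x - p x) < e"
proof -
  have "continuous_on K (\<lambda>x. Re (G x))" "continuous_on K (\<lambda>x. Im (G x))" "e / 2 > 0"
    using G e by (auto intro!: continuous_intros)
  then obtain p q where p: "trig (\<lambda>x. complex_of_real (p x))" "\<And>x. x \<in> K \<Longrightarrow> \<bar>Re (G x) - p x\<bar> < e / 2"
    and q: "trig (\<lambda>x. complex_of_real (q x))" "\<And>x. x \<in> K \<Longrightarrow> \<bar>Im (G x) - q x\<bar> < e / 2"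
    using trig_dense_real[OF K] by metis
  show ?thesis
  proof
    show "trig (\<lambda>x. complex_of_real (p x) + \<i> * complex_of_real (q x))"
      by (intro trig_add trig_mult trig_const p q)
    fix x assume x: "x \<in> K"
    have "cmod (G x - (complex_of_real (p x) + \<i> * complex_of_real (q x))) \<le> \<bar>Re (G x) - p x\<bar> + \<bar>Im (G x) - q x\<bar>"
      by (rule order_trans[OF cmod_le]) simp
    then show "cmod (G x - (complex_of_real (p x) + \<i> * complex_of_real (q x))) < e"
      using p(2)[OF x] q(2)[OF x] by linarith
  qed
qed

section \<open>Approximation of square-integrable functions\<close>

lemma set_integral_lebesgue_on:
  fixes f :: "'a::euclidean_space \<Rightarrow> 'b::{banach, second_countable_topology}"
  assumes "W \<in> sets lebesgue"
  shows "(LINT x:W|lebesgue. f x) = (LINT x|lebesgue_on W. f x)"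
  using assms by (simp add: integral_restrict_space set_lebesgue_integral_def)

lemma L2_on_iff:
  assumes "W \<in> sets lebesgue"
  shows "L2_on W f \<longleftrightarrow> f \<in> borel_measurable (lebesgue_on W) \<and> integrable (lebesgue_on W) (\<lambda>x. (cmod (f x))\<^sup>2)"
  using assms unfolding L2_on_def set_borel_measurable_def set_integrable_def
  by (simp add: borel_measurable_restrict_space_iff integrable_restrict_space)

lemma bmeas_lebesgue_on_continuous:
  assumes "bounded W" "continuous_on UNIV f"
  shows "bmeas (lebesgue_on W) f"
proof -
  have "compact (f ` closure W)"
    using assms by (intro compact_continuous_image) (auto intro: continuous_on_subset)
  then obtain C where "\<forall>z \<in> f ` closure W. cmod z \<le> C"
    using compact_imp_bounded bounded_iff by metis
  then have "cmod (f x) \<le> C" if "x \<in> W" for x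
    using that closure_subset by blast
  moreover have "f \<in> borel_measurable lebesgue"
    using assms(2) by (simp add: borel_measurable_continuous_onI measurable_completion)
  ultimately show ?thesis
    by (intro bmeasI[where C = C]) (auto intro: measurable_restrict_space1)
qed

lemma bmeas_expo: "bmeas (lebesgue_on W) (expo l)"
proof (rule bmeasI[where C = 1])
  have "expo l \<in> borel_measurable lebesgue"
    by (simp add: borel_measurable_expo measurable_completion)
  then show "expo l \<in> borel_measurable (lebesgue_on W)"
    by (rule measurable_restrict_space1)
qed simp

lemma approximate_by_continuous:
  assumes W: "W \<in> lmeasurable" and h: "bmeas (lebesgue_on W) h" and e: "e > 0"
  obtains g where "continuous_on UNIV g" "sqn (lebesgue_on W) (\<lambda>x. h x - g x) < e"
proof -
  let ?N = "lebesgue_on W"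
  interpret finite_measure "?N"
    using W by (rule finite_measure_lebesgue_on)
  have Ws: "W \<in> sets lebesgue"
    using W by (rule fmeasurableD)
  obtain C0 where C0: "\<forall>x\<in>W. cmod (h x) \<le> C0"
    using h unfolding bmeas_def by auto
  define C where "C = max C0 1"
  have C: "C > 0" and hC: "\<And>x. x \<in> W \<Longrightarrow> cmod (h x) \<le> C"
    using C0 unfolding C_def by force+
  \<comment> \<open>Radial retraction onto the disc of radius \<open>C\<close>. The continuous
    approximants of a measurable function need not be uniformly bounded; composing them with
    \<open>cl\<close> makes dominated convergence applicable and keeps the limit, since
    \<open>cl\<close> fixes the values of \<open>h\<close>.\<close>
  define cl where "cl z = (C / max C (cmod z)) *\<^sub>R z" for z
  have cont_cl: "continuous_on UNIV cl"
    unfolding cl_def using C by (intro continuous_intros) (auto simp: max_def)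
  have cl_id: "cl z = z" if "cmod z \<le> C" for z
    using that C by (simp add: cl_def max_def)
  have cl_bound: "cmod (cl z) \<le> C" for z
    using C by (simp add: cl_def max_def abs_mult divide_le_eq)
  have "h measurable_on W"
    using h Ws by (simp add: measurable_on_iff_borel_measurable bmeas_def)
  then obtain N g where N: "negligible N" and g: "\<And>n. continuous_on UNIV (g n)"
    and lim: "\<And>x. x \<notin> N \<Longrightarrow> (\<lambda>n. g n x) \<longlonglongrightarrow> (if x \<in> W then h x else 0)"
    unfolding measurable_on_def by blast
  have cg: "continuous_on UNIV (\<lambda>x. cl (g n x))" for n
    using continuous_on_compose2[OF cont_cl g[of n]] by simp
  have "(\<lambda>n. LINT x|?N. (cmod (h x - cl (g n x)))\<^sup>2) \<longlonglongrightarrow> (LINT x|?N. 0)"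
  proof (rule integral_dominated_convergence[where w = "\<lambda>_. (2 * C)\<^sup>2"])
    show "(\<lambda>x. (cmod (h x - cl (g n x)))\<^sup>2) \<in> borel_measurable ?N" for n
    proof -
      have "(\<lambda>x. cl (g n x)) \<in> borel_measurable lebesgue"
        using cg[of n] by (simp add: borel_measurable_continuous_onI measurable_completion)
      then have "(\<lambda>x. cl (g n x)) \<in> borel_measurable ?N"
        by (rule measurable_restrict_space1)
      then show ?thesis
        using bmeas_measurable[OF h] by measurable
    qed
    show "AE x in ?N. (\<lambda>n. (cmod (h x - cl (g n x)))\<^sup>2) \<longlonglongrightarrow> 0"
    proof -
      have "AE x in lebesgue. x \<notin> N"
        using N by (simp add: AE_not_in negligible_iff_null_sets)
      then have "AE x in lebesgue. x \<in> W \<longrightarrow> (\<lambda>n. (cmod (h x - cl (g n x)))\<^sup>2) \<longlonglongrightarrow> 0"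
      proof (eventually_elim, intro impI)
        fix x assume x: "x \<notin> N" "x \<in> W"
        have "(\<lambda>n. cl (g n x)) \<longlonglongrightarrow> cl (h x)"
          using lim[OF x(1)] x(2) cont_cl
          by (intro isCont_tendsto_compose[where g = cl]) (auto simp: continuous_on_eq_continuous_at)
        then have "(\<lambda>n. (cmod (h x - cl (g n x)))\<^sup>2) \<longlonglongrightarrow> (cmod (h x - cl (h x)))\<^sup>2"
          by (intro tendsto_intros)
        then show "(\<lambda>n. (cmod (h x - cl (g n x)))\<^sup>2) \<longlonglongrightarrow> 0"
          using cl_id[OF hC[OF x(2)]] by simp
      qed
      then show ?thesis
        using Ws by (simp add: AE_restrict_space_iff)
    qed
    show "AE x in ?N. norm ((cmod (h x - cl (g n x)))\<^sup>2) \<le> (2 * C)\<^sup>2" for n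
    proof (rule AE_I2)
      fix x assume "x \<in> space ?N"
      then have "cmod (h x - cl (g n x)) \<le> 2 * C"
        using norm_triangle_ineq4[of "h x" "cl (g n x)"] hC[of x] cl_bound[of "g n x"] by simp
      then have "(cmod (h x - cl (g n x)))\<^sup>2 \<le> (2 * C)\<^sup>2"
        by (intro power_mono) auto
      then show "norm ((cmod (h x - cl (g n x)))\<^sup>2) \<le> (2 * C)\<^sup>2"
        by simp
    qed
  qed simp_all
  then have "(\<lambda>n. sqn ?N (\<lambda>x. h x - cl (g n x))) \<longlonglongrightarrow> 0"
    by (simp add: sqn_def)
  then have "eventually (\<lambda>n. sqn ?N (\<lambda>x. h x - cl (g n x)) < e) sequentially"
    using e by (rule order_tendstoD)
  then obtain n where "sqn ?N (\<lambda>x. h x - cl (g n x)) < e"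
    by (auto simp: eventually_sequentially)
  with cg[of n] that show ?thesis
    by blast
qed

lemma approximate_by_bounded:
  assumes W: "W \<in> lmeasurable" and f: "L2_on W f" and e: "e > 0"
  obtains h where "bmeas (lebesgue_on W) h" "integrable (lebesgue_on W) (\<lambda>x. (cmod (f x - h x))\<^sup>2)"
    "sqn (lebesgue_on W) (\<lambda>x. f x - h x) < e"
proof -
  let ?N = "lebesgue_on W"
  have Ws: "W \<in> sets lebesgue"
    using W by (rule fmeasurableD)
  have fm [measurable]: "f \<in> borel_measurable ?N"
    and fi: "integrable ?N (\<lambda>x. (cmod (f x))\<^sup>2)"
    using f Ws by (auto simp: L2_on_iff)
  define h where "h n x = (if cmod (f x) \<le> real n then f x else 0)" for n x
  have hm [measurable]: "h n \<in> borel_measurable ?N" for n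
    unfolding h_def by measurable
  have dom: "(cmod (f x - h n x))\<^sup>2 \<le> (cmod (f x))\<^sup>2" for n x
    by (simp add: h_def)
  have "(\<lambda>n. LINT x|?N. (cmod (f x - h n x))\<^sup>2) \<longlonglongrightarrow> (LINT x|?N. 0)"
  proof (rule integral_dominated_convergence[OF _ _ fi])
    show "AE x in ?N. (\<lambda>n. (cmod (f x - h n x))\<^sup>2) \<longlonglongrightarrow> 0"
    proof (rule AE_I2, rule tendsto_eventually)
      fix x
      obtain n0 :: nat where "cmod (f x) \<le> real n0"
        using real_arch_simple by blast
      then show "\<forall>\<^sub>F n in sequentially. (cmod (f x - h n x))\<^sup>2 = 0"
        by (intro eventually_sequentiallyI[of n0]) (auto simp: h_def)
    qed
  qed (use dom in auto)
  then have "(\<lambda>n. sqn ?N (\<lambda>x. f x - h n x)) \<longlonglongrightarrow> 0"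
    by (simp add: sqn_def)
  then have "eventually (\<lambda>n. sqn ?N (\<lambda>x. f x - h n x) < e) sequentially"
    using e by (rule order_tendstoD)
  then obtain n where n: "sqn ?N (\<lambda>x. f x - h n x) < e"
    by (auto simp: eventually_sequentially)
  show ?thesis
  proof (rule that[of "h n", OF _ _ n])
    show "bmeas ?N (h n)"
      by (rule bmeasI[OF hm, where C = "real n"]) (simp add: h_def)
    show "integrable ?N (\<lambda>x. (cmod (f x - h n x))\<^sup>2)"
      by (rule Bochner_Integration.integrable_bound[OF fi]) (use dom in auto)
  qed
qed

text \<open>The closed span is enlarged in four stages: trigonometric polynomials by linearity,
  continuous functions by Stone-Weierstrass on the compact closure of \<open>W\<close>, bounded
  measurable functions, and finally square-integrable ones by truncation.\<close>

lemma closed_span_L2: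
  assumes W: "W \<in> lmeasurable" "bounded W" and f: "L2_on W f"
    and \<Lambda>: "\<And>x. closed_span (lebesgue_on W) \<Lambda> expo (expo x)"
  shows "closed_span (lebesgue_on W) \<Lambda> expo f"
proof -
  let ?N = "lebesgue_on W"
  let ?cl = "closed_span ?N \<Lambda> expo"
  interpret finite_measure "?N"
    using W(1) by (rule finite_measure_lebesgue_on)
  have bt: "bmeas ?N p" if "trig p" for p
    using that W by (intro bmeas_lebesgue_on_continuous continuous_on_trig)
  have tr: "?cl p" if "trig p" for p
    using that by (induction rule: trig.induct) (auto intro!: closed_span_add closed_span_cmult \<Lambda> bmeas_expo bt trig.intros)
  have co: "?cl g" if g: "continuous_on UNIV g" for g
  proof (rule closed_span_limit)
    fix e :: real assume e: "e > 0"
    define m where "m = measure ?N W + 1"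
    have m: "m > 0"
      by (simp add: m_def add_nonneg_pos)
    have "sqrt (e / m) > 0"
      using e m by simp
    moreover have "compact (closure W)"
      using W(2) by simp
    ultimately obtain p where p: "trig p" "\<And>x. x \<in> closure W \<Longrightarrow> cmod (g x - p x) < sqrt (e / m)"
      using trig_dense continuous_on_subset[OF g, of "closure W"] by blast
    have bd: "bmeas ?N (\<lambda>x. g x - p x)"
      by (intro bmeas_diff bmeas_lebesgue_on_continuous[OF W(2) g] bt[OF p(1)])
    have "sqn ?N (\<lambda>x. g x - p x) \<le> (LINT x|?N. e / m)"
      unfolding sqn_def
    proof (rule integral_mono)
      fix x assume "x \<in> space ?N"
      then have "cmod (g x - p x) \<le> sqrt (e / m)"
        using p(2)[of x] closure_subset[of W] by force
      then have "(cmod (g x - p x))\<^sup>2 \<le> (sqrt (e / m))\<^sup>2"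
        by (intro power_mono) auto
      then show "(cmod (g x - p x))\<^sup>2 \<le> e / m"
        using e m by simp
    qed (use bmeas_integrable_sq[OF bd] in auto)
    also have "\<dots> = measure ?N W * (e / m)"
      by simp
    also have "\<dots> < m * (e / m)"
      using e m by (intro mult_strict_right_mono) (auto simp: m_def)
    finally show "\<exists>p. bmeas ?N p \<and> ?cl p \<and>
        integrable ?N (\<lambda>x. (cmod (g x - p x))\<^sup>2) \<and> sqn ?N (\<lambda>x. g x - p x) < e"
      using m bt[OF p(1)] tr[OF p(1)] bmeas_integrable_sq[OF bd] by (intro exI[of _ p]) auto
  qed (rule bmeas_expo)
  have bo: "?cl h" if h: "bmeas ?N h" for h
  proof (rule closed_span_limit)
    fix e :: real assume e: "e > 0"
    obtain g where g: "continuous_on UNIV g" "sqn ?N (\<lambda>x. h x - g x) < e"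
      using approximate_by_continuous[OF W(1) h e] by blast
    have bg: "bmeas ?N g"
      using W(2) g(1) by (rule bmeas_lebesgue_on_continuous)
    then show "\<exists>g. bmeas ?N g \<and> ?cl g \<and>
        integrable ?N (\<lambda>x. (cmod (h x - g x))\<^sup>2) \<and> sqn ?N (\<lambda>x. h x - g x) < e"
      using g co[OF g(1)] bmeas_integrable_sq[OF bmeas_diff[OF h bg]] by blast
  qed (rule bmeas_expo)
  show ?thesis
  proof (rule closed_span_limit)
    fix e :: real assume e: "e > 0"
    obtain h where "bmeas ?N h" "integrable ?N (\<lambda>x. (cmod (f x - h x))\<^sup>2)"
      "sqn ?N (\<lambda>x. f x - h x) < e"
      using approximate_by_bounded[OF W(1) f e] by blast
    with bo[of h] show "\<exists>h. bmeas ?N h \<and> ?cl h \<and>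
        integrable ?N (\<lambda>x. (cmod (f x - h x))\<^sup>2) \<and> sqn ?N (\<lambda>x. f x - h x) < e"
      by blast
  qed (rule bmeas_expo)
qed

section \<open>Spectra and the tiling identity\<close>

text \<open>The positive sign in the exponent makes the inner product of the exponentials of
  frequencies \<open>l\<close> and \<open>k\<close> over \<open>A\<close> equal to
  \<open>ft A (l - k)\<close> (\<open>ip_expo\<close>).\<close>

definition ft :: "'a::euclidean_space set \<Rightarrow> 'a \<Rightarrow> complex" where
  "ft A x = (LINT t:A|lebesgue. expo x t)"

lemma ft_lebesgue_on: "A \<in> sets lebesgue \<Longrightarrow> ft A x = (LINT t|lebesgue_on A. expo x t)"
  unfolding ft_def by (rule set_integral_lebesgue_on)

lemma ip_expo: "A \<in> sets lebesgue \<Longrightarrow> ip (lebesgue_on A) (expo l) (expo k) = ft A (l - k)"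
  by (simp add: ft_lebesgue_on ip_def expo_diff)

lemma measure_lebesgue_on_space: "A \<in> sets lebesgue \<Longrightarrow> measure (lebesgue_on A) A = measure lebesgue A"
  by (simp add: measure_restrict_space)

lemma ft_0: "A \<in> sets lebesgue \<Longrightarrow> ft A 0 = of_real (measure lebesgue A)"
  by (simp add: ft_lebesgue_on measure_lebesgue_on_space scaleR_conv_of_real)

lemma ft_minus: "ft A (- x) = cnj (ft A x)"
proof -
  have "ft A (- x) = (LINT t|lebesgue. cnj (indicator A t *\<^sub>R expo x t))"
    by (simp add: ft_def set_lebesgue_integral_def cnj_expo)
  also have "\<dots> = cnj (ft A x)"
    unfolding ft_def set_lebesgue_integral_def by (rule Bochner_Integration.integral_cnj)
  finally show ?thesis .
qed

lemma sqn_expo: "A \<in> sets lebesgue \<Longrightarrow> sqn (lebesgue_on A) (expo l) = measure lebesgue A"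
  by (simp add: sqn_def measure_lebesgue_on_space)

lemma orth_system_expo:
  assumes W: "W \<in> lmeasurable" and pos: "measure lebesgue W > 0"
    and \<Lambda>: "\<And>l k. l \<in> \<Lambda> \<Longrightarrow> k \<in> \<Lambda> \<Longrightarrow> l \<noteq> k \<Longrightarrow> ft W (l - k) = 0"
  shows "orth_system (lebesgue_on W) \<Lambda> expo (measure lebesgue W)"
proof -
  interpret finite_measure "lebesgue_on W"
    using W by (rule finite_measure_lebesgue_on)
  show ?thesis
  proof
    show "ip (lebesgue_on W) (expo l) (expo k) = (if l = k then complex_of_real (measure lebesgue W) else 0)"
      if "l \<in> \<Lambda>" "k \<in> \<Lambda>" for l k
      using \<Lambda>[OF that] fmeasurableD[OF W] by (auto simp: ip_expo ft_0)
  qed (use pos in \<open>auto intro: bmeas_expo\<close>)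
qed

lemma is_spectrum_orth:
  assumes "W \<in> sets lebesgue" "is_spectrum W \<Lambda>" "l \<in> \<Lambda>" "k \<in> \<Lambda>" "l \<noteq> k"
  shows "ft W (l - k) = 0"
  using assms unfolding is_spectrum_def by (auto simp: ft_def expo_diff)

lemma is_spectrum_closed_span:
  assumes W: "W \<in> lmeasurable" and "is_spectrum W \<Lambda>" and f: "bmeas (lebesgue_on W) f"
  shows "closed_span (lebesgue_on W) \<Lambda> expo f"
proof -
  interpret finite_measure "lebesgue_on W"
    using W by (rule finite_measure_lebesgue_on)
  have Ws: "W \<in> sets lebesgue"
    using W by (rule fmeasurableD)
  have "L2_on W f"
    using f Ws bmeas_integrable_sq[OF f] by (simp add: L2_on_iff bmeas_measurable)
  then show ?thesis
    using assms(2) Ws unfolding is_spectrum_def closed_span_def sqn_def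
    by (simp add: set_integral_lebesgue_on)
qed

lemma is_spectrumI:
  assumes W: "W \<in> lmeasurable" "bounded W"
    and orth: "\<And>l k. l \<in> \<Lambda> \<Longrightarrow> k \<in> \<Lambda> \<Longrightarrow> l \<noteq> k \<Longrightarrow> ft W (l - k) = 0"
    and span: "\<And>x. closed_span (lebesgue_on W) \<Lambda> expo (expo x)"
  shows "is_spectrum W \<Lambda>"
  unfolding is_spectrum_def
proof (intro conjI ballI impI allI)
  fix l k assume "l \<in> \<Lambda>" "k \<in> \<Lambda>" "l \<noteq> k"
  then show "(LINT x:W|lebesgue. expo l x * cnj (expo k x)) = 0"
    using orth by (simp add: ft_def expo_diff)
next
  fix f and e :: real assume f: "L2_on W f" and e: "e > 0"
  have "closed_span (lebesgue_on W) \<Lambda> expo f"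
    using W f span by (rule closed_span_L2)
  then show "\<exists>S c. finite S \<and> S \<subseteq> \<Lambda> \<and> (LINT x:W|lebesgue. (cmod (f x - (\<Sum>l\<in>S. c l * expo l x)))\<^sup>2) < e"
    using e fmeasurableD[OF W(1)] unfolding closed_span_def sqn_def by (simp add: set_integral_lebesgue_on)
qed

text \<open>Parseval's identity for the exponential of frequency \<open>x\<close>, whose
  coefficients are \<open>ft W (x - l)\<close>. One factor \<open>measure lebesgue W\<close> is the
  squared norm of the basis vectors, the other that of \<open>expo x\<close>.\<close>

lemma spectrum_tiling:
  assumes W: "W \<in> lmeasurable" "measure lebesgue W > 0" and \<Lambda>: "is_spectrum W \<Lambda>"
  shows "((\<lambda>l. (cmod (ft W (x - l)))\<^sup>2) has_sum (measure lebesgue W)\<^sup>2) \<Lambda>"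
proof -
  have Ws: "W \<in> sets lebesgue"
    using W(1) by (rule fmeasurableD)
  interpret orth_system "lebesgue_on W" \<Lambda> expo "measure lebesgue W"
    using W is_spectrum_orth[OF Ws \<Lambda>] by (rule orth_system_expo)
  show ?thesis
    using parseval[OF bmeas_expo[of W x]] is_spectrum_closed_span[OF W(1) \<Lambda> bmeas_expo[of W x]]
    by (simp add: closed_span_def ip_expo sqn_expo Ws power2_eq_square)
qed

text \<open>The converse of \<open>spectrum_tiling\<close>: a sum within \<open>e\<close> of 1, the
  squared norm of \<open>expo x\<close>, leaves a residual of squared norm below
  \<open>e\<close>.\<close>

lemma closed_span_tiling:
  assumes W: "W \<in> lmeasurable" "measure lebesgue W = 1"
    and orth: "\<And>l k. l \<in> \<Lambda> \<Longrightarrow> k \<in> \<Lambda> \<Longrightarrow> l \<noteq> k \<Longrightarrow> ft W (l - k) = 0"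
    and tile: "\<And>e. e > 0 \<Longrightarrow> \<exists>S. finite S \<and> S \<subseteq> \<Lambda> \<and> 1 - e < (\<Sum>l\<in>S. (cmod (ft W (x - l)))\<^sup>2)"
  shows "closed_span (lebesgue_on W) \<Lambda> expo (expo x)"
proof -
  have Ws: "W \<in> sets lebesgue"
    using W(1) by (rule fmeasurableD)
  interpret orth_system "lebesgue_on W" \<Lambda> expo 1
    using orth_system_expo[OF W(1) _ orth] W(2) by simp
  show ?thesis
    unfolding closed_span_def
  proof (intro allI impI)
    fix e :: real assume e: "e > 0"
    then obtain S where S: "finite S" "S \<subseteq> \<Lambda>" "1 - e < (\<Sum>l\<in>S. (cmod (ft W (x - l)))\<^sup>2)"
      using tile by blast
    have "sqn (lebesgue_on W) (\<lambda>t. expo x t - (\<Sum>l\<in>S. ip (lebesgue_on W) (expo x) (expo l) / complex_of_real 1 * expo l t)) < e"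
      by (rule parseval_appr[OF bmeas_expo e S(1,2)]) (use S(3) in \<open>simp add: ip_expo sqn_expo Ws W(2)\<close>)
    with S(1,2) show "\<exists>S c. finite S \<and> S \<subseteq> \<Lambda> \<and> sqn (lebesgue_on W) (\<lambda>t. expo x t - (\<Sum>l\<in>S. c l * expo l t)) < e"
      by (intro exI[of _ S] exI[of _ "\<lambda>l. ip (lebesgue_on W) (expo x) (expo l) / complex_of_real 1"] conjI)
  qed
qed

lemma cmod_expo_diff: "cmod (expo x t - expo y t) \<le> 2 * pi * \<bar>(x - y) \<bullet> t\<bar>"
proof -
  have "cmod (cis a - cis b) \<le> \<bar>a - b\<bar>" for a b
  proof -
    have "cis a - cis b = cis b * (cis (a - b) - 1)"
      by (simp add: algebra_simps cis_mult)
    then have "cmod (cis a - cis b) = cmod (exp (\<i> * of_real (a - b)) - 1)"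
      by (simp add: norm_mult cis_conv_exp)
    also have "\<dots> \<le> \<bar>a - b\<bar>"
      unfolding dist_exp_i_1 using abs_sin_x_le_abs_x[of "(a - b) / 2"] by simp
    finally show ?thesis .
  qed
  then have "cmod (expo x t - expo y t) \<le> \<bar>2 * pi * (x \<bullet> t) - 2 * pi * (y \<bullet> t)\<bar>"
    unfolding expo_eq_cis .
  also have "\<dots> = 2 * pi * \<bar>(x - y) \<bullet> t\<bar>"
    by (simp add: inner_diff_left abs_mult flip: right_diff_distrib)
  finally show ?thesis .
qed

lemma ft_lipschitz:
  fixes A :: "real set"
  assumes A: "A \<in> lmeasurable" "A \<subseteq> {-R..R}"
  shows "cmod (ft A x - ft A y) \<le> 2 * pi * \<bar>x - y\<bar> * R * measure lebesgue A"
proof -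
  interpret finite_measure "lebesgue_on A"
    using A(1) by (rule finite_measure_lebesgue_on)
  have As: "A \<in> sets lebesgue"
    using A(1) by (rule fmeasurableD)
  have "ft A x - ft A y = (LINT t|lebesgue_on A. expo x t - expo y t)"
    using Bochner_Integration.integral_diff[OF bmeas_integrable[OF bmeas_expo] bmeas_integrable[OF bmeas_expo], of x y]
      ft_lebesgue_on[OF As] by simp
  then have "cmod (ft A x - ft A y) \<le> (LINT t|lebesgue_on A. cmod (expo x t - expo y t))"
    by (simp only: integral_norm_bound)
  also have "\<dots> \<le> (LINT t|lebesgue_on A. 2 * pi * (\<bar>x - y\<bar> * R))"
  proof (rule integral_mono)
    fix t assume "t \<in> space (lebesgue_on A)"
    then have "\<bar>t\<bar> \<le> R"
      using A(2) by fastforce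
    then have "2 * pi * \<bar>(x - y) \<bullet> t\<bar> \<le> 2 * pi * (\<bar>x - y\<bar> * R)"
      by (intro mult_left_mono) (auto simp: abs_mult intro: mult_left_mono)
    with cmod_expo_diff[of x t y] show "cmod (expo x t - expo y t) \<le> 2 * pi * (\<bar>x - y\<bar> * R)"
      by (rule order_trans)
  qed (auto intro!: integrable_norm bmeas_integrable bmeas_diff bmeas_expo)
  also have "\<dots> = 2 * pi * \<bar>x - y\<bar> * R * measure lebesgue A"
    by (simp add: measure_lebesgue_on_space As)
  finally show ?thesis .
qed

subsection \<open>Intervals\<close>

lemma ft_interval:
  fixes x :: real
  assumes "a \<le> b" "x \<noteq> 0"
  shows "ft {a..b} x = (expo x b - expo x a) / (2 * pi * \<i> * x)"
proof -
  have "ft {a..b} x = (LINT t|lborel. indicator {a..b} t *\<^sub>R expo x t)"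
    unfolding ft_def set_lebesgue_integral_def
    by (rule integral_completion) (auto intro!: borel_measurable_scaleR borel_measurable_expo)
  also have "\<dots> = expo x b / (2 * pi * \<i> * x) - expo x a / (2 * pi * \<i> * x)"
  proof (rule integral_FTC_Icc[OF assms(1)])
    show "((\<lambda>t. expo x t / (2 * pi * \<i> * x)) has_vector_derivative expo x t) (at t within {a..b})" for t
    proof -
      have "((\<lambda>z. exp (2 * pi * \<i> * x * z) / (2 * pi * \<i> * x)) has_field_derivative exp (2 * pi * \<i> * x * of_real t))
        (at (of_real t))"
        using assms(2) by (auto intro!: derivative_eq_intros)
      then show ?thesis
        by (drule_tac has_vector_derivative_real_field) (simp add: expo_def mult.assoc)
    qed
  qed (intro continuous_intros)
  finally show ?thesis
    by (simp add: diff_divide_distrib)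
qed

lemma cmod_ft_interval:
  fixes x :: real
  assumes "a \<le> b" "x \<noteq> 0"
  shows "(cmod (ft {a..b} x))\<^sup>2 = (sin (pi * x * (b - a)) / (pi * x))\<^sup>2"
proof -
  have "(cmod (expo x b - expo x a))\<^sup>2 = 2 - 2 * cos (2 * (pi * x * (b - a)))"
    unfolding expo_eq_cis cmod_power2
    by (simp add: algebra_simps power2_eq_square cos_diff)
  also have "\<dots> = (2 * sin (pi * x * (b - a)))\<^sup>2"
    by (simp add: cos_double_sin power_mult_distrib)
  finally have "(cmod (expo x b - expo x a))\<^sup>2 = (2 * sin (pi * x * (b - a)))\<^sup>2" .
  then show ?thesis
    unfolding ft_interval[OF assms] norm_divide power_divide
    by (simp add: norm_mult power_mult_distrib)
qed

lemma cmod_ft_le: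
  assumes "A \<in> lmeasurable"
  shows "cmod (ft A x) \<le> measure lebesgue A"
proof -
  interpret finite_measure "lebesgue_on A"
    using assms by (rule finite_measure_lebesgue_on)
  have "cmod (ft A x) \<le> (LINT t|lebesgue_on A. cmod (expo x t))"
    unfolding ft_lebesgue_on[OF fmeasurableD[OF assms]] by (rule integral_norm_bound)
  then show ?thesis
    by (simp add: measure_lebesgue_on_space fmeasurableD[OF assms])
qed

text \<open>The sum of the trivial bound \<open>b - a\<close> and the bound 1 for
  \<open>\<bar>x\<bar> * cmod (ft {a..b} x)\<close>; the denominator
  \<open>1 + \<bar>x\<bar>\<close> makes one formula serve near 0 and at infinity.\<close>

lemma cmod_ft_interval_le:
  fixes x :: real
  assumes "a \<le> b"
  shows "cmod (ft {a..b} x) \<le> (b - a + 1) / (1 + \<bar>x\<bar>)"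
proof (cases "x = 0")
  case True
  have "cmod (ft {a..b} x) \<le> measure lebesgue {a..b}"
    by (intro cmod_ft_le) simp
  with True assms show ?thesis
    by simp
next
  case False
  have m: "cmod (ft {a..b} x) \<le> b - a"
    using cmod_ft_le[of "{a..b}" x] assms by simp
  have "cmod (expo x b - expo x a) \<le> 2"
    using norm_triangle_ineq4[of "expo x b" "expo x a"] by simp
  then have "cmod (expo x b - expo x a) / (2 * pi * \<bar>x\<bar>) \<le> 2 / (2 * pi * \<bar>x\<bar>)"
    by (intro divide_right_mono) auto
  then have "cmod (ft {a..b} x) \<le> 2 / (2 * pi * \<bar>x\<bar>)"
    unfolding ft_interval[OF assms False] norm_divide by (simp add: norm_mult)
  also have "\<dots> \<le> 1 / \<bar>x\<bar>"
    using False pi_gt3 by (simp add: field_simps)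
  finally have "\<bar>x\<bar> * cmod (ft {a..b} x) \<le> 1"
    using False by (simp add: field_simps)
  with m have "(1 + \<bar>x\<bar>) * cmod (ft {a..b} x) \<le> b - a + 1"
    by (simp add: distrib_right)
  then show ?thesis
    by (simp add: field_simps)
qed

abbreviation sinc2 :: "real \<Rightarrow> real" where
  "sinc2 x \<equiv> (cmod (ft {0..1} x))\<^sup>2"

lemma sinc2_0: "sinc2 0 = 1"
  by (simp add: ft_0)

lemma sinc2_int: "n \<noteq> 0 \<Longrightarrow> sinc2 (of_int n) = 0"
  by (subst cmod_ft_interval) (auto simp: sin_integer_2pi sin_zero_iff_int2)

lemma sinc2_pos: "x \<notin> \<int> \<Longrightarrow> sinc2 x > 0"
proof -
  assume x: "x \<notin> \<int>"
  then have "x \<noteq> 0"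
    by auto
  moreover have "sin (pi * x) \<noteq> 0"
    using x by (auto simp: sin_zero_iff_int2)
  ultimately show ?thesis
    by (subst cmod_ft_interval) auto
qed

lemma sinc2_double: "sinc2 (2 * u) = (cos (pi * u))\<^sup>2 * sinc2 u"
proof (cases "u = 0")
  case False
  have "sin (pi * (2 * u)) = 2 * sin (pi * u) * cos (pi * u)"
    using sin_double[of "pi * u"] by (simp add: mult.left_commute)
  then have "(sin (pi * (2 * u)) / (pi * (2 * u)))\<^sup>2 = (cos (pi * u))\<^sup>2 * (sin (pi * u) / (pi * u))\<^sup>2"
    using False by (simp add: power_divide power_mult_distrib)
  with False show ?thesis
    using cmod_ft_interval[of 0 1 "2 * u"] cmod_ft_interval[of 0 1 u] by simp
qed (simp add: sinc2_0)

lemma sinc2_near_0: "sinc2 x \<ge> 1 - 4 * pi * \<bar>x\<bar>"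
proof -
  have "cmod (ft {0..1} (0::real) - ft {0..1} x) \<le> 2 * pi * \<bar>0 - x\<bar> * 1 * measure lebesgue {0..1::real}"
    by (intro ft_lipschitz) auto
  then have "cmod (ft {0..1} x) \<ge> 1 - 2 * pi * \<bar>x\<bar>"
    using norm_triangle_ineq2[of "ft {0..1} (0::real)" "ft {0..1} x"] by (simp add: ft_0)
  moreover have "sinc2 x \<ge> 2 * cmod (ft {0..1} x) - 1"
    using sum_squares_bound[of "cmod (ft {0..1} x)" 1] by simp
  ultimately show ?thesis
    by linarith
qed

lemma sinc2_bessel:
  assumes "finite S"
  shows "(\<Sum>n\<in>S. sinc2 (x - of_int n)) \<le> 1"
proof -
  interpret orth_system "lebesgue_on {0..1::real}" "range of_int" expo 1
    using orth_system_expo[of "{0..1::real}" "range of_int"]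
  proof -
    have "ft {0..1} (l - k) = 0" if "l \<in> range of_int" "k \<in> range of_int" "l \<noteq> k" for l k :: real
    proof -
      from that obtain i j where "l = of_int i" "k = of_int j" "i \<noteq> j"
        by auto
      then show ?thesis
        using sinc2_int[of "i - j"] by simp
    qed
    then show "orth_system (lebesgue_on {0..1::real}) (range of_int) expo 1"
      using orth_system_expo[of "{0..1::real}" "range of_int"] by simp
  qed
  have "(\<Sum>n\<in>S. sinc2 (x - of_int n)) = (\<Sum>l\<in>of_int ` S. (cmod (ip (lebesgue_on {0..1::real}) (expo x) (expo l)))\<^sup>2)"
    by (subst sum.reindex) (auto simp: ip_expo inj_on_def)
  also have "\<dots> \<le> 1 * sqn (lebesgue_on {0..1}) (expo x)"
    using assms by (intro bessel bmeas_expo) auto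
  finally show ?thesis
    by (simp add: sqn_expo)
qed

text \<open>By Bessel's inequality the defect \<open>D = 1 - T\<close> is nonnegative; the duplication formula for the sine writes
  \<open>D x\<close> as a convex combination of \<open>D (x / 2)\<close> and \<open>D ((x + 1) / 2)\<close>, so if \<open>sup D\<close> were positive, repeated halving
  would contradict the fact that \<open>D\<close> tends to \<open>0\<close> at \<open>0\<close>.\<close>

lemma sinc2_tiling: "((\<lambda>n. sinc2 (x - of_int n)) has_sum 1) UNIV"
proof -
  define T where "T x = (\<Sum>\<^sub>\<infinity>n. sinc2 (x - of_int n))" for x
  define D where "D x = 1 - T x" for x
  have T: "((\<lambda>n. sinc2 (x - of_int n)) has_sum T x) UNIV" for x
    unfolding T_def
    by (intro has_sum_infsum nonneg_bdd_above_summable_on bdd_aboveI2[where M = 1]) (auto intro: sinc2_bessel)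
  have D0: "D x \<ge> 0" and D1: "D x \<le> 1 - sinc2 x" for x
  proof -
    show "D x \<ge> 0"
      using has_sum_le_finite_sums[OF T[of x], of 1] sinc2_bessel[of _ x] by (simp add: D_def)
    show "D x \<le> 1 - sinc2 x"
      using finite_sum_le_has_sum[OF T[of x], of "{0}"] by (simp add: D_def)
  qed
  have per: "D (x - of_int k) = D x" for x k
  proof -
    have "((\<lambda>n. sinc2 (x - of_int (k + n))) has_sum T x) UNIV"
      using T[of x] by (subst has_sum_reindex_bij_betw[of "\<lambda>n. k + n" UNIV UNIV]) (auto simp: bij_plus_right)
    then have "((\<lambda>n. sinc2 (x - of_int k - of_int n)) has_sum T x) UNIV"
      by (simp add: diff_diff_eq)
    with T[of "x - of_int k"] show ?thesis
      by (metis D_def has_sum_unique)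
  qed
  \<comment> \<open>Splitting \<open>n\<close> by parity turns each half into a tiling sum at half
    the scale. Odd numbers are written \<open>2 * m - 1\<close> so that their arguments are twice
    \<open>(x + 1) / 2 - m\<close>; the shift by 1/2 turns the cosine into a sine.\<close>
  have split: "D x = (cos (pi * x / 2))\<^sup>2 * D (x / 2) + (sin (pi * x / 2))\<^sup>2 * D ((x + 1) / 2)" for x
  proof -
    have cos_shift: "(cos (a - pi * of_int m))\<^sup>2 = (cos a)\<^sup>2" for a and m :: int
    proof -
      have s: "sin (pi * of_int m) = 0"
        by (auto simp: sin_zero_iff_int2)
      have "(cos (pi * of_int m))\<^sup>2 = 1"
        by (simp add: cos_squared_eq s)
      then show ?thesis
        by (simp add: cos_diff s power_mult_distrib)
    qed
    have even: "((\<lambda>m. sinc2 (x - of_int (2 * m))) has_sum (cos (pi * x / 2))\<^sup>2 * T (x / 2)) UNIV"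
    proof -
      have "sinc2 (x - of_int (2 * m)) = (cos (pi * x / 2))\<^sup>2 * sinc2 (x / 2 - of_int m)" for m
        using sinc2_double[of "x / 2 - of_int m"] cos_shift[of "pi * x / 2" m] by (simp add: right_diff_distrib)
      then show ?thesis
        using has_sum_cmult_right[OF T[of "x / 2"]] by simp
    qed
    have odd: "((\<lambda>m. sinc2 (x - of_int (2 * m - 1))) has_sum (sin (pi * x / 2))\<^sup>2 * T ((x + 1) / 2)) UNIV"
    proof -
      have "sinc2 (x - of_int (2 * m - 1)) = (sin (pi * x / 2))\<^sup>2 * sinc2 ((x + 1) / 2 - of_int m)" for m
      proof -
        have "2 * ((x + 1) / 2 - of_int m) = x - of_int (2 * m - 1)"
          by (simp add: field_simps)
        moreover have "pi * ((x + 1) / 2 - of_int m) = (pi * x / 2 + pi / 2) - pi * of_int m"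
          by (simp add: field_simps)
        moreover have "(cos (pi * x / 2 + pi / 2))\<^sup>2 = (sin (pi * x / 2))\<^sup>2"
          by (simp add: cos_add)
        ultimately show ?thesis
          using sinc2_double[of "(x + 1) / 2 - of_int m"] cos_shift[of "pi * x / 2 + pi / 2" m]
          by (simp only:)
      qed
      then show ?thesis
        using has_sum_cmult_right[OF T[of "(x + 1) / 2"]] by simp
    qed
    have "((\<lambda>n. sinc2 (x - of_int n)) has_sum (cos (pi * x / 2))\<^sup>2 * T (x / 2)) (range (\<lambda>m. 2 * m))"
      using even by (subst has_sum_reindex) (auto simp: inj_on_def o_def)
    moreover have "((\<lambda>n. sinc2 (x - of_int n)) has_sum (sin (pi * x / 2))\<^sup>2 * T ((x + 1) / 2)) (range (\<lambda>m. 2 * m - 1))"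
      using odd by (subst has_sum_reindex) (auto simp: inj_on_def o_def)
    ultimately have "((\<lambda>n. sinc2 (x - of_int n)) has_sum
        (cos (pi * x / 2))\<^sup>2 * T (x / 2) + (sin (pi * x / 2))\<^sup>2 * T ((x + 1) / 2)) (range (\<lambda>m. 2 * m) \<union> range (\<lambda>m. 2 * m - 1))"
      by (rule has_sum_Un_disjoint) (auto, presburger)
    also have "range (\<lambda>m. 2 * m) \<union> range (\<lambda>m. 2 * m - 1) = (UNIV :: int set)"
    proof -
      have "n \<in> range (\<lambda>m. 2 * m) \<union> range (\<lambda>m. 2 * m - 1)" for n :: int
        by (cases "even n") (auto elim!: evenE oddE simp: image_iff, presburger)
      then show ?thesis
        by blast
    qed
    finally have "T x = (cos (pi * x / 2))\<^sup>2 * T (x / 2) + (sin (pi * x / 2))\<^sup>2 * T ((x + 1) / 2)"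
      using T[of x] has_sum_unique by blast
    moreover have "(cos (pi * x / 2))\<^sup>2 + (sin (pi * x / 2))\<^sup>2 = 1"
      by simp
    ultimately show ?thesis
      unfolding D_def right_diff_distrib by linarith
  qed
  define M where "M = (SUP x. D x)"
  have bdd: "bdd_above (range D)"
  proof (rule bdd_aboveI2[where M = 1])
    show "D x \<le> 1" for x
      using D1[of x] zero_le_power2[of "cmod (ft {0..1} x)"] by linarith
  qed
  have DM: "D x \<le> M" for x
    unfolding M_def using bdd by (intro cSUP_upper) auto
  have "M \<le> 0"
  proof (rule ccontr)
    assume "\<not> M \<le> 0"
    then have M: "M > 0"
      by simp
    \<comment> \<open>For x of absolute value at most 1/2 all halvings keep the angle within pi / 4,
      where the squared cosine is at least 1/2; so each halving costs at most a factor 2 in the gap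
      below \<open>M\<close>.\<close>
    have step: "M - D x \<ge> (1/2) ^ n * (M - D (x / 2 ^ n))" if "\<bar>x\<bar> \<le> 1 / 2" for x n
    proof (induction n)
      case (Suc n)
      define y where "y = x / 2 ^ n"
      have "\<bar>y\<bar> \<le> \<bar>x\<bar>"
        by (simp add: y_def divide_le_eq abs_mult mult_le_cancel_left1)
      with that have "\<bar>pi * y / 2\<bar> \<le> pi / 4"
        using mult_left_mono[of "\<bar>y\<bar>" "1 / 2" pi] by (simp add: abs_mult)
      then have "cos (pi / 4) \<le> cos \<bar>pi * y / 2\<bar>"
        by (intro cos_monotone_0_pi_le) (auto simp: pi_ge_zero)
      then have "cos (pi / 4) \<le> cos (pi * y / 2)"
        by (simp only: cos_abs_real)
      then have "(cos (pi / 4))\<^sup>2 \<le> (cos (pi * y / 2))\<^sup>2"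
        by (intro power_mono) (auto simp: cos_45)
      then have c: "1 / 2 \<le> (cos (pi * y / 2))\<^sup>2"
        by (simp add: cos_45 power_divide)
      have "D y \<le> (cos (pi * y / 2))\<^sup>2 * D (y / 2) + (sin (pi * y / 2))\<^sup>2 * M"
        unfolding split[of y] using DM by (intro add_left_mono mult_left_mono) auto
      also have "\<dots> = M - (cos (pi * y / 2))\<^sup>2 * (M - D (y / 2))"
        by (simp add: sin_squared_eq algebra_simps)
      finally have "M - D y \<ge> (cos (pi * y / 2))\<^sup>2 * (M - D (y / 2))"
        by simp
      moreover have "(cos (pi * y / 2))\<^sup>2 * (M - D (y / 2)) \<ge> 1 / 2 * (M - D (y / 2))"
        using c DM[of "y / 2"] by (intro mult_right_mono) auto
      ultimately have "(1/2) ^ n * (1 / 2 * (M - D (y / 2))) \<le> (1/2) ^ n * (M - D y)"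
        by (intro mult_left_mono) auto
      also have "(1/2) ^ n * (M - D y) \<le> M - D x"
        using Suc by (simp add: y_def)
      finally show ?case
        by (simp add: y_def mult.commute)
    qed simp
    \<comment> \<open>Chosen so that \<open>4 * pi * r = M / 2\<close>; by
      \<open>sinc2_near_0\<close>, \<open>D\<close> is then at most \<open>M / 2\<close> on
      [-r, r].\<close>
    define r where "r = M / (8 * pi)"
    have r: "r > 0"
      using M by (simp add: r_def)
    obtain n :: nat where n: "(1/2) ^ n < r"
      using real_arch_pow_inv[OF r, of "1/2"] by auto
    have small: "D x \<le> M - (1/2) ^ n * (M / 2)" if x: "\<bar>x\<bar> \<le> 1 / 2" for x
    proof -
      have "\<bar>x / 2 ^ n\<bar> = \<bar>x\<bar> * (1/2) ^ n"
        by (simp add: power_one_over field_simps)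
      also have "\<dots> \<le> 1 * (1/2) ^ n"
        using x by (intro mult_right_mono) auto
      finally have "\<bar>x / 2 ^ n\<bar> \<le> r"
        using n by simp
      then have "4 * pi * \<bar>x / 2 ^ n\<bar> \<le> 4 * pi * r"
        by (intro mult_left_mono) auto
      then have "D (x / 2 ^ n) \<le> M / 2"
        using D1[of "x / 2 ^ n"] sinc2_near_0[of "x / 2 ^ n"] by (simp add: r_def)
      then have "(1/2) ^ n * (M - D (x / 2 ^ n)) \<ge> (1/2) ^ n * (M / 2)"
        by (intro mult_left_mono) auto
      with step[OF x, of n] show ?thesis
        by linarith
    qed
    \<comment> \<open>By periodicity every point can be moved into [-1/2, 1/2], so the gap in
      \<open>small\<close> is uniform and contradicts the choice of \<open>M\<close> as a
      supremum.\<close>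
    have "M \<le> M - (1/2) ^ n * (M / 2)"
      unfolding M_def
    proof (rule cSUP_least)
      fix x :: real
      have "\<bar>x - of_int (round x)\<bar> \<le> 1 / 2"
        using of_int_round_abs_le[of x] by (simp add: abs_minus_commute)
      from small[OF this] show "D x \<le> (SUP x. D x) - (1/2) ^ n * ((SUP x. D x) / 2)"
        unfolding per M_def .
    qed simp
    moreover have "(1/2::real) ^ n * (M / 2) > 0"
      using M by simp
    ultimately show False
      by linarith
  qed
  then have "D x = 0"
    using D0[of x] DM[of x] by linarith
  then show ?thesis
    using T[of x] by (simp add: D_def)
qed

lemma cmod_ft_interval_scaled:
  assumes "P > 0"
  shows "(cmod (ft {c..c + P} x))\<^sup>2 = P\<^sup>2 * sinc2 (P * x)"
proof (cases "x = 0")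
  case False
  with assms show ?thesis
    using cmod_ft_interval[of c "c + P" x] cmod_ft_interval[of 0 1 "P * x"]
    by (simp add: power_divide power_mult_distrib mult_ac)
qed (use assms in \<open>simp add: ft_0\<close>)

text \<open>\<open>sinc2_tiling\<close> rescaled by \<open>P\<close>; it supplies the Fourier basis
  of the window of length 12.\<close>

lemma is_spectrum_interval:
  fixes c :: real
  assumes P: "P > 0"
  shows "is_spectrum {c..c + P} (range (\<lambda>n. of_int n / P))"
proof (rule is_spectrumI)
  have L: "{c..c + P} \<in> lmeasurable"
    by simp
  show orth: "ft {c..c + P} (l - k) = 0"
    if "l \<in> range (\<lambda>n. of_int n / P)" "k \<in> range (\<lambda>n. of_int n / P)" "l \<noteq> k" for l k
  proof -
    from that obtain i j where ij: "l = of_int i / P" "k = of_int j / P" "i \<noteq> j"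
      by auto
    then have "P * (l - k) = of_int (i - j)"
      using P by (simp add: field_simps)
    with ij have "(cmod (ft {c..c + P} (l - k)))\<^sup>2 = 0"
      using sinc2_int[of "i - j"] by (simp only: cmod_ft_interval_scaled[OF P])
    then show ?thesis
      by simp
  qed
  interpret orth_system "lebesgue_on {c..c + P}" "range (\<lambda>n. of_int n / P)" expo P
    using orth_system_expo[OF L _ orth] P by simp
  show "closed_span (lebesgue_on {c..c + P}) (range (\<lambda>n. of_int n / P)) expo (expo x)" for x
    unfolding closed_span_def
  proof (intro allI impI)
    fix e :: real assume e: "e > 0"
    have "e / P > 0"
      using e P by simp
    then obtain S where S: "finite S" "\<bar>(\<Sum>n\<in>S. sinc2 (P * x - of_int n)) - 1\<bar> < e / P"
      using has_sum_finite_lower[OF sinc2_tiling[of "P * x"]] by (metis subset_UNIV order_refl)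
    define R where "R = (\<lambda>n. of_int n / P) ` S"
    have inj: "inj_on (\<lambda>n. of_int n / P) S"
      using P by (auto simp: inj_on_def)
    have "(\<Sum>l\<in>R. (cmod (ip (lebesgue_on {c..c + P}) (expo x) (expo l)))\<^sup>2) = (\<Sum>n\<in>S. P\<^sup>2 * sinc2 (P * x - of_int n))"
      unfolding R_def using inj P
      by (subst sum.reindex) (auto simp: ip_expo cmod_ft_interval_scaled right_diff_distrib)
    also have "\<dots> = P\<^sup>2 * (\<Sum>n\<in>S. sinc2 (P * x - of_int n))"
      by (simp add: sum_distrib_left)
    also have "\<dots> > P\<^sup>2 * (1 - e / P)"
      using S(2) P by (intro mult_strict_left_mono) auto
    finally have "sqn (lebesgue_on {c..c + P}) (\<lambda>t. expo x t - (\<Sum>l\<in>R. ip (lebesgue_on {c..c + P}) (expo x) (expo l) / P * expo l t)) < e"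
      using S(1) e P by (intro parseval_appr bmeas_expo) (auto simp: R_def sqn_expo right_diff_distrib power2_eq_square)
    then show "\<exists>S d. finite S \<and> S \<subseteq> range (\<lambda>n. of_int n / P) \<and> sqn (lebesgue_on {c..c + P}) (\<lambda>t. expo x t - (\<Sum>l\<in>S. d l * expo l t)) < e"
      using S(1) by (intro exI[of _ R] exI[of _ "\<lambda>l. ip (lebesgue_on {c..c + P}) (expo x) (expo l) / P"] conjI) (auto simp: R_def)
  qed
qed simp_all

section \<open>Correlations of bounded sets on the line\<close>

text \<open>Termwise integration over an unordered index set: the product bound
  \<open>a i * w x\<close> makes the tail of the sum a small multiple of \<open>w\<close>, uniformly
  in \<open>x\<close>, and this survives integration.\<close>

lemma has_sum_integral:
  fixes f :: "'i \<Rightarrow> 'a \<Rightarrow> complex"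
  assumes a: "a summable_on I" and w: "integrable M w" "\<And>x. w x \<ge> 0"
    and f: "\<And>i. i \<in> I \<Longrightarrow> f i \<in> borel_measurable M" "\<And>i x. i \<in> I \<Longrightarrow> cmod (f i x) \<le> a i * w x"
    and F: "F \<in> borel_measurable M" "\<And>x. ((\<lambda>i. f i x) has_sum F x) I"
  shows "((\<lambda>i. LINT x|M. f i x) has_sum (LINT x|M. F x)) I"
  unfolding has_sum_def
proof (rule tendstoI)
  fix e :: real assume e: "e > 0"
  define c where "c = (LINT x|M. w x) + 1"
  have c: "c > 0"
    unfolding c_def using w(2) by (intro add_nonneg_pos integral_nonneg) auto
  have fi: "integrable M (f i)" if "i \<in> I" for i
    using w(1) f(1)[OF that]
    by (rule Bochner_Integration.integrable_bound[of _ "\<lambda>x. a i * w x", OF integrable_mult_right])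
      (use f(2)[OF that] in \<open>auto intro: order_trans[OF _ abs_ge_self]\<close>)
  have tail: "cmod (F x - (\<Sum>i\<in>T. f i x)) \<le> (infsum a I - sum a T) * w x" if T: "finite T" "T \<subseteq> I" for x T
  proof -
    have s1: "((\<lambda>i. f i x) has_sum F x - (\<Sum>i\<in>T. f i x)) (I - T)"
      using has_sum_Diff[OF F(2)[of x] has_sum_finite[OF T(1)] T(2)] by simp
    have "(a has_sum infsum a I - sum a T) (I - T)"
      using has_sum_Diff[OF has_sum_infsum[OF a] has_sum_finite[OF T(1)] T(2)] by simp
    then have s2: "((\<lambda>i. a i * w x) has_sum (infsum a I - sum a T) * w x) (I - T)"
      by (rule has_sum_cmult_left)
    have "(\<lambda>i. cmod (f i x)) summable_on (I - T)"
      using s2 f(2) by (intro summable_on_comparison_test[OF has_sum_imp_summable[OF s2]]) auto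
    then have s3: "((\<lambda>i. cmod (f i x)) has_sum (\<Sum>\<^sub>\<infinity>i\<in>I - T. cmod (f i x))) (I - T)"
      by (rule has_sum_infsum)
    have "cmod (F x - (\<Sum>i\<in>T. f i x)) \<le> (\<Sum>\<^sub>\<infinity>i\<in>I - T. cmod (f i x))"
      using s3 s1 by (rule norm_has_sum_bound)
    also have "\<dots> \<le> (infsum a I - sum a T) * w x"
      using s3 s2 f(2) by (intro has_sum_mono[OF s3 s2]) auto
    finally show ?thesis .
  qed
  have Fi: "integrable M F"
    using integrable_mult_right[OF w(1), of "infsum a I"] F(1)
    by (rule Bochner_Integration.integrable_bound) (use tail[of "{}"] in \<open>auto intro: order_trans[OF _ abs_ge_self]\<close>)
  obtain S where S: "finite S" "S \<subseteq> I" "\<And>T. finite T \<Longrightarrow> S \<subseteq> T \<Longrightarrow> T \<subseteq> I \<Longrightarrow> \<bar>sum a T - infsum a I\<bar> < e / c"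
    using has_sum_finite_lower[OF has_sum_infsum[OF a], of "e / c"] e c by auto
  have "dist (\<Sum>i\<in>T. LINT x|M. f i x) (LINT x|M. F x) < e" if T: "finite T" "S \<subseteq> T" "T \<subseteq> I" for T
  proof -
    have Ti: "integrable M (\<lambda>x. \<Sum>i\<in>T. f i x)"
      using fi T by (intro Bochner_Integration.integrable_sum) auto
    have "(LINT x|M. F x) - (\<Sum>i\<in>T. LINT x|M. f i x) = (LINT x|M. F x - (\<Sum>i\<in>T. f i x))"
      using Fi Ti fi T by (subst Bochner_Integration.integral_diff) (auto simp: Bochner_Integration.integral_sum subset_iff)
    then have "dist (\<Sum>i\<in>T. LINT x|M. f i x) (LINT x|M. F x) \<le> (LINT x|M. cmod (F x - (\<Sum>i\<in>T. f i x)))"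
      by (simp add: dist_norm norm_minus_commute[of "\<Sum>i\<in>T. LINT x|M. f i x"])
    also have "\<dots> \<le> (LINT x|M. (infsum a I - sum a T) * w x)"
      using Fi Ti w(1) tail[OF T(1,3)]
      by (intro integral_mono integrable_norm Bochner_Integration.integrable_diff integrable_mult_right) auto
    also have "\<dots> \<le> (e / c) * (LINT x|M. w x)"
    proof -
      have "infsum a I - sum a T \<le> e / c"
        using S(3)[OF T] by linarith
      then show ?thesis
        unfolding integral_mult_right_zero using w(2) by (intro mult_right_mono integral_nonneg) auto
    qed
    also have "\<dots> < (e / c) * c"
      using e c by (intro mult_strict_left_mono) (auto simp: c_def)
    finally show ?thesis
      using c by simp
  qed
  then show "\<forall>\<^sub>F T in finite_subsets_at_top I. dist (\<Sum>i\<in>T. LINT x|M. f i x) (LINT x|M. F x) < e"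
    unfolding eventually_finite_subsets_at_top using S by blast
qed

text \<open>For bounded Borel sets this is the measure of the intersection of \<open>B\<close> with
  \<open>A\<close> shifted by \<open>- t\<close>; \<open>corr A A\<close> is the autocorrelation.
  Two different sets are allowed because trapezoids and the pieces of a subdivided interval also
  have to be written in this form.\<close>

definition corr :: "real set \<Rightarrow> real set \<Rightarrow> real \<Rightarrow> real" where
  "corr A B t = (LINT s|lborel. indicator A (s + t) * indicator B s)"

definition cross :: "real set \<Rightarrow> real set \<Rightarrow> real \<Rightarrow> complex" where
  "cross A B x = ft A x * cnj (ft B x)"

lemma ft_lborel:
  fixes A :: "'a::euclidean_space set"
  assumes "A \<in> sets borel"
  shows "ft A x = (LINT s|lborel. indicator A s * expo x s)"
proof -
  have "ft A x = (LINT s|lborel. indicator A s *\<^sub>R expo x s)"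
    unfolding ft_def set_lebesgue_integral_def using assms
    by (intro integral_completion borel_measurable_scaleR) auto
  then show ?thesis
    by (simp add: scaleR_conv_of_real of_real_indicator)
qed

lemma lborel_shift:
  fixes f :: "real \<Rightarrow> 'b::{banach, second_countable_topology}"
  shows "(LINT s|lborel. f (t + s)) = (LINT s|lborel. f s)"
  using lborel_integral_real_affine[of 1 f t] by simp

lemma corr_measurable [measurable]:
  assumes [measurable]: "A \<in> sets borel" "B \<in> sets borel"
  shows "corr A B \<in> borel_measurable borel"
proof -
  have "(\<lambda>t. LINT s|lborel. indicator A (s + t) * indicator B s :: real) \<in> borel_measurable lborel"
    by measurable
  then show ?thesis
    by (simp add: corr_def[abs_def])
qed

context
  fixes A B :: "real set"
  assumes AB [measurable]: "A \<in> sets borel" "B \<in> sets borel"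
    and AB2: "A \<subseteq> {-2..2}" "B \<subseteq> {-2..2}"
begin

lemma corr_support: "s + t \<in> A \<Longrightarrow> s \<in> B \<Longrightarrow> s \<in> {-2..2} \<and> t \<in> {-4..4}"
  using AB2 by (smt (verit) atLeastAtMost_iff subsetD)

lemma corr_zero:
  assumes "t \<notin> {-4..4}"
  shows "corr A B t = 0"
proof -
  have "indicator A (s + t) * indicator B s = (0::real)" for s
    using assms corr_support[of s t] by (auto simp: indicator_def)
  then show ?thesis
    unfolding corr_def by (simp only: Bochner_Integration.integral_zero)
qed

lemma corr_bound: "\<bar>corr A B t\<bar> \<le> 4"
proof -
  have "\<bar>corr A B t\<bar> \<le> (LINT s|lborel. norm (indicator A (s + t) * indicator B s :: real))"
    unfolding corr_def by (metis integral_norm_bound real_norm_def)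
  also have "\<dots> \<le> (LINT s|lborel. indicator {-2..2::real} s)"
  proof (rule integral_mono')
    show "integrable lborel (indicator {-2..2::real} :: real \<Rightarrow> real)"
      by (simp add: emeasure_lborel_Icc_eq)
  qed (use AB2 in \<open>auto simp: indicator_def\<close>)
  finally show ?thesis
    by simp
qed

text \<open>Fubini after writing \<open>expo x t\<close> as
  \<open>expo x (s + t) * expo (- x) s\<close>, which separates the variables \<open>s\<close> and
  \<open>s + t\<close>.\<close>

lemma cross_eq: "cross A B x = (LINT t|lborel. corr A B t * expo x t)"
proof -
  define f where "f s t = indicator B s * indicator A (s + t) * expo x t" for s t :: real
  have f_meas: "case_prod f \<in> borel_measurable (lborel \<Otimes>\<^sub>M lborel)"
    unfolding f_def by measurable
  have "integrable (lborel \<Otimes>\<^sub>M lborel) (case_prod f)"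
  proof (rule integrableI_bounded_set[of "{-2..2} \<times> {-4..4}" _ _ 1])
    show "AE z \<in> {-2..2} \<times> {-4..4} in lborel \<Otimes>\<^sub>M lborel. norm (case_prod f z) \<le> 1"
      by (auto simp: f_def norm_mult indicator_def)
    show "AE z in lborel \<Otimes>\<^sub>M lborel. z \<notin> {-2..2} \<times> {-4..4} \<longrightarrow> case_prod f z = 0"
      using corr_support by (intro AE_I2) (force simp: f_def indicator_def)
  qed (use f_meas in \<open>auto simp: lborel.emeasure_pair_measure_Times ennreal_mult_less_top\<close>)
  then have swap: "(LINT t|lborel. LINT s|lborel. f s t) = (LINT s|lborel. LINT t|lborel. f s t)"
    by (rule lborel_pair.Fubini_integral)
  have "(LINT s|lborel. f s t) = corr A B t * expo x t" for t
  proof -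
    have "(LINT s|lborel. f s t) = (LINT s|lborel. complex_of_real (indicator A (s + t) * indicator B s)) * expo x t"
      unfolding f_def integral_mult_left_zero[symmetric]
      by (intro Bochner_Integration.integral_cong) (simp_all add: mult_ac of_real_indicator)
    then show ?thesis
      unfolding integral_complex_of_real corr_def .
  qed
  moreover have "(LINT t|lborel. f s t) = indicator B s * expo (- x) s * ft A x" for s
  proof -
    have "f s t = (indicator B s * expo (- x) s) * (indicator A (s + t) * expo x (s + t))" for t
      by (simp add: f_def expo_add_right mult_ac flip: expo_add)
    then have "(LINT t|lborel. f s t) = (indicator B s * expo (- x) s) * (LINT t|lborel. indicator A (s + t) * expo x (s + t))"
      by simp
    also have "(LINT t|lborel. indicator A (s + t) * expo x (s + t)) = ft A x"
      by (subst lborel_shift[of "\<lambda>u. indicator A u * expo x u"]) (simp add: ft_lborel)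
    finally show ?thesis .
  qed
  ultimately have "(LINT t|lborel. corr A B t * expo x t) = (LINT s|lborel. indicator B s * expo (- x) s * ft A x)"
    using swap by simp
  also have "\<dots> = cross A B x"
  proof -
    have "(LINT s|lborel. indicator B s * expo (- x) s) = cnj (ft B x)"
      unfolding ft_minus[symmetric] by (rule ft_lborel[OF AB(2), symmetric])
    then show ?thesis
      by (simp add: cross_def)
  qed
  finally show ?thesis ..
qed

end

text \<open>Length \<open>12\<close> is large enough that translating subsets of \<open>{-2..2}\<close> by differences of their points does not
  wrap around the period.\<close>

definition window :: "real measure" where
  "window = lebesgue_on {-6..6}"

definition freq :: "int \<Rightarrow> real" where
  "freq n = of_int n / 12"

abbreviation coeff :: "(real \<Rightarrow> complex) \<Rightarrow> int \<Rightarrow> complex" where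
  "coeff f n \<equiv> ip window f (expo (freq n))"

lemma window_finite: "finite_measure window"
  unfolding window_def by (rule finite_measure_lebesgue_on) simp

interpretation window: orth_system window UNIV "\<lambda>n. expo (freq n)" 12
proof -
  interpret finite_measure window
    by (rule window_finite)
  have sp: "is_spectrum {-6..6::real} (range (\<lambda>n. of_int n / 12))"
    using is_spectrum_interval[of 12 "-6"] by simp
  show "orth_system window UNIV (\<lambda>n. expo (freq n)) 12"
  proof
    fix i j
    have "ft {-6..6} (freq i - freq j) = 0" if "i \<noteq> j"
      using that by (intro is_spectrum_orth[OF _ sp]) (auto simp: freq_def)
    then show "ip window (expo (freq i)) (expo (freq j)) = (if i = j then complex_of_real 12 else 0)"
      by (auto simp: window_def ip_expo ft_0)
  qed (simp_all add: window_def bmeas_expo)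
qed

lemma window_complete:
  assumes f: "bmeas window f" and e: "e > 0"
  shows "\<exists>S c. finite S \<and> S \<subseteq> UNIV \<and> sqn window (\<lambda>x. f x - (\<Sum>n\<in>S. c n * expo (freq n) x)) < e"
proof -
  have sp: "is_spectrum {-6..6::real} (range freq)"
    using is_spectrum_interval[of 12 "-6"] by (simp add: freq_def[abs_def])
  have "closed_span window (range freq) expo f"
    using is_spectrum_closed_span[OF _ sp] f by (simp add: window_def)
  then obtain S c where S: "finite S" "S \<subseteq> range freq" "sqn window (\<lambda>x. f x - (\<Sum>l\<in>S. c l * expo l x)) < e"
    using e by (rule closed_spanD)
  from S(1,2) obtain T where T: "finite T" "S = freq ` T"
    by (metis finite_subset_image)
  have "inj_on freq T"
    by (auto simp: inj_on_def freq_def)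
  then have "(\<Sum>l\<in>S. c l * expo l x) = (\<Sum>n\<in>T. c (freq n) * expo (freq n) x)" for x
    unfolding T(2) by (simp add: sum.reindex)
  with S(3) T(1) show ?thesis
    by (intro exI[of _ T] exI[of _ "\<lambda>n. c (freq n)"]) simp
qed

lemma bmeas_window:
  assumes "f \<in> borel_measurable borel" "\<And>x. cmod (f x) \<le> C"
  shows "bmeas window f"
proof (rule bmeasI[where C = C])
  show "f \<in> borel_measurable window"
    unfolding window_def using assms(1) by (intro measurable_restrict_space1 measurable_completion) simp
qed (rule assms(2))

lemma integral_window:
  fixes f :: "real \<Rightarrow> 'b::{banach, second_countable_topology}"
  assumes "f \<in> borel_measurable borel" "\<And>x. x \<notin> {-6..6} \<Longrightarrow> f x = 0"
  shows "(LINT x|window. f x) = (LINT x|lborel. f x)"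
proof -
  have "(LINT x|window. f x) = (LINT x|lebesgue. indicator {-6..6} x *\<^sub>R f x)"
    unfolding window_def by (subst integral_restrict_space) auto
  also have "\<dots> = (LINT x|lebesgue. f x)"
    using assms(2) by (intro Bochner_Integration.integral_cong) (auto simp: indicator_def)
  also have "\<dots> = (LINT x|lborel. f x)"
    using assms(1) by (intro integral_completion) simp
  finally show ?thesis .
qed

lemma window_product:
  assumes f: "bmeas window f" and g: "bmeas window g"
  shows "(\<lambda>n. cmod (coeff f n) * cmod (coeff g n)) summable_on UNIV"
    and "(\<Sum>\<^sub>\<infinity>n. cmod (coeff f n) * cmod (coeff g n)) \<le> 12 * sqrt (sqn window f) * sqrt (sqn window g)"
proof -
  show s: "(\<lambda>n. cmod (coeff f n) * cmod (coeff g n)) summable_on UNIV"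
    using window.cauchy_schwarz_coeffs[OF _ _ f g]
    by (intro nonneg_bdd_above_summable_on bdd_aboveI2[where M = "12 * sqrt (sqn window f) * sqrt (sqn window g)"]) auto
  show "(\<Sum>\<^sub>\<infinity>n. cmod (coeff f n) * cmod (coeff g n)) \<le> 12 * sqrt (sqn window f) * sqrt (sqn window g)"
    using s window.cauchy_schwarz_coeffs[OF _ _ f g] by (intro infsum_le_finite_sums) auto
qed

lemma bmeas_window_indicator: "A \<in> sets borel \<Longrightarrow> bmeas window (indicator A)"
  by (intro bmeas_window[where C = 1]) (auto simp: indicator_def)

lemma ip_window_indicator:
  assumes "A \<in> sets borel" "A \<subseteq> {-6..6}"
  shows "ip window (indicator A) (expo x) = ft A (- x)"
  unfolding ip_def
  using assms by (subst integral_window) (auto simp: ft_lborel cnj_expo indicator_def)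

text \<open>The terms are products of two square-summable coefficient sequences. This is why all
  multipliers below are correlations of sets: their Fourier series converge absolutely without any
  smoothness.\<close>

lemma cross_summable:
  assumes "A \<in> sets borel" "B \<in> sets borel" "A \<subseteq> {-6..6}" "B \<subseteq> {-6..6}"
  shows "(\<lambda>n. cmod (cross A B (freq n))) summable_on UNIV"
  using window_product(1)[OF bmeas_window_indicator[OF assms(1)] bmeas_window_indicator[OF assms(2)]] assms
  by (simp add: ip_window_indicator cross_def norm_mult ft_minus)

text \<open>\<open>corr A B t\<close> is the inner product of a translated indicator of
  \<open>A\<close> with the indicator of \<open>B\<close>, expanded by polarised Parseval. For
  \<open>\<bar>t\<bar> \<le> 4\<close> the translate stays inside the window {-6..6}.\<close>

lemma cross_fourier:
  assumes [measurable]: "A \<in> sets borel" "B \<in> sets borel" and AB: "A \<subseteq> {-2..2}" "B \<subseteq> {-2..2}" and t: "\<bar>t\<bar> \<le> 4"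
  shows "((\<lambda>n. cross A B (freq n) / 12 * expo (- freq n) t) has_sum of_real (corr A B t)) UNIV"
proof -
  define f where "f s = (indicator A (s + t) :: complex)" for s
  have f: "bmeas window f"
    unfolding f_def by (rule bmeas_window[where C = 1]) (auto simp: indicator_def)
  have g: "bmeas window (indicator B)"
    by (rule bmeas_window_indicator) measurable
  have sup: "s \<in> {-6..6}" if "s + t \<in> A" for s
    using that AB(1) t by auto (smt (verit) atLeastAtMost_iff subsetD)+
  have ipf: "ip window f (expo x) = expo x t * ft A (- x)" for x
  proof -
    have "ip window f (expo x) = (LINT s|lborel. f s * cnj (expo x s))"
      unfolding ip_def
    proof (rule integral_window)
      show "(\<lambda>s. f s * cnj (expo x s)) \<in> borel_measurable borel"
        unfolding f_def cnj_expo by measurable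
    qed (use sup in \<open>auto simp: f_def indicator_def\<close>)
    also have "\<dots> = (LINT s|lborel. expo x t * (indicator A (t + s) * expo (- x) (t + s)))"
    proof (intro Bochner_Integration.integral_cong refl)
      fix s
      have "expo x t * expo (- x) t = 1"
        by (simp flip: expo_add)
      then show "f s * cnj (expo x s) = expo x t * (indicator A (t + s) * expo (- x) (t + s))"
        by (simp add: f_def cnj_expo expo_add_right add.commute)
    qed
    also have "\<dots> = expo x t * ft A (- x)"
      by (simp add: lborel_shift[of "\<lambda>u. indicator A u * expo (- x) u"] ft_lborel)
    finally show ?thesis .
  qed
  have ipg: "ip window (indicator B) (expo x) = ft B (- x)" for x
    using AB(2) by (intro ip_window_indicator) auto
  have ipfg: "ip window f (indicator B) = of_real (corr A B t)"
  proof -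
    have "ip window f (indicator B) = (LINT s|lborel. f s * cnj (indicator B s))"
      unfolding ip_def
    proof (rule integral_window)
      have "(\<lambda>s. f s * indicator B s) \<in> borel_measurable borel"
        unfolding f_def by measurable
      moreover have "cnj (indicator B s) = indicator B s" for s
        by (simp add: indicator_def)
      ultimately show "(\<lambda>s. f s * cnj (indicator B s)) \<in> borel_measurable borel"
        by simp
    qed (use sup in \<open>auto simp: f_def indicator_def\<close>)
    also have "\<dots> = (LINT s|lborel. complex_of_real (indicator A (s + t) * indicator B s))"
      by (intro Bochner_Integration.integral_cong) (auto simp: f_def indicator_def)
    finally show ?thesis
      unfolding integral_complex_of_real corr_def .
  qed
  have "((\<lambda>n. 1 / 12 * (expo (freq n) t * cross A B (- freq n))) has_sum 1 / 12 * (12 * of_real (corr A B t))) UNIV"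
    using window.parseval_polarised[OF f g window_complete]
    by (intro has_sum_cmult_right) (simp add: ipf ipg ipfg cross_def mult.assoc)
  then have "((\<lambda>n. (1 / 12 * (expo (freq n) t * cross A B (- freq n)))) has_sum of_real (corr A B t)) UNIV"
    by simp
  \<comment> \<open>Reflection of the index, because \<open>ip\<close> conjugates the
    exponential.\<close>
  then have "((\<lambda>n. (1 / 12 * (expo (freq (- n)) t * cross A B (- freq (- n))))) has_sum of_real (corr A B t)) UNIV"
    by (subst has_sum_reindex_bij_betw[of uminus UNIV UNIV]) (auto simp: bij_uminus)
  then show ?thesis
    by (simp add: freq_def mult_ac)
qed

text \<open>Convolution on one side is multiplication on the other. The lattice sum represents the
  12-periodic extension of \<open>corr A B\<close>, but \<open>corr C D\<close> vanishes outside
  {-4..4}, where the extension agrees with \<open>corr A B\<close>.\<close>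

lemma cross_convolution:
  assumes [measurable]: "A \<in> sets borel" "B \<in> sets borel" "C \<in> sets borel" "D \<in> sets borel"
    and AB: "A \<subseteq> {-2..2}" "B \<subseteq> {-2..2}" and CD: "C \<subseteq> {-2..2}" "D \<subseteq> {-2..2}"
  shows "((\<lambda>n. cross A B (freq n) / 12 * cross C D (x - freq n)) has_sum
    (LINT t|lborel. corr A B t * corr C D t * expo x t)) UNIV"
proof -
  define f where "f n t = cross A B (freq n) / 12 * (corr C D t * expo (x - freq n) t)" for n t
  have "((\<lambda>n. LINT t|lborel. f n t) has_sum (LINT t|lborel. corr A B t * corr C D t * expo x t)) UNIV"
  proof (rule has_sum_integral[where a = "\<lambda>n. cmod (cross A B (freq n))" and w = "\<lambda>t. 4 * indicator {-4..4} t"])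
    show "(\<lambda>n. cmod (cross A B (freq n))) summable_on UNIV"
      using AB by (intro cross_summable) (auto intro: order_trans)
    show "f n \<in> borel_measurable lborel" for n
      unfolding f_def by measurable
    show "cmod (f n t) \<le> cmod (cross A B (freq n)) * (4 * indicator {-4..4} t)" for n t
    proof (cases "t \<in> {-4..4}")
      case True
      have "\<bar>corr C D t\<bar> \<le> 4"
        using CD by (intro corr_bound) auto
      then have "cmod (cross A B (freq n)) / 12 * \<bar>corr C D t\<bar> \<le> cmod (cross A B (freq n)) * 4"
        by (intro mult_mono) auto
      with True show ?thesis
        by (simp add: f_def norm_mult norm_divide)
    next
      case False
      then show ?thesis
        using corr_zero[of C D t] CD by (simp add: f_def)
    qed
    show "((\<lambda>n. f n t) has_sum corr A B t * corr C D t * expo x t) UNIV" for t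
    proof (cases "t \<in> {-4..4}")
      case True
      have "((\<lambda>n. cross A B (freq n) / 12 * expo (- freq n) t * (corr C D t * expo x t)) has_sum
          of_real (corr A B t) * (corr C D t * expo x t)) UNIV"
        using True AB by (intro has_sum_cmult_left cross_fourier) auto
      moreover have "cross A B (freq n) / 12 * expo (- freq n) t * (corr C D t * expo x t) = f n t" for n
        using expo_add[of x "- freq n" t] by (simp add: f_def mult_ac)
      ultimately show ?thesis
        by (simp add: mult_ac)
    next
      case False
      then show ?thesis
        using corr_zero[of C D t] CD by (simp add: f_def)
    qed
  qed auto
  moreover have "(LINT t|lborel. f n t) = cross A B (freq n) / 12 * cross C D (x - freq n)" for n
    using CD by (simp add: f_def cross_eq)
  ultimately show ?thesis
    by simp
qed

section \<open>A local Wiener lemma\<close>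

lemma corr_sym: "A \<in> sets borel \<Longrightarrow> corr A A (- t) = corr A A t"
  unfolding corr_def
  by (subst lborel_shift[of "\<lambda>s. indicator A (s + - t) * indicator A s" t, symmetric])
    (simp add: mult.commute add.commute)

text \<open>For \<open>t \<ge> 1/2\<close>, removing from \<open>E\<close> every \<open>s\<close> with \<open>s + t \<in> E\<close> leaves a set whose parts near the two ends of
  \<open>{0..L}\<close>, \<open>L = 3/2 - \<epsilon>\<close>, stay disjoint after a shift by \<open>t\<close>; hence it has measure at most
  \<open>max t (L - t)\<close>.\<close>

lemma corr_lower:
  assumes E [measurable]: "E \<in> sets borel" and sub: "E \<subseteq> {0..3/2 - \<epsilon>}" and one: "measure lborel E = 1"
    and t: "\<bar>t\<bar> \<le> a" "a < 1" and \<epsilon>: "\<epsilon> > 0"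
  shows "min (1 - a) \<epsilon> \<le> corr E E t"
proof -
  define L where "L = 3/2 - \<epsilon>"
  have E_L: "s \<in> E \<Longrightarrow> 0 \<le> s \<and> s \<le> L" for s
    using sub by (auto simp: L_def)
  have fin: "emeasure lborel E \<noteq> \<infinity>"
  proof -
    have "emeasure lborel E \<le> emeasure lborel {0..L}"
      using E_L by (intro emeasure_mono) auto
    then show ?thesis
      by (auto simp: emeasure_lborel_Icc_eq top_unique split: if_splits)
  qed
  have intE: "(LINT s|lborel. indicator E s) = (1::real)"
    using one by simp
  have L1: "1 \<le> L"
  proof -
    have "(LINT s|lborel. indicator E s) \<le> (LINT s|lborel. indicator {0..L} s :: real)"
    proof (rule integral_mono')
      show "integrable lborel (indicator {0..L} :: real \<Rightarrow> real)"
        by (simp add: emeasure_lborel_Icc_eq)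
    qed (use E_L in \<open>auto simp: indicator_def\<close>)
    then show ?thesis
      using intE by (auto simp: split: if_splits)
  qed
  have pos: "min (1 - a) \<epsilon> \<le> corr E E t" if t: "0 \<le> t" "t \<le> a" for t
  proof -
    have i1: "integrable lborel (indicator E :: real \<Rightarrow> real)"
      using fin by (simp add: less_top)
    have i2: "integrable lborel (\<lambda>s. indicator E (s + t) :: real)"
      using lborel_integrable_real_affine[OF i1, of 1 t] by (simp add: add.commute)
    have i3: "integrable lborel (\<lambda>s. indicator E (s + t) * indicator E s :: real)"
      by (rule Bochner_Integration.integrable_bound[OF i1]) (auto simp: indicator_def)
    have intE': "(LINT s|lborel. indicator E (s + t)) = (1::real)"
      using lborel_shift[of "indicator E :: real \<Rightarrow> real" t] intE by (simp add: add.commute)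
    show ?thesis
    proof (cases "t \<le> 1/2")
      case True
      \<comment> \<open>Inclusion-exclusion for \<open>E\<close> and its translate by
        \<open>- t\<close> inside [-t, L]: \<open>2 - corr E E t\<close> is at most
        \<open>L + t\<close>, which is at most \<open>2 - \<epsilon>\<close> in this case.\<close>
      have "(LINT s|lborel. indicator E s + indicator E (s + t) - indicator E (s + t) * indicator E s :: real)
          \<le> (LINT s|lborel. indicator {-t..L} s)"
      proof (rule integral_mono)
        show "integrable lborel (indicator {-t..L} :: real \<Rightarrow> real)"
          by (simp add: emeasure_lborel_Icc_eq)
        show "indicator E s + indicator E (s + t) - indicator E (s + t) * indicator E s \<le> (indicator {-t..L} s :: real)" for s
          using E_L[of s] E_L[of "s + t"] t by (auto simp: indicator_def)
      qed (use i1 i2 i3 in simp)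
      then have "2 - corr E E t \<le> L + t"
        using i1 i2 i3 intE intE' t L1 by (simp add: corr_def)
      then show ?thesis
        using True by (simp add: L_def)
    next
      case False
      \<comment> \<open>[0, \<sigma>] and its translate [t, t + \<sigma>] lie in [0, L] and meet at
        most in an endpoint. The rest is covered by \<open>r\<close>, which lies to the right of
        both if \<open>2 * t\<close> is at most \<open>L\<close> and between them otherwise.\<close>
      define \<sigma> where "\<sigma> = min t (L - t)"
      define r where "r = (if t \<le> L - t then {2 * t..L} else {L - t..t})"
      have \<sigma>: "0 \<le> \<sigma>" "measure lborel r = L - 2 * \<sigma>" "emeasure lborel r < \<infinity>" "r \<in> sets borel"
        using t \<open>a < 1\<close> L1 by (auto simp: \<sigma>_def r_def min_def emeasure_lborel_Icc_eq)
      define e where "e s = (indicator E s * (1 - indicator E (s + t)) :: real)" for s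
      have e01: "0 \<le> e s" "e s \<le> 1" for s
        by (auto simp: e_def indicator_def)
      have [measurable]: "e \<in> borel_measurable borel"
        unfolding e_def by measurable
      have ie: "integrable lborel e"
        by (rule Bochner_Integration.integrable_bound[OF i1]) (auto simp: e_def indicator_def)
      define u where "u s = e s * indicator {0..\<sigma>} s" for s
      define v where "v s = e s * indicator {t..t + \<sigma>} s" for s
      have iu: "integrable lborel u" and iv: "integrable lborel v"
        unfolding u_def v_def
        by (rule Bochner_Integration.integrable_bound[OF ie]; auto simp: e01 indicator_def)+
      have iv': "integrable lborel (\<lambda>s. v (s + t))"
        using lborel_integrable_real_affine[OF iv, of 1 t] by (simp add: add.commute)
      have "(LINT s|lborel. e s) \<le> (LINT s|lborel. u s + v s + indicator r s)"
      proof (rule integral_mono[OF ie])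
        show "integrable lborel (\<lambda>s. u s + v s + indicator r s)"
          using iu iv \<sigma> by (intro Bochner_Integration.integrable_add integrable_real_indicator) auto
        show "e s \<le> u s + v s + indicator r s" for s
        proof (cases "s \<in> E")
          case True
          with E_L[OF True] e01[of s] t show ?thesis
            by (auto simp: u_def v_def r_def \<sigma>_def indicator_def)
        qed (simp add: e_def u_def v_def)
      qed
      also have "\<dots> = (LINT s|lborel. u s) + (LINT s|lborel. v s) + (L - 2 * \<sigma>)"
        using iu iv \<sigma> by simp
      also have "(LINT s|lborel. v s) = (LINT s|lborel. v (s + t))"
        using lborel_shift[of v t] by (simp add: add.commute)
      also have "(LINT s|lborel. u s) + (LINT s|lborel. v (s + t)) = (LINT s|lborel. u s + v (s + t))"
        using iu iv' by simp
      \<comment> \<open>If \<open>e s\<close> is 1 then \<open>s + t\<close> is outside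
        \<open>E\<close> and \<open>e (s + t)\<close> is 0, so the two parts never overlap after the
        shift.\<close>
      also have "\<dots> \<le> (LINT s|lborel. indicator {0..\<sigma>} s)"
      proof (rule integral_mono)
        show "integrable lborel (indicator {0..\<sigma>} :: real \<Rightarrow> real)"
          by (simp add: emeasure_lborel_Icc_eq)
        show "u s + v (s + t) \<le> (indicator {0..\<sigma>} s :: real)" for s
          by (auto simp: u_def v_def e_def indicator_def)
      qed (use iu iv' in simp)
      also have "\<dots> = \<sigma>"
        using \<sigma>(1) by simp
      finally have "(LINT s|lborel. e s) \<le> L - \<sigma>"
        by simp
      moreover have "(LINT s|lborel. e s) = 1 - corr E E t"
      proof -
        have "e = (\<lambda>s. indicator E s - indicator E (s + t) * indicator E s)"
          by (auto simp: e_def algebra_simps)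
        then show ?thesis
          using i1 i3 intE by (simp add: corr_def)
      qed
      ultimately show ?thesis
        using False t by (auto simp: \<sigma>_def L_def min_def split: if_splits)
    qed
  qed
  show ?thesis
    using pos[of "\<bar>t\<bar>"] t corr_sym[OF E, of t] by (cases "t \<ge> 0") auto
qed

text \<open>Convolution of \<open>U\<close> with the measure that has mass \<open>c n\<close> at
  \<open>freq n\<close>. For absolutely summable \<open>c\<close> the transform of this measure is
  an absolutely convergent Fourier series of period 12.\<close>

definition conv :: "(int \<Rightarrow> complex) \<Rightarrow> (real \<Rightarrow> complex) \<Rightarrow> real \<Rightarrow> complex" where
  "conv c U x = (\<Sum>\<^sub>\<infinity>n. c n * U (x - freq n))"

lemma freq_add: "freq (n + m) = freq n + freq m"
  and freq_diff: "freq (n - m) = freq n - freq m"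
  and freq_minus: "freq (- n) = - freq n"
  by (simp_all add: freq_def add_divide_distrib diff_divide_distrib)

lemma conv_abs_summable:
  assumes c: "(\<lambda>n. cmod (c n)) summable_on UNIV" and U: "\<And>x. cmod (U x) \<le> K"
  shows "(\<lambda>n. cmod (c n * U (x - freq n))) summable_on UNIV"
proof (rule summable_on_comparison_test)
  show "(\<lambda>n. cmod (c n) * K) summable_on UNIV"
    using c by (rule summable_on_cmult_left)
  show "cmod (c n * U (x - freq n)) \<le> cmod (c n) * K" for n
    using U by (simp add: norm_mult mult_left_mono)
qed simp

lemma conv_has_sum:
  assumes c: "(\<lambda>n. cmod (c n)) summable_on UNIV" and U: "\<And>x. cmod (U x) \<le> K"
  shows "((\<lambda>n. c n * U (x - freq n)) has_sum conv c U x) UNIV"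
proof -
  have "(\<lambda>n. c n * U (x - freq n)) summable_on UNIV"
    by (rule abs_summable_summable) (rule conv_abs_summable[OF assms])
  then show ?thesis
    unfolding conv_def by (rule has_sum_infsum)
qed

lemma conv_bound:
  assumes c: "(\<lambda>n. cmod (c n)) summable_on UNIV" and U: "\<And>x. cmod (U x) \<le> K"
  shows "cmod (conv c U x) \<le> (\<Sum>\<^sub>\<infinity>n. cmod (c n)) * K"
proof -
  have "cmod (conv c U x) \<le> (\<Sum>\<^sub>\<infinity>n. cmod (c n * U (x - freq n)))"
    unfolding conv_def by (rule norm_infsum_bound[OF conv_abs_summable[OF assms]])
  also have "\<dots> \<le> (\<Sum>\<^sub>\<infinity>n. cmod (c n) * K)"
    using conv_abs_summable[OF assms] U
    by (intro infsum_mono summable_on_cmult_left c) (auto simp: norm_mult mult_left_mono)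
  also have "\<dots> = (\<Sum>\<^sub>\<infinity>n. cmod (c n)) * K"
    by (rule infsum_cmult_left') 
  finally show ?thesis .
qed

lemma conv_double_summable:
  assumes c: "(\<lambda>n. cmod (c n)) summable_on UNIV" and d: "(\<lambda>n. cmod (d n)) summable_on UNIV"
    and U: "\<And>x. cmod (U x) \<le> K"
  shows "(\<lambda>(n, m). c n * (d m * U (x - freq n - freq m))) summable_on UNIV \<times> UNIV"
proof (rule abs_summable_summable, rule summable_on_comparison_test)
  show "(\<lambda>(n, m). cmod (c n) * (cmod (d m) * K)) summable_on UNIV \<times> UNIV"
  proof (rule summable_on_SigmaI)
    show "((\<lambda>m. case (n, m) of (n, m) \<Rightarrow> cmod (c n) * (cmod (d m) * K)) has_sum
        cmod (c n) * ((\<Sum>\<^sub>\<infinity>m. cmod (d m)) * K)) UNIV" for n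
      using has_sum_cmult_right[OF has_sum_cmult_left[OF has_sum_infsum[OF d]]] by simp
    show "(\<lambda>n. cmod (c n) * ((\<Sum>\<^sub>\<infinity>m. cmod (d m)) * K)) summable_on UNIV"
      using c by (rule summable_on_cmult_left)
    show "0 \<le> (case z of (n, m) \<Rightarrow> cmod (c n) * (cmod (d m) * K))" for z
      using order_trans[OF norm_ge_zero U[of 0]] by (auto split: prod.splits)
  qed
  show "cmod (case z of (n, m) \<Rightarrow> c n * (d m * U (x - freq n - freq m))) \<le> (case z of (n, m) \<Rightarrow> cmod (c n) * (cmod (d m) * K))" for z
    using U by (auto simp: norm_mult mult_left_mono split: prod.splits)
qed simp

lemma conv_commute:
  assumes c: "(\<lambda>n. cmod (c n)) summable_on UNIV" and d: "(\<lambda>n. cmod (d n)) summable_on UNIV"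
    and U: "\<And>x. cmod (U x) \<le> K"
  shows "conv c (conv d U) x = conv d (conv c U) x"
proof -
  have "conv c (conv d U) x = (\<Sum>\<^sub>\<infinity>n. \<Sum>\<^sub>\<infinity>m. c n * (d m * U (x - freq n - freq m)))"
    unfolding conv_def by (simp add: infsum_cmult_right')
  also have "\<dots> = (\<Sum>\<^sub>\<infinity>m. \<Sum>\<^sub>\<infinity>n. c n * (d m * U (x - freq n - freq m)))"
    using conv_double_summable[OF c d U] by (rule infsum_swap_banach)
  also have "\<dots> = conv d (conv c U) x"
    unfolding conv_def by (simp add: infsum_cmult_right'[symmetric] mult.left_commute diff_diff_eq add.commute)
  finally show ?thesis .
qed

text \<open>The absolutely convergent double sum is regrouped by l = n + m; \<open>e\<close> is the
  convolution of the two coefficient sequences.\<close>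

lemma conv_assoc:
  assumes c: "(\<lambda>n. cmod (c n)) summable_on UNIV" and d: "(\<lambda>n. cmod (d n)) summable_on UNIV"
    and U: "\<And>x. cmod (U x) \<le> K" and e: "\<And>l. ((\<lambda>n. c n * d (l - n)) has_sum e l) UNIV"
  shows "conv c (conv d U) x = conv e U x"
proof -
  have s: "(\<lambda>(n, m). c n * (d m * U (x - freq n - freq m))) summable_on UNIV \<times> UNIV"
    using c d U by (rule conv_double_summable)
  have "conv c (conv d U) x = (\<Sum>\<^sub>\<infinity>n. \<Sum>\<^sub>\<infinity>m. c n * (d m * U (x - freq n - freq m)))"
    unfolding conv_def by (simp add: infsum_cmult_right')
  also have "\<dots> = (\<Sum>\<^sub>\<infinity>n. \<Sum>\<^sub>\<infinity>l. c n * (d (l - n) * U (x - freq l)))"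
  proof (rule infsum_cong)
    fix n
    show "(\<Sum>\<^sub>\<infinity>m. c n * (d m * U (x - freq n - freq m))) = (\<Sum>\<^sub>\<infinity>l. c n * (d (l - n) * U (x - freq l)))"
      by (rule infsum_reindex_bij_witness[of _ "\<lambda>l. l - n" "\<lambda>m. m + n"]) (simp_all add: freq_add freq_diff diff_diff_eq add.commute)
  qed
  also have "\<dots> = (\<Sum>\<^sub>\<infinity>l. \<Sum>\<^sub>\<infinity>n. c n * (d (l - n) * U (x - freq l)))"
  proof (rule infsum_swap_banach)
    show "(\<lambda>(n, l). c n * (d (l - n) * U (x - freq l))) summable_on UNIV \<times> UNIV"
      using s by (subst (asm) summable_on_reindex_bij_witness[of _ "\<lambda>(n, l). (n, l - n)" "\<lambda>(n, m). (n, m + n)"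
            "UNIV \<times> UNIV" "\<lambda>(n, l). c n * (d (l - n) * U (x - freq l))"])
        (auto simp: freq_add diff_diff_eq add.commute)
  qed
  also have "\<dots> = conv e U x"
    unfolding conv_def
  proof (rule infsum_cong)
    fix l
    have "((\<lambda>n. c n * d (l - n) * U (x - freq l)) has_sum e l * U (x - freq l)) UNIV"
      using e by (rule has_sum_cmult_left)
    then show "(\<Sum>\<^sub>\<infinity>n. c n * (d (l - n) * U (x - freq l))) = e l * U (x - freq l)"
      by (simp add: infsumI mult.assoc)
  qed
  finally show ?thesis .
qed


lemma corr_eq_length:
  assumes "\<And>s. s \<in> B \<Longrightarrow> s + t \<in> A"
  shows "corr A B t = measure lborel B"
proof -
  have "(indicator A (s + t) * indicator B s :: real) = indicator B s" for s
    using assms by (auto simp: indicator_def)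
  then show ?thesis
    unfolding corr_def by (simp only:) simp
qed

lemma corr_eq_0:
  assumes "\<And>s. s \<in> B \<Longrightarrow> s + t \<notin> A"
  shows "corr A B t = 0"
proof -
  have "(indicator A (s + t) * indicator B s :: real) = 0" for s
    using assms by (auto simp: indicator_def)
  then show ?thesis
    unfolding corr_def by (simp only: Bochner_Integration.integral_zero)
qed

text \<open>De la Vallee Poussin kernel: the coefficients of the trapezoid equal to \<open>1\<close> on \<open>{t - r..t + r}\<close> and
  supported on \<open>{t - 2 * r..t + 2 * r}\<close>.\<close>

definition vp :: "real \<Rightarrow> real \<Rightarrow> int \<Rightarrow> complex" where
  "vp r t n = cross {t - 3 / 2 * r..t + 3 / 2 * r} {- r / 2..r / 2} (freq n) / (12 * r)"

context
  fixes r t :: real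
  assumes r: "0 < r" "r \<le> 1 / 2" and t: "\<bar>t\<bar> \<le> 1"
begin

lemma vp_sets: "{t - 3 / 2 * r..t + 3 / 2 * r} \<subseteq> {-2..2}" "{- r / 2..r / 2} \<subseteq> {-2..2}"
  using r t by auto

lemma vp_summable: "(\<lambda>n. cmod (vp r t n)) summable_on UNIV"
proof -
  have "(\<lambda>n. cmod (cross {t - 3 / 2 * r..t + 3 / 2 * r} {- r / 2..r / 2} (freq n)) * (1 / (12 * r))) summable_on UNIV"
    using vp_sets by (intro summable_on_cmult_left cross_summable) auto
  then show ?thesis
    using r by (simp add: vp_def norm_divide norm_mult)
qed

text \<open>The trapezoid \<open>corr ?I ?J\<close> has the constant value \<open>r\<close> on
  [t - r, t + r], outside of which \<open>corr X Y\<close> vanishes; the factor in \<open>vp\<close>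
  divides by this value.\<close>

lemma vp_reproduces:
  assumes XY: "X \<in> sets borel" "Y \<in> sets borel" "X \<subseteq> {-2..2}" "Y \<subseteq> {-2..2}"
    and diff: "\<And>x y. x \<in> X \<Longrightarrow> y \<in> Y \<Longrightarrow> \<bar>x - y - t\<bar> \<le> r"
  shows "((\<lambda>n. vp r t n * cross X Y (x - freq n)) has_sum cross X Y x) UNIV"
proof -
  let ?I = "{t - 3 / 2 * r..t + 3 / 2 * r}" and ?J = "{- r / 2..r / 2}"
  have "corr ?I ?J s * corr X Y s = r * corr X Y s" for s
  proof (cases "\<bar>s - t\<bar> \<le> r")
    case True
    then have "corr ?I ?J s = measure lborel ?J"
      by (intro corr_eq_length) auto
    then show ?thesis
      using r by simp
  next
    case False
    then have "corr X Y s = 0"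
      using diff[of "y + s" y for y] by (intro corr_eq_0) force
    then show ?thesis
      by simp
  qed
  then have "(\<lambda>s. complex_of_real (corr ?I ?J s) * complex_of_real (corr X Y s) * expo x s)
      = (\<lambda>s. complex_of_real r * (complex_of_real (corr X Y s) * expo x s))"
    by (metis (no_types, opaque_lifting) mult.assoc of_real_mult)
  then have "(LINT s|lborel. complex_of_real (corr ?I ?J s) * complex_of_real (corr X Y s) * expo x s) = r * cross X Y x"
    using XY by (simp add: cross_eq)
  then have "((\<lambda>n. cross ?I ?J (freq n) / 12 * cross X Y (x - freq n)) has_sum r * cross X Y x) UNIV"
    using cross_convolution[of ?I ?J X Y x] vp_sets XY by simp
  from has_sum_cmult_right[OF this, of "1 / r"] show ?thesis
    using r by (simp add: vp_def field_simps)
qed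

text \<open>For a pure character of frequency \<open>t\<close>, a translation by \<open>k\<close>
  only multiplies by a phase. This is the l1 distance of the kernel from that behaviour.\<close>

definition vp_shift :: "int \<Rightarrow> real" where
  "vp_shift k = (\<Sum>\<^sub>\<infinity>n. cmod (vp r t (n - k) - expo (- freq k) t * vp r t n))"

lemma sqn_window_le:
  assumes "\<And>s. cmod (f s) \<le> c * indicator {a..b} s" "c \<ge> 0" "a \<le> b"
  shows "sqn window f \<le> c\<^sup>2 * (b - a)"
proof -
  have "sqn window f \<le> (LINT s|window. c\<^sup>2 * indicator {a..b} s)"
    unfolding sqn_def
  proof (rule integral_mono')
    have "bmeas window (\<lambda>s. complex_of_real (c\<^sup>2 * indicator {a..b} s))"
      by (rule bmeas_window[where C = "c\<^sup>2"]) (auto simp: indicator_def norm_power)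
    then show "integrable window (\<lambda>s. c\<^sup>2 * indicator {a..b} s)"
      using window.bmeas_integrable complex_of_real_integrable_eq by blast
    show "(cmod (f s))\<^sup>2 \<le> c\<^sup>2 * indicator {a..b} s" for s
      using power_mono[OF assms(1)[of s], of 2] by (auto simp: indicator_def power_mult_distrib)
  qed auto
  also have "\<dots> \<le> c\<^sup>2 * (b - a)"
  proof -
    have "(LINT s|window. indicator {a..b} s :: real) = measure lebesgue ({-6..6} \<inter> {a..b})"
      unfolding window_def by (subst integral_restrict_space) (simp_all flip: indicator_inter_arith)
    also have "\<dots> \<le> measure lebesgue {a..b}"
      by (intro measure_mono_fmeasurable) auto
    finally show ?thesis
      using assms by (simp add: mult_left_mono)
  qed
  finally show ?thesis .
qed

text \<open>The kernel is a product of Fourier coefficients of two indicators, so Cauchy-Schwarz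
  bounds its l1 norm by interval lengths. The bound 4 is uniform in \<open>k\<close> and will serve
  for the tail of a series; the bound linear in \<open>r\<close> gives smallness for finitely many
  \<open>k\<close>.\<close>

lemma vp_shift_bounds:
  shows "(\<lambda>n. cmod (vp r t (n - k) - expo (- freq k) t * vp r t n)) summable_on UNIV"
    and "vp_shift k \<le> 4" and "vp_shift k \<le> 8 * pi * r * \<bar>freq k\<bar>"
proof -
  let ?I = "{t - 3 / 2 * r..t + 3 / 2 * r}" and ?J = "{- r / 2..r / 2}"
  define s where "s = freq k"
  \<comment> \<open>A shift of the kernel multiplies the two indicators by exponentials
    (\<open>f1\<close>, \<open>g1\<close>); in \<open>f0\<close> and \<open>g0\<close> these are
    frozen at the midpoints \<open>t\<close> and 0 of the two intervals.\<close>
  define f1 where "f1 u = indicator ?I u * expo (- s) u" for u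
  define f0 where "f0 u = indicator ?I u * expo (- s) t" for u
  define g1 where "g1 u = indicator ?J u * expo (- s) u" for u
  define g0 where "g0 u = (indicator ?J u :: complex)" for u
  have b: "bmeas window f1" "bmeas window f0" "bmeas window g1" "bmeas window g0"
    unfolding f1_def f0_def g1_def g0_def
    by (rule bmeas_window[where C = 1]; auto simp: indicator_def)+
  have ip_expo_ind: "ip window (\<lambda>u. indicator A u * expo (- s) u) (expo y) = ft A (- s - y)"
    if A: "A \<in> sets borel" "A \<subseteq> {-2..2}" for A y
  proof -
    have "ip window (\<lambda>u. indicator A u * expo (- s) u) (expo y) = ip window (indicator A) (expo (y + s))"
      unfolding ip_def by (simp add: cnj_expo expo_add mult_ac)
    also have "\<dots> = ft A (- (y + s))"
      using A by (intro ip_window_indicator) (auto intro: order_trans)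
    also have "- (y + s) = - s - y"
      by simp
    finally show ?thesis .
  qed
  have s_freq: "- s - freq n = freq (- n - k)" for n
    by (simp add: s_def freq_diff freq_minus)
  have ipf1: "coeff f1 n = ft ?I (freq (- n - k))" for n
    using ip_expo_ind[OF _ vp_sets(1), of "freq n"] by (simp only: f1_def[abs_def] s_freq) simp
  have ipg1: "coeff g1 n = ft ?J (freq (- n - k))" for n
    using ip_expo_ind[OF _ vp_sets(2), of "freq n"] by (simp only: g1_def[abs_def] s_freq) simp
  have I6: "?I \<subseteq> {-6..6}" "?J \<subseteq> {-6..6}"
    using r t by auto
  have ipf0: "coeff f0 n = expo (- s) t * ft ?I (freq (- n))" for n
  proof -
    have "coeff f0 n = expo (- s) t * coeff (indicator ?I) n"
      unfolding f0_def by (subst mult.commute) (rule window.ip_cmult_left)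
    then show ?thesis
      by (simp only: ip_window_indicator[OF _ I6(1)] freq_minus borel_closed closed_atLeastAtMost)
  qed
  have ipg0: "coeff g0 n = ft ?J (freq (- n))" for n
    unfolding g0_def by (simp only: ip_window_indicator[OF _ I6(2)] freq_minus borel_closed closed_atLeastAtMost)
  have V: "vp r t (- n - k) = coeff f1 n * cnj (coeff g1 n) / (12 * r)"
    "expo (- freq k) t * vp r t (- n) = coeff f0 n * cnj (coeff g0 n) / (12 * r)" for n
    by (simp_all add: vp_def cross_def ipf1 ipf0 ipg1 ipg0 s_def)
  have nf: "sqrt (sqn window f1) \<le> sqrt (3 * r)" "sqrt (sqn window f0) \<le> sqrt (3 * r)"
    using sqn_window_le[of f1 1 "t - 3 / 2 * r" "t + 3 / 2 * r"] sqn_window_le[of f0 1 "t - 3 / 2 * r" "t + 3 / 2 * r"] r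
    by (simp_all add: f1_def f0_def norm_mult indicator_def)
  have ng: "sqrt (sqn window g1) \<le> sqrt r" "sqrt (sqn window g0) \<le> sqrt r"
    using sqn_window_le[of g1 1 "- r / 2" "r / 2"] sqn_window_le[of g0 1 "- r / 2" "r / 2"] r
    by (simp_all add: g1_def g0_def norm_mult indicator_def)
  define h where "h n = vp r t (- n - k) - expo (- freq k) t * vp r t (- n)" for n
  have reindex: "((\<lambda>n. cmod (vp r t (n - k) - expo (- freq k) t * vp r t n)) has_sum S) UNIV \<longleftrightarrow> ((\<lambda>n. cmod (h n)) has_sum S) UNIV" for S
    by (rule has_sum_reindex_bij_witness[of _ uminus uminus]) (auto simp: h_def)
  show "(\<lambda>n. cmod (vp r t (n - k) - expo (- freq k) t * vp r t n)) summable_on UNIV"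
  proof (rule summable_on_comparison_test)
    have "(\<lambda>n. cmod (vp r t (n - k))) summable_on UNIV"
      using vp_summable by (subst summable_on_reindex_bij_witness[of _ "\<lambda>n. n + k" "\<lambda>n. n - k" UNIV]) auto
    then show "(\<lambda>n. cmod (vp r t (n - k)) + cmod (vp r t n)) summable_on UNIV"
      using vp_summable by (rule summable_on_add)
    show "cmod (vp r t (n - k) - expo (- freq k) t * vp r t n) \<le> cmod (vp r t (n - k)) + cmod (vp r t n)" for n
      using norm_triangle_ineq4[of "vp r t (n - k)" "expo (- freq k) t * vp r t n"] by (simp add: norm_mult)
  qed auto
  then have shift: "((\<lambda>n. cmod (h n)) has_sum vp_shift k) UNIV"
    unfolding reindex[symmetric] vp_shift_def by (rule has_sum_infsum)
  have prod: "(\<Sum>\<^sub>\<infinity>n. cmod (coeff f n) * cmod (coeff g n)) \<le> 12 * (p * q)"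
    if "bmeas window f" "bmeas window g" "sqrt (sqn window f) \<le> p" "sqrt (sqn window g) \<le> q" "p \<ge> 0" for f g p q
  proof -
    have "12 * sqrt (sqn window f) * sqrt (sqn window g) \<le> 12 * p * q"
      using that by (intro mult_mono) auto
    then show ?thesis
      using window_product(2)[OF that(1,2)] by simp
  qed
  let ?P = "\<lambda>f g n. cmod (coeff f n) * cmod (coeff g n)"
  have upper: "vp_shift k \<le> (S + T) / (12 * r)"
    if "bmeas window f" "bmeas window g" "bmeas window f'" "bmeas window g'"
      "infsum (?P f g) UNIV \<le> S" "infsum (?P f' g') UNIV \<le> T"
      "\<And>n. cmod (h n) \<le> (?P f g n + ?P f' g' n) / (12 * r)" for f g f' g' S T
  proof -
    have "((\<lambda>n. (?P f g n + ?P f' g' n) / (12 * r)) has_sum (infsum (?P f g) UNIV + infsum (?P f' g') UNIV) / (12 * r)) UNIV"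
      using window_product(1)[OF that(1,2)] window_product(1)[OF that(3,4)]
      by (intro has_sum_divide_const has_sum_add has_sum_infsum)
    from has_sum_mono[OF shift this that(7)] have "vp_shift k \<le> (infsum (?P f g) UNIV + infsum (?P f' g') UNIV) / (12 * r)"
      by simp
    also have "\<dots> \<le> (S + T) / (12 * r)"
      using that(5,6) r by (intro divide_right_mono) auto
    finally show ?thesis .
  qed
  \<comment> \<open>\<open>3 * r\<close> and \<open>r\<close> are the lengths of the two
    intervals.\<close>
  have sq3: "sqrt (3 * r) * sqrt r \<le> 2 * r"
  proof -
    have "sqrt (3 * r) * sqrt r = sqrt 3 * r"
      using r by (simp add: real_sqrt_mult)
    moreover have "sqrt 3 \<le> (2::real)"
      by (rule real_le_lsqrt) auto
    ultimately show ?thesis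
      using r by (simp add: mult_right_mono)
  qed
  have "vp_shift k \<le> (12 * (sqrt (3 * r) * sqrt r) + 12 * (sqrt (3 * r) * sqrt r)) / (12 * r)"
  proof (rule upper[of f1 g1 f0 g0])
    fix n
    have "cmod (h n) \<le> cmod (vp r t (- n - k)) + cmod (expo (- freq k) t * vp r t (- n))"
      unfolding h_def by (rule norm_triangle_ineq4)
    then show "cmod (h n) \<le> (?P f1 g1 n + ?P f0 g0 n) / (12 * r)"
      using r unfolding V by (simp add: norm_divide norm_mult add_divide_distrib)
  qed (use b nf ng r in \<open>auto intro!: prod\<close>)
  also have "\<dots> \<le> 4"
    using sq3 r by (simp add: field_simps)
  finally show "vp_shift k \<le> 4" .
  have df: "sqrt (sqn window (\<lambda>u. f1 u - f0 u)) \<le> 3 * pi * r * \<bar>s\<bar> * sqrt (3 * r)"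
  proof -
    have "cmod (f1 u - f0 u) \<le> (3 * pi * r * \<bar>s\<bar>) * indicator ?I u" for u
    proof (cases "u \<in> ?I")
      case True
      have "cmod (expo (- s) u - expo (- s) t) \<le> 2 * pi * (\<bar>s\<bar> * \<bar>u - t\<bar>)"
        using cmod_expo_diff[of u "- s" t] by (simp add: expo_def mult.commute abs_mult)
      also have "\<dots> \<le> 2 * pi * (\<bar>s\<bar> * (3 / 2 * r))"
        using True by (intro mult_left_mono) (auto simp: abs_real_def)
      finally show ?thesis
        using True by (simp add: f1_def f0_def mult_ac)
    qed (simp add: f1_def f0_def)
    from sqn_window_le[OF this] have "sqn window (\<lambda>u. f1 u - f0 u) \<le> (3 * pi * r * \<bar>s\<bar>)\<^sup>2 * (3 * r)"
      using r by simp
    then have "sqrt (sqn window (\<lambda>u. f1 u - f0 u)) \<le> sqrt ((3 * pi * r * \<bar>s\<bar>)\<^sup>2 * (3 * r))"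
      by (rule real_sqrt_le_mono)
    then show ?thesis
      using r by (simp only: real_sqrt_mult[of "(3 * pi * r * \<bar>s\<bar>)\<^sup>2"] real_sqrt_abs) (simp add: abs_mult)
  qed
  have dg: "sqrt (sqn window (\<lambda>u. g1 u - g0 u)) \<le> pi * r * \<bar>s\<bar> * sqrt r"
  proof -
    have "cmod (g1 u - g0 u) \<le> (pi * r * \<bar>s\<bar>) * indicator ?J u" for u
    proof (cases "u \<in> ?J")
      case True
      have "cmod (expo (- s) u - 1) \<le> 2 * pi * (\<bar>s\<bar> * \<bar>u\<bar>)"
        using cmod_expo_diff[of "- s" u 0] by (simp add: abs_mult)
      also have "\<dots> \<le> 2 * pi * (\<bar>s\<bar> * (r / 2))"
        using True by (intro mult_left_mono) (auto simp: abs_real_def)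
      finally show ?thesis
        using True by (simp add: g1_def g0_def mult_ac)
    qed (simp add: g1_def g0_def)
    from sqn_window_le[OF this] have "sqn window (\<lambda>u. g1 u - g0 u) \<le> (pi * r * \<bar>s\<bar>)\<^sup>2 * r"
      using r by simp
    then have "sqrt (sqn window (\<lambda>u. g1 u - g0 u)) \<le> sqrt ((pi * r * \<bar>s\<bar>)\<^sup>2 * r)"
      by (rule real_sqrt_le_mono)
    then show ?thesis
      using r by (simp only: real_sqrt_mult[of "(pi * r * \<bar>s\<bar>)\<^sup>2"] real_sqrt_abs) (simp add: abs_mult)
  qed
  have bd: "bmeas window (\<lambda>u. f1 u - f0 u)" "bmeas window (\<lambda>u. g1 u - g0 u)"
    using b by (auto intro: bmeas_diff)
  have p1: "infsum (?P (\<lambda>u. f1 u - f0 u) g1) UNIV \<le> 12 * (3 * pi * r * \<bar>s\<bar> * sqrt (3 * r) * sqrt r)"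
    by (rule prod[OF bd(1) b(3) df ng(1)]) (use r in simp)
  have p2: "infsum (?P f0 (\<lambda>u. g1 u - g0 u)) UNIV \<le> 12 * (sqrt (3 * r) * (pi * r * \<bar>s\<bar> * sqrt r))"
    by (rule prod[OF b(2) bd(2) nf(2) dg]) (use r in simp)
  have "vp_shift k \<le> (12 * (3 * pi * r * \<bar>s\<bar> * sqrt (3 * r) * sqrt r) + 12 * (sqrt (3 * r) * (pi * r * \<bar>s\<bar> * sqrt r))) / (12 * r)"
  proof (rule upper[OF bd(1) b(3) b(2) bd(2) p1 p2])
    fix n
    let ?e = "expo (freq n)"
    have d: "ip window (\<lambda>u. f1 u - f0 u) ?e = ip window f1 ?e - ip window f0 ?e"
      "ip window (\<lambda>u. g1 u - g0 u) ?e = ip window g1 ?e - ip window g0 ?e"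
      using b window.bmeas_phi[of n] by (simp_all add: window.ip_diff_left)
    \<comment> \<open>Telescoping: the difference of the two products is rewritten so that each term
      contains a difference \<open>f1 - f0\<close> or \<open>g1 - g0\<close>, whose norm carries an
      extra factor \<open>r * \<bar>s\<bar>\<close>.\<close>
    have hn: "h n = (ip window (\<lambda>u. f1 u - f0 u) ?e * cnj (ip window g1 ?e)
        + ip window f0 ?e * cnj (ip window (\<lambda>u. g1 u - g0 u) ?e)) / (12 * r)"
      unfolding h_def V d by (simp add: algebra_simps add_divide_distrib diff_divide_distrib)
    have "cmod (x * cnj y + z * cnj w) \<le> cmod x * cmod y + cmod z * cmod w" for x y z w
      using norm_triangle_ineq[of "x * cnj y" "z * cnj w"] by (simp add: norm_mult)
    then show "cmod (h n) \<le> (?P (\<lambda>u. f1 u - f0 u) g1 n + ?P f0 (\<lambda>u. g1 u - g0 u) n) / (12 * r)"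
      unfolding hn norm_divide using r by (simp add: norm_mult divide_right_mono)
  qed
  also have "\<dots> = 4 * pi * \<bar>s\<bar> * (sqrt (3 * r) * sqrt r)"
    using r by (simp add: field_simps)
  also have "\<dots> \<le> 4 * pi * \<bar>s\<bar> * (2 * r)"
    using sq3 by (intro mult_left_mono) auto
  finally show "vp_shift k \<le> 8 * pi * r * \<bar>freq k\<bar>"
    by (simp add: s_def mult_ac)
qed

end

lemma has_sum_norm_le:
  fixes f :: "'i \<Rightarrow> 'b::banach"
  assumes "(f has_sum a) A" "(g has_sum b) A" "\<And>i. i \<in> A \<Longrightarrow> norm (f i) \<le> g i"
  shows "norm a \<le> b"
proof -
  have "(\<lambda>i. norm (f i)) summable_on A"
    by (rule summable_on_comparison_test[OF has_sum_imp_summable[OF assms(2)]]) (use assms(3) in auto)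
  then have s: "((\<lambda>i. norm (f i)) has_sum (\<Sum>\<^sub>\<infinity>i\<in>A. norm (f i))) A"
    by (rule has_sum_infsum)
  show ?thesis
    using norm_has_sum_bound[OF s assms(1)] has_sum_mono[OF s assms(2,3)] by simp
qed

text \<open>Encodes local division by the autocorrelation of \<open>E\<close>: if its product with
  the transform of \<open>U\<close> vanishes, then every correlation supported within
  \<open>r\<close> of a frequency \<open>t\<close> in [-a, a] annihilates \<open>U\<close>. One
  \<open>r0\<close> serves all \<open>t\<close>, so that an interval can later be cut into finitely
  many equal pieces.\<close>

definition annihilation_scale :: "real set \<Rightarrow> real \<Rightarrow> real \<Rightarrow> bool" where
  "annihilation_scale E a r0 \<longleftrightarrow>
    (\<forall>r t X Y U K x. 0 < r \<longrightarrow> r \<le> r0 \<longrightarrow> \<bar>t\<bar> \<le> a \<longrightarrow> X \<in> sets borel \<longrightarrow> Y \<in> sets borel \<longrightarrow>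
      X \<subseteq> {-2..2} \<longrightarrow> Y \<subseteq> {-2..2} \<longrightarrow> (\<forall>u\<in>X. \<forall>v\<in>Y. \<bar>u - v - t\<bar> \<le> r) \<longrightarrow> (\<forall>x. cmod (U x) \<le> K) \<longrightarrow>
      (\<forall>x. conv (\<lambda>n. cross E E (freq n) / 12) U x = 0) \<longrightarrow> conv (\<lambda>n. cross X Y (freq n) / 12) U x = 0)"

text \<open>Put \<open>Z = \<kappa> * U\<close>, where \<open>\<kappa>\<close> are the coefficients of \<open>corr X Y\<close>. As \<open>Z\<close> is reproduced by \<open>vp r t\<close>, its translates
  nearly behave like those of the character of frequency \<open>t\<close>, so \<open>corr E E t * Z\<close> is close to \<open>q * Z = 0\<close>; the error is at
  most half of what is needed to conclude \<open>sup \<bar>Z\<bar> \<le> sup \<bar>Z\<bar> / 2\<close>.\<close>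

lemma wiener_local:
  assumes E: "E \<in> sets borel" "E \<subseteq> {0..3/2 - \<epsilon>}" "measure lborel E = 1" and \<epsilon>: "\<epsilon> > 0" and a: "0 \<le> a" "a < 1"
  obtains r0 where "r0 > 0" "annihilation_scale E a r0"
proof -
  have E2: "E \<subseteq> {-2..2}"
    using E(2) \<epsilon> by force
  define q where "q n = cross E E (freq n) / 12" for n
  define c0 where "c0 = min (1 - a) \<epsilon>"
  have c0: "c0 > 0"
    using a \<epsilon> by (simp add: c0_def)
  have "(\<lambda>n. cmod (cross E E (freq n)) * (1 / 12)) summable_on UNIV"
    using E(1) E2 by (intro summable_on_cmult_left cross_summable) auto
  then have qs: "(\<lambda>n. cmod (q n)) summable_on UNIV"
    by (simp add: q_def norm_divide)
  define Q where "Q = (\<Sum>\<^sub>\<infinity>n. cmod (q n))"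
  have Q: "((\<lambda>n. cmod (q n)) has_sum Q) UNIV"
    unfolding Q_def using qs by (rule has_sum_infsum)
  have Q0: "Q \<ge> 0"
    using has_sum_nonneg[OF Q] by simp
  \<comment> \<open>Outside \<open>T\<close> the coefficients have mass below \<open>c0 / 16\<close>
    and \<open>vp_shift\<close> is at most 4, which contributes at most
    \<open>c0 / 4\<close>.\<close>
  obtain T where T: "finite T" "\<bar>(\<Sum>n\<in>T. cmod (q n)) - Q\<bar> < c0 / 16"
    using has_sum_finite_lower[OF Q, of "c0 / 16"] c0 by (metis divide_pos_pos order_refl subset_UNIV zero_less_numeral)
  define R where "R = (\<Sum>n\<in>T. \<bar>freq n\<bar>)"
  have R0: "R \<ge> 0"
    by (simp add: R_def sum_nonneg)
  have RT: "\<bar>freq n\<bar> \<le> R" if "n \<in> T" for n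
    unfolding R_def using T(1) that by (intro member_le_sum) auto
  \<comment> \<open>On \<open>T\<close>, \<open>vp_shift\<close> is at most
    \<open>8 * pi * r * R\<close>; this choice makes the contribution at most \<open>c0 / 4\<close>,
    and the two quarters add up to the factor 1/2. Each \<open>+ 1\<close> keeps the denominator
    positive, and 1/2 is the size limit of the bounds on \<open>vp\<close>.\<close>
  define r0 where "r0 = min (1 / 2) (c0 / (32 * pi * (R + 1) * (Q + 1)))"
  have D: "32 * pi * (R + 1) * (Q + 1) > 0"
    using R0 Q0 by (intro mult_pos_pos) auto
  have r0: "r0 > 0"
    using D c0 by (simp add: r0_def)
  show ?thesis
  proof (rule that[OF r0], unfold annihilation_scale_def, intro allI impI)
    fix r t X Y U K x
    assume r: "0 < r" "r \<le> r0" and t: "\<bar>t\<bar> \<le> a"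
      and XY: "X \<in> sets borel" "Y \<in> sets borel" "X \<subseteq> {-2..2}" "Y \<subseteq> {-2..2}"
      and "\<forall>u\<in>X. \<forall>v\<in>Y. \<bar>u - v - t\<bar> \<le> r" "\<forall>x. cmod (U x) \<le> K"
      and "\<forall>x. conv (\<lambda>n. cross E E (freq n) / 12) U x = 0"
    then have diff: "\<And>u v. u \<in> X \<Longrightarrow> v \<in> Y \<Longrightarrow> \<bar>u - v - t\<bar> \<le> r"
      and U: "\<And>x. cmod (U x) \<le> K" and qU: "\<And>x. conv (\<lambda>n. cross E E (freq n) / 12) U x = 0"
      by blast+
    have r': "r \<le> 1 / 2" and t1: "\<bar>t\<bar> \<le> 1"
      using r t a by (auto simp: r0_def)
    note vp = vp_summable[OF r(1) r' t1] vp_shift_bounds[OF r(1) r' t1]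
    define \<kappa> where "\<kappa> n = cross X Y (freq n) / 12" for n
    have "(\<lambda>n. cmod (cross X Y (freq n)) * (1 / 12)) summable_on UNIV"
      using XY by (intro summable_on_cmult_left cross_summable) (auto intro: order_trans)
    then have \<kappa>s: "(\<lambda>n. cmod (\<kappa> n)) summable_on UNIV"
      by (simp add: \<kappa>_def norm_divide)
    define Z where "Z = conv \<kappa> U"
    define KZ where "KZ = (\<Sum>\<^sub>\<infinity>n. cmod (\<kappa> n)) * K"
    have ZK: "cmod (Z x) \<le> KZ" for x
      unfolding Z_def KZ_def using \<kappa>s U by (rule conv_bound)
    define S where "S = (SUP x. cmod (Z x))"
    have ZS: "cmod (Z x) \<le> S" for x
      unfolding S_def using ZK by (intro cSUP_upper bdd_aboveI2[where M = KZ]) auto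
    have S0: "S \<ge> 0"
      using ZS[of 0] norm_ge_zero order_trans by blast
    have rep: "conv (vp r t) Z x = Z x" for x
      unfolding Z_def
    proof (rule conv_assoc[OF vp(1) \<kappa>s U])
      fix l
      have "((\<lambda>n. vp r t n * cross X Y (freq l - freq n) * (1 / 12)) has_sum cross X Y (freq l) * (1 / 12)) UNIV"
        by (intro has_sum_cmult_left vp_reproduces r r' t1 XY diff)
      then show "((\<lambda>n. vp r t n * \<kappa> (l - n)) has_sum \<kappa> l) UNIV"
        by (simp add: \<kappa>_def freq_diff)
    qed
    have qZ: "conv q Z x = 0" for x
    proof -
      have "conv q Z x = conv \<kappa> (conv q U) x"
        unfolding Z_def using qs \<kappa>s U by (rule conv_commute)
      also have "conv q U = (\<lambda>_. 0)"
        using qU by (auto simp: q_def[abs_def])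
      finally show ?thesis
        by (simp add: conv_def)
    qed
    \<comment> \<open>As \<open>vp r t\<close> reproduces \<open>Z\<close>, a translate of
      \<open>Z\<close> is a convolution with the translated kernel, which is nearly a multiple of
      the kernel itself.\<close>
    have shift: "cmod (expo (- freq k) t * Z x - Z (x - freq k)) \<le> vp_shift r t k * S" for x k
    proof -
      have "((\<lambda>n. vp r t n * Z (x - freq k - freq n)) has_sum Z (x - freq k)) UNIV"
        using conv_has_sum[OF vp(1), of Z KZ "x - freq k", OF ZK] by (simp add: rep)
      then have h1: "((\<lambda>n. vp r t (n - k) * Z (x - freq n)) has_sum Z (x - freq k)) UNIV"
        by (subst has_sum_reindex_bij_witness[of _ "\<lambda>n. n + k" "\<lambda>n. n - k" UNIV "\<lambda>n. vp r t n * Z (x - freq k - freq n)"])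
          (auto simp: freq_diff freq_add)
      have h2: "((\<lambda>n. expo (- freq k) t * (vp r t n * Z (x - freq n))) has_sum expo (- freq k) t * Z x) UNIV"
        using conv_has_sum[OF vp(1), of Z KZ x, OF ZK] by (intro has_sum_cmult_right) (simp add: rep)
      have h3: "((\<lambda>n. cmod (vp r t (n - k) - expo (- freq k) t * vp r t n) * S) has_sum vp_shift r t k * S) UNIV"
        unfolding vp_shift_def[OF r(1) r' t1] by (intro has_sum_cmult_left has_sum_infsum vp(2))
      have "cmod (Z (x - freq k) - expo (- freq k) t * Z x) \<le> vp_shift r t k * S"
      proof (rule has_sum_norm_le[OF _ h3])
        show "((\<lambda>n. vp r t (n - k) * Z (x - freq n) - expo (- freq k) t * (vp r t n * Z (x - freq n))) has_sum
            Z (x - freq k) - expo (- freq k) t * Z x) UNIV"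
          using has_sum_add[OF h1 has_sum_uminusI[OF h2]] by simp
        show "cmod (vp r t (n - k) * Z (x - freq n) - expo (- freq k) t * (vp r t n * Z (x - freq n)))
            \<le> cmod (vp r t (n - k) - expo (- freq k) t * vp r t n) * S" for n
          using ZS[of "x - freq n"]
          by (simp add: mult.assoc[symmetric] left_diff_distrib[symmetric] norm_mult mult_left_mono)
      qed
      then show ?thesis
        by (simp add: norm_minus_commute)
    qed
    define b where "b k = cmod (q k) * (8 * pi * r * R) + (if k \<in> T then 0 else 4 * cmod (q k))" for k
    have "(b has_sum Q * (8 * pi * r * R) + 4 * (Q - (\<Sum>n\<in>T. cmod (q n)))) UNIV"
      unfolding b_def
    proof (intro has_sum_add has_sum_cmult_left Q)
      have "((\<lambda>k. cmod (q k)) has_sum Q - (\<Sum>n\<in>T. cmod (q n))) (UNIV - T)"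
        using has_sum_Diff[OF Q has_sum_finite[OF T(1)]] by simp
      then have "((\<lambda>k. 4 * cmod (q k)) has_sum 4 * (Q - (\<Sum>n\<in>T. cmod (q n)))) (UNIV - T)"
        by (rule has_sum_cmult_right)
      then show "((\<lambda>k. if k \<in> T then 0 else 4 * cmod (q k)) has_sum 4 * (Q - (\<Sum>n\<in>T. cmod (q n)))) UNIV"
        by (rule has_sum_cong_neutral[THEN iffD1, rotated -1]) auto
    qed
    moreover have "Q * (8 * pi * r * R) + 4 * (Q - (\<Sum>n\<in>T. cmod (q n))) \<le> c0 / 2"
    proof -
      have "Q * (8 * pi * r * R) \<le> (Q + 1) * (8 * pi * r * (R + 1))"
        using Q0 R0 r by (intro mult_mono) auto
      also have "\<dots> = r * (32 * pi * (R + 1) * (Q + 1)) / 4"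
        by simp
      also have "\<dots> \<le> c0 / 4"
      proof (rule divide_right_mono)
        have "r \<le> c0 / (32 * pi * (R + 1) * (Q + 1))"
          using r(2) by (simp add: r0_def)
        then show "r * (32 * pi * (R + 1) * (Q + 1)) \<le> c0"
          by (simp only: pos_le_divide_eq[OF D])
      qed simp
      finally have "Q * (8 * pi * r * R) \<le> c0 / 4" .
      moreover have "4 * (Q - (\<Sum>n\<in>T. cmod (q n))) \<le> c0 / 4"
      proof -
        have "- (c0 / 16) < (\<Sum>n\<in>T. cmod (q n)) - Q"
          using T(2) unfolding abs_less_iff by simp
        then show ?thesis
          by (simp add: field_simps)
      qed
      ultimately show ?thesis
        by (simp add: field_simps)
    qed
    ultimately obtain B where B: "(b has_sum B) UNIV" "B \<le> c0 / 2"
      by blast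
    have b: "cmod (q k) * vp_shift r t k \<le> b k" for k
    proof (cases "k \<in> T")
      case True
      have "vp_shift r t k \<le> 8 * pi * r * R"
        using vp(4)[of k] RT[OF True] r by (smt (verit) mult_left_mono mult_nonneg_nonneg pi_ge_zero)
      with True show ?thesis
        by (simp add: b_def mult_left_mono)
    next
      case False
      have le: "cmod (q k) * vp_shift r t k \<le> cmod (q k) * 4"
        using vp(3)[of k] by (intro mult_left_mono) auto
      have nonneg: "0 \<le> cmod (q k) * (8 * pi * r * R)"
        using r R0 by simp
      have "b k = cmod (q k) * (8 * pi * r * R) + cmod (q k) * 4"
        using False by (simp add: b_def)
      with add_mono[OF nonneg le] show ?thesis
        by (simp only: add_0)
    qed
    have key: "cmod (Z x) \<le> S / 2" for x
    proof -
      have cE: "c0 \<le> corr E E t"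
        unfolding c0_def using E t a \<epsilon> by (intro corr_lower) auto
      have h1: "((\<lambda>k. q k * expo (- freq k) t * Z x) has_sum corr E E t * Z x) UNIV"
        unfolding q_def using E(1) E2 t1 by (intro has_sum_cmult_left cross_fourier) auto
      have h2: "((\<lambda>k. q k * Z (x - freq k)) has_sum 0) UNIV"
        using conv_has_sum[OF qs, of Z KZ x, OF ZK] by (simp add: qZ)
      have "cmod (corr E E t * Z x - 0) \<le> B * S"
      proof (rule has_sum_norm_le)
        show "((\<lambda>k. q k * expo (- freq k) t * Z x - q k * Z (x - freq k)) has_sum corr E E t * Z x - 0) UNIV"
          using has_sum_add[OF h1 has_sum_uminusI[OF h2]] by simp
        show "((\<lambda>k. b k * S) has_sum B * S) UNIV"
          using B(1) by (rule has_sum_cmult_left)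
        show "cmod (q k * expo (- freq k) t * Z x - q k * Z (x - freq k)) \<le> b k * S" for k
        proof -
          have "cmod (q k * expo (- freq k) t * Z x - q k * Z (x - freq k)) = cmod (q k) * cmod (expo (- freq k) t * Z x - Z (x - freq k))"
            by (simp add: mult.assoc right_diff_distrib[symmetric] norm_mult)
          also have "\<dots> \<le> cmod (q k) * (vp_shift r t k * S)"
            using shift by (intro mult_left_mono) auto
          also have "\<dots> \<le> b k * S"
            using b[of k] S0 by (simp add: mult.assoc[symmetric] mult_right_mono)
          finally show ?thesis .
        qed
      qed
      then have "corr E E t * cmod (Z x) \<le> B * S"
        using cE c0 by (simp add: norm_mult)
      moreover have "c0 * cmod (Z x) \<le> corr E E t * cmod (Z x)" "B * S \<le> c0 / 2 * S"
        by (rule mult_right_mono[OF cE norm_ge_zero], rule mult_right_mono[OF B(2) S0])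
      ultimately have "c0 * cmod (Z x) \<le> c0 * (S / 2)"
        by simp
      then show ?thesis
        using c0 by simp
    qed
    \<comment> \<open>\<open>Z\<close> is bounded, so \<open>S\<close> is a genuine supremum and the
      halved bound forces it down to 0.\<close>
    have "S \<le> S / 2"
      unfolding S_def using key[unfolded S_def] by (intro cSUP_least) auto
    then have "cmod (Z x) \<le> 0"
      using ZS[of x] by linarith
    then show "conv (\<lambda>n. cross X Y (freq n) / 12) U x = 0"
      by (simp add: Z_def \<kappa>_def[abs_def])
  qed
qed


section \<open>Transforms of intervals: subdivision and decay\<close>

lemma ft_interval_split:
  fixes x :: real
  assumes "a \<le> b" "b \<le> c"
  shows "ft {a..c} x = ft {a..b} x + ft {b..c} x"
  using assms by (cases "x = 0") (simp_all add: ft_0 ft_interval diff_divide_distrib flip: of_real_add)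

lemma ft_interval_sum:
  fixes x :: real
  assumes "r \<ge> 0"
  shows "ft {0..real n * r} x = (\<Sum>i<n. ft {real i * r..real (Suc i) * r} x)"
proof (induction n)
  case 0
  show ?case
    using ft_interval[of 0 0 x] ft_0[of "{0..0::real}"] by (cases "x = 0") auto
next
  case (Suc n)
  have "ft {0..real (Suc n) * r} x = ft {0..real n * r} x + ft {real n * r..real (Suc n) * r} x"
    using assms by (intro ft_interval_split) (auto simp: algebra_simps)
  with Suc show ?case
    by simp
qed

text \<open>For a general measurable set \<open>ft\<close> decays at no fixed rate. For intervals
  the decay is quadratic, which makes sums against the weights converge
  (\<open>wsummable_decay\<close>).\<close>

lemma cross_interval_bound:
  fixes x :: real
  assumes "a \<le> b" "c \<le> d"
  shows "cmod (cross {a..b} {c..d} x) \<le> (b - a + 1) * (d - c + 1) / (1 + x\<^sup>2)"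
proof -
  have "cmod (cross {a..b} {c..d} x) \<le> (b - a + 1) / (1 + \<bar>x\<bar>) * ((d - c + 1) / (1 + \<bar>x\<bar>))"
    unfolding cross_def norm_mult complex_mod_cnj using assms
    by (intro mult_mono cmod_ft_interval_le) auto
  also have "\<dots> = (b - a + 1) * (d - c + 1) / (1 + \<bar>x\<bar>)\<^sup>2"
    by (simp add: power2_eq_square)
  also have "\<dots> \<le> (b - a + 1) * (d - c + 1) / (1 + x\<^sup>2)"
    using assms by (intro divide_left_mono) (auto simp: power2_sum intro!: mult_nonneg_nonneg mult_pos_pos add_pos_nonneg)
  finally show ?thesis .
qed

lemma summable_inverse_squares_int: "(\<lambda>n::int. 1 / (1 + (of_int n)\<^sup>2) :: real) summable_on UNIV"
proof -
  have "summable (\<lambda>n. 1 / (1 + (real n)\<^sup>2))"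
  proof (rule summable_comparison_test_ev)
    show "summable (\<lambda>n. 1 / real n ^ 2)"
      using inverse_power_summable[of 2, where ?'a = real] by (simp add: inverse_eq_divide)
    show "\<forall>\<^sub>F n in sequentially. norm (1 / (1 + (real n)\<^sup>2)) \<le> 1 / real n ^ 2"
      by (intro eventually_sequentiallyI[of 1]) (auto intro!: divide_left_mono mult_pos_pos add_pos_nonneg simp: abs_of_nonneg)
  qed
  then have N: "(\<lambda>n. 1 / (1 + (real n)\<^sup>2)) summable_on UNIV"
    by (subst summable_on_UNIV_nonneg_real_iff) auto
  have pos: "(\<lambda>n::int. 1 / (1 + (of_int n)\<^sup>2) :: real) summable_on range int"
    using N by (subst summable_on_reindex) (auto simp: o_def)
  have neg: "(\<lambda>n::int. 1 / (1 + (of_int n)\<^sup>2) :: real) summable_on range (\<lambda>n. - int n)"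
    using N by (subst summable_on_reindex) (auto simp: o_def inj_on_def)
  have "range int \<union> range (\<lambda>n. - int n) = UNIV"
  proof -
    have "n \<in> range int \<union> range (\<lambda>n. - int n)" for n
      by (cases n rule: int_cases2) auto
    then show ?thesis
      by blast
  qed
  with summable_on_union[OF pos neg] show ?thesis
    by simp
qed

section \<open>Weighted tilings on the line\<close>

text \<open>The tiling for one fixed second frequency, with the product structure forgotten. The
  positions \<open>p i\<close> may coincide, hence an indexed family instead of a set of
  points.\<close>

locale weighted_tiling =
  fixes I :: "'i set" and w p :: "'i \<Rightarrow> real" and E :: "real set" and \<epsilon> :: real
  assumes w_nonneg: "\<And>i. i \<in> I \<Longrightarrow> w i \<ge> 0"
    and E_borel: "E \<in> sets borel" and E_sub: "E \<subseteq> {0..3/2 - \<epsilon>}" and E_measure: "measure lborel E = 1"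
    and \<epsilon>_pos: "\<epsilon> > 0"
    and tile: "\<And>x. ((\<lambda>i. w i * (cmod (ft E (x - p i)))\<^sup>2) has_sum 1) I"
begin

lemma E_sub2: "E \<subseteq> {-2..2}"
  using E_sub \<epsilon>_pos by force

text \<open>Uniformity of \<open>B\<close> in \<open>x\<close> is what permits interchanging the sum
  over translates with \<open>conv\<close> (\<open>wsum_conv\<close>).\<close>

definition wsummable :: "(real \<Rightarrow> complex) \<Rightarrow> real \<Rightarrow> bool" where
  "wsummable h B \<longleftrightarrow> (\<forall>x. \<exists>s\<le>B. ((\<lambda>i. w i * cmod (h (x - p i))) has_sum s) I)"

definition wsum :: "(real \<Rightarrow> complex) \<Rightarrow> real \<Rightarrow> complex" where
  "wsum h x = (\<Sum>\<^sub>\<infinity>i\<in>I. complex_of_real (w i) * h (x - p i))"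

lemma wsummable_abs:
  assumes "wsummable h B"
  shows "(\<lambda>i. cmod (complex_of_real (w i) * h (x - p i))) summable_on I" "(\<Sum>\<^sub>\<infinity>i\<in>I. cmod (complex_of_real (w i) * h (x - p i))) \<le> B"
proof -
  obtain s where s: "s \<le> B" "((\<lambda>i. w i * cmod (h (x - p i))) has_sum s) I"
    using assms unfolding wsummable_def by blast
  have "((\<lambda>i. cmod (complex_of_real (w i) * h (x - p i))) has_sum s) I"
    by (subst has_sum_cong[OF _ ]) (use s(2) w_nonneg in \<open>auto simp: norm_mult intro: refl\<close>)
  then show "(\<lambda>i. cmod (complex_of_real (w i) * h (x - p i))) summable_on I" "(\<Sum>\<^sub>\<infinity>i\<in>I. cmod (complex_of_real (w i) * h (x - p i))) \<le> B"
    using s(1) by (auto simp: infsumI summable_on_def)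
qed

lemma wsum_has_sum:
  assumes "wsummable h B"
  shows "((\<lambda>i. complex_of_real (w i) * h (x - p i)) has_sum wsum h x) I"
proof -
  have "(\<lambda>i. complex_of_real (w i) * h (x - p i)) summable_on I"
    by (rule abs_summable_summable) (rule wsummable_abs[OF assms])
  then show ?thesis
    unfolding wsum_def by (rule has_sum_infsum)
qed

lemma wsum_bound:
  assumes "wsummable h B"
  shows "cmod (wsum h x) \<le> B"
  unfolding wsum_def using norm_infsum_bound[OF wsummable_abs(1)[OF assms]] wsummable_abs(2)[OF assms]
  by (rule order_trans)

lemma wsum_conv:
  assumes c: "(\<lambda>n. cmod (c n)) summable_on UNIV" and h: "wsummable h B"
    and g: "\<And>x. ((\<lambda>n. c n * h (x - freq n)) has_sum g x) UNIV"
  shows "conv c (wsum h) x = wsum g x"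
proof -
  have B0: "B \<ge> 0"
    using order_trans[OF norm_ge_zero wsum_bound[OF h]] by blast
  have s: "(\<lambda>(n, i). c n * (complex_of_real (w i) * h (x - freq n - p i))) summable_on UNIV \<times> I"
  proof (rule abs_summable_summable, rule summable_on_SigmaI)
    show "((\<lambda>i. cmod (case (n, i) of (n, i) \<Rightarrow> c n * (complex_of_real (w i) * h (x - freq n - p i)))) has_sum
        cmod (c n) * (\<Sum>\<^sub>\<infinity>i\<in>I. cmod (complex_of_real (w i) * h (x - freq n - p i)))) I" for n
      using has_sum_cmult_right[OF has_sum_infsum[OF wsummable_abs(1)[OF h]], of "cmod (c n)" "x - freq n"]
      by (simp add: norm_mult)
    show "(\<lambda>n. cmod (c n) * (\<Sum>\<^sub>\<infinity>i\<in>I. cmod (complex_of_real (w i) * h (x - freq n - p i)))) summable_on UNIV"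
    proof (rule summable_on_comparison_test)
      show "(\<lambda>n. cmod (c n) * B) summable_on UNIV"
        using c by (rule summable_on_cmult_left)
      show "cmod (c n) * (\<Sum>\<^sub>\<infinity>i\<in>I. cmod (complex_of_real (w i) * h (x - freq n - p i))) \<le> cmod (c n) * B" for n
        using wsummable_abs(2)[OF h] by (intro mult_left_mono) auto
    qed (auto intro!: mult_nonneg_nonneg infsum_nonneg)
  qed simp
  have "conv c (wsum h) x = (\<Sum>\<^sub>\<infinity>n. \<Sum>\<^sub>\<infinity>i\<in>I. c n * (complex_of_real (w i) * h (x - freq n - p i)))"
    unfolding conv_def wsum_def by (simp add: infsum_cmult_right')
  also have "\<dots> = (\<Sum>\<^sub>\<infinity>i\<in>I. \<Sum>\<^sub>\<infinity>n. c n * (complex_of_real (w i) * h (x - freq n - p i)))"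
    using s by (rule infsum_swap_banach)
  also have "\<dots> = wsum g x"
    unfolding wsum_def
  proof (rule infsum_cong)
    fix i
    have "((\<lambda>n. w i * (c n * h (x - p i - freq n))) has_sum w i * g (x - p i)) UNIV"
      using g by (rule has_sum_cmult_right)
    then have "((\<lambda>n. c n * (complex_of_real (w i) * h (x - freq n - p i))) has_sum w i * g (x - p i)) UNIV"
      by (simp add: mult.left_commute diff_diff_eq add.commute)
    then show "(\<Sum>\<^sub>\<infinity>n. c n * (complex_of_real (w i) * h (x - freq n - p i))) = w i * g (x - p i)"
      by (rule infsumI)
  qed
  finally show ?thesis .
qed

text \<open>The distance 1/24 is half the spacing of the lattice \<open>freq n\<close>.
  \<open>ft E\<close> is 1 at 0 with Lipschitz constant at most \<open>3 * pi\<close>, so its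
  modulus drops by at most pi / 8, less than 1/2.\<close>

lemma ft_E_lower:
  assumes "\<bar>x\<bar> \<le> 1 / 24"
  shows "1 / 4 \<le> (cmod (ft E x))\<^sup>2"
proof -
  have El: "E \<in> lmeasurable" and Em: "measure lebesgue E = 1"
    using E_borel E_measure bounded_subset[OF bounded_closed_interval E_sub]
    by (auto intro!: bounded_set_imp_lmeasurable)
  have "cmod (ft E 0 - ft E x) \<le> 2 * pi * \<bar>0 - x\<bar> * (3 / 2) * measure lebesgue E"
    using El E_sub \<epsilon>_pos by (intro ft_lipschitz) force+
  also have "\<dots> \<le> 3 * pi * (1 / 24)"
    using assms Em by (simp add: mult_left_mono)
  also have "\<dots> \<le> 1 / 2"
    using pi_less_4 by simp
  finally have "1 / 2 \<le> cmod (ft E x)"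
    using norm_triangle_ineq2[of "ft E 0" "ft E x"] Em El by (simp add: ft_0 fmeasurableD)
  then have "(1 / 2)\<^sup>2 \<le> (cmod (ft E x))\<^sup>2"
    by (intro power_mono) auto
  then show ?thesis
    by (simp add: power2_eq_square)
qed

text \<open>1152 is 288 times 4: the factor 288, twice the square of 12, compares the decay at a
  point with that at the index of the nearest lattice point, and 4 is the reciprocal of the bound in
  \<open>ft_E_lower\<close>.\<close>

definition decay_const :: real where
  "decay_const = 1152 * (\<Sum>\<^sub>\<infinity>n::int. 1 / (1 + (of_int n)\<^sup>2))"

text \<open>Since \<open>ft E\<close> stays away from \<open>0\<close> near the origin, the tiling bounds the total weight in any short interval.\<close>

lemma weighted_decay_sum:
  assumes S: "finite S" "S \<subseteq> I"
  shows "(\<Sum>i\<in>S. w i * (1 / (1 + (x - p i)\<^sup>2))) \<le> decay_const"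
proof -
  define r where "r i = round (12 * (x - p i))" for i
  define \<gamma> where "\<gamma> n = 1 / (1 + (real_of_int n)\<^sup>2)" for n
  have \<gamma>0: "\<gamma> n \<ge> 0" for n
    by (simp add: \<gamma>_def)
  have step: "1 / (1 + (x - p i)\<^sup>2) \<le> 1152 * \<gamma> (r i) * (cmod (ft E (x - freq (r i) - p i)))\<^sup>2" for i
  proof -
    define y where "y = x - p i"
    have near: "\<bar>12 * y - of_int (r i)\<bar> \<le> 1 / 2"
      using of_int_round_abs_le[of "12 * y"] by (simp add: r_def y_def abs_minus_commute)
    then have "\<bar>y - freq (r i)\<bar> \<le> 1 / 24"
      by (auto simp: freq_def abs_le_iff field_simps)
    then have g: "1 / 4 \<le> (cmod (ft E (y - freq (r i))))\<^sup>2"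
      by (rule ft_E_lower)
    have "\<bar>of_int (r i)\<bar> \<le> 12 * \<bar>y\<bar> + 1 / 2"
      using near by (simp add: abs_real_def split: if_splits)
    then have "\<bar>of_int (r i)\<bar>\<^sup>2 \<le> (12 * \<bar>y\<bar> + 1 / 2)\<^sup>2"
      by (intro power_mono) auto
    also have "\<dots> \<le> 288 * y\<^sup>2 + 1 / 2"
      using zero_le_power2[of "12 * \<bar>y\<bar> - 1 / 2"] by (simp add: power2_eq_square algebra_simps)
    finally have "1 + (of_int (r i))\<^sup>2 \<le> 288 * (1 + y\<^sup>2)"
      by simp
    then have "1 / (1 + y\<^sup>2) \<le> 288 * \<gamma> (r i)"
      using add_pos_nonneg[of 1 "y\<^sup>2"] add_pos_nonneg[of 1 "(real_of_int (r i))\<^sup>2"]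
      by (simp add: \<gamma>_def field_simps)
    also have "\<dots> \<le> 288 * \<gamma> (r i) * (4 * (cmod (ft E (y - freq (r i))))\<^sup>2)"
      using g \<gamma>0[of "r i"] mult_left_mono[of 1 "4 * (cmod (ft E (y - freq (r i))))\<^sup>2" "288 * \<gamma> (r i)"] by simp
    finally show ?thesis
      by (simp add: y_def diff_diff_eq add.commute mult.assoc)
  qed
  have "(\<Sum>i\<in>S. w i * (1 / (1 + (x - p i)\<^sup>2)))
      \<le> (\<Sum>i\<in>S. w i * (1152 * \<gamma> (r i) * (cmod (ft E (x - freq (r i) - p i)))\<^sup>2))"
    using S(2) w_nonneg step by (intro sum_mono mult_left_mono) auto
  \<comment> \<open>Indices are grouped by the lattice point nearest to \<open>x - p i\<close>; each
    group is controlled by the tiling sum at \<open>x - freq n\<close>.\<close>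
  also have "\<dots> = (\<Sum>n\<in>r ` S. \<Sum>i\<in>{i\<in>S. r i = n}. w i * (1152 * \<gamma> (r i) * (cmod (ft E (x - freq (r i) - p i)))\<^sup>2))"
    using S(1) by (intro sum.group[symmetric]) auto
  also have "\<dots> = (\<Sum>n\<in>r ` S. 1152 * \<gamma> n * (\<Sum>i\<in>{i\<in>S. r i = n}. w i * (cmod (ft E (x - freq n - p i)))\<^sup>2))"
    by (intro sum.cong refl) (auto simp: sum_distrib_left intro!: sum.cong)
  also have "\<dots> \<le> (\<Sum>n\<in>r ` S. 1152 * \<gamma> n * 1)"
  proof (intro sum_mono mult_left_mono)
    fix n
    show "(\<Sum>i\<in>{i\<in>S. r i = n}. w i * (cmod (ft E (x - freq n - p i)))\<^sup>2) \<le> 1"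
      using S w_nonneg by (intro finite_sum_le_has_sum[OF tile]) auto
  qed (simp add: \<gamma>0)
  also have "\<dots> = 1152 * (\<Sum>n\<in>r ` S. \<gamma> n)"
    by (simp add: sum_distrib_left)
  also have "\<dots> \<le> decay_const"
  proof -
    have "(\<Sum>n\<in>r ` S. \<gamma> n) \<le> infsum \<gamma> UNIV"
      using summable_inverse_squares_int S(1) \<gamma>0 unfolding \<gamma>_def[symmetric]
      by (intro finite_sum_le_infsum) auto
    then show ?thesis
      by (simp add: decay_const_def \<gamma>_def[abs_def])
  qed
  finally show ?thesis .
qed

lemma weighted_decay_summable: "(\<lambda>i. w i * (1 / (1 + (x - p i)\<^sup>2))) summable_on I"
  using w_nonneg weighted_decay_sum
  by (intro nonneg_bdd_above_summable_on bdd_aboveI2[where M = decay_const]) auto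

lemma wsummable_decay:
  assumes h: "\<And>x. cmod (h x) \<le> C / (1 + x\<^sup>2)"
  shows "wsummable h (C * decay_const)"
  unfolding wsummable_def
proof (intro allI)
  fix x
  let ?d = "\<lambda>i. w i * (1 / (1 + (x - p i)\<^sup>2))"
  have C: "C \<ge> 0"
    using order_trans[OF norm_ge_zero h[of 0]] by simp
  have d: "((\<lambda>i. C * ?d i) has_sum C * infsum ?d I) I"
    using weighted_decay_summable by (intro has_sum_cmult_right has_sum_infsum)
  have le: "w i * cmod (h (x - p i)) \<le> C * ?d i" if "i \<in> I" for i
    using mult_left_mono[OF h[of "x - p i"] w_nonneg[OF that]] by (simp add: mult.commute)
  then have "(\<lambda>i. w i * cmod (h (x - p i))) summable_on I"
    using w_nonneg by (intro summable_on_comparison_test[OF has_sum_imp_summable[OF d]]) auto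
  then obtain s where s: "((\<lambda>i. w i * cmod (h (x - p i))) has_sum s) I"
    unfolding summable_on_def by blast
  have "s \<le> C * infsum ?d I"
    by (rule has_sum_mono[OF s d le])
  also have "\<dots> \<le> C * decay_const"
    using C weighted_decay_sum weighted_decay_summable by (intro mult_left_mono infsum_le_finite_sums) auto
  finally show "\<exists>s\<le>C * decay_const. ((\<lambda>i. w i * cmod (h (x - p i))) has_sum s) I"
    using s by blast
qed

lemma wsummable_E: "wsummable (cross E E) 1"
  unfolding wsummable_def
proof (intro allI exI[of _ 1] conjI)
  show "((\<lambda>i. w i * cmod (cross E E (x - p i))) has_sum 1) I" for x
    using tile[of x] by (simp add: cross_def norm_mult power2_eq_square)
qed simp

lemma wsum_E: "wsum (cross E E) x = 1"
proof -
  have "((\<lambda>i. complex_of_real (w i * (cmod (ft E (x - p i)))\<^sup>2)) has_sum of_real 1) I"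
    using tile[of x] by (simp only: has_sum_of_real_iff)
  then have "((\<lambda>i. w i * cross E E (x - p i)) has_sum 1) I"
    by (simp add: cross_def complex_norm_square del: of_real_power)
  then show ?thesis
    unfolding wsum_def by (rule infsumI)
qed

lemma conv_diff_const:
  assumes c: "(\<lambda>n. cmod (c n)) summable_on UNIV" "(c has_sum s) UNIV" and U: "\<And>x. cmod (U x) \<le> K"
  shows "conv c (\<lambda>x. U x - k) x = conv c U x - s * k"
proof -
  have "((\<lambda>n. c n * U (x - freq n) - c n * k) has_sum conv c U x - s * k) UNIV"
    using has_sum_add[OF conv_has_sum[OF c(1), of U K x, OF U] has_sum_uminusI[OF has_sum_cmult_left[OF c(2), of k]]] by simp
  then show ?thesis
    unfolding conv_def by (simp add: right_diff_distrib infsumI)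
qed

lemma cross_coeff:
  assumes "A \<in> sets borel" "B \<in> sets borel" "A \<subseteq> {-2..2}" "B \<subseteq> {-2..2}"
  shows "(\<lambda>n. cmod (cross A B (freq n) / 12)) summable_on UNIV"
    and "((\<lambda>n. cross A B (freq n) / 12) has_sum of_real (corr A B 0)) UNIV"
proof -
  have "(\<lambda>n. cmod (cross A B (freq n)) * (1 / 12)) summable_on UNIV"
    using assms by (intro summable_on_cmult_left cross_summable) (auto intro: order_trans)
  then show "(\<lambda>n. cmod (cross A B (freq n) / 12)) summable_on UNIV"
    by (simp add: norm_divide)
  show "((\<lambda>n. cross A B (freq n) / 12) has_sum of_real (corr A B 0)) UNIV"
    using cross_fourier[OF assms, of 0] by (simp add: expo_def)
qed

text \<open>\<open>trap\<close> is the transform of the trapezoid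
  \<open>2 * corr wide narrow\<close>, which is 1 on [-1, 1] because 5/4 - 1/4 = 1 and the shorter
  interval has length 1/2. Summing its translates replaces the weights by a bounded function with
  the same transform on [-1, 1]; the 1 subtracted in \<open>defect\<close> removes the mass at
  frequency 0.\<close>

definition "wide = {-5/4..5/4::real}"
definition "narrow = {-1/4..1/4::real}"
definition "trap x = 2 * cross wide narrow x"
definition "defect x = wsum trap x - 1"

lemma wide_narrow: "wide \<in> sets borel" "narrow \<in> sets borel" "wide \<subseteq> {-2..2}" "narrow \<subseteq> {-2..2}"
  by (auto simp: wide_def narrow_def)

lemma corr_wide_narrow: "\<bar>t\<bar> \<le> 1 \<Longrightarrow> corr wide narrow t = 1 / 2"
  by (subst corr_eq_length) (auto simp: wide_def narrow_def)

lemma wsummable_trap: obtains B where "wsummable trap B"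
proof -
  have "cmod (trap x) \<le> (2 * ((5/4 - (-5/4) + 1) * (1/4 - (-1/4) + 1))) / (1 + x\<^sup>2)" for x
  proof -
    have "cmod (trap x) = 2 * cmod (cross wide narrow x)"
      by (simp add: trap_def norm_mult)
    also have "\<dots> \<le> 2 * ((5/4 - (-5/4) + 1) * (1/4 - (-1/4) + 1) / (1 + x\<^sup>2))"
      unfolding wide_def narrow_def by (intro mult_left_mono cross_interval_bound) auto
    finally show ?thesis
      by (simp only: times_divide_eq_right)
  qed
  then show ?thesis
    using that wsummable_decay by blast
qed

text \<open>Multiplication by the trapezoid and by the autocorrelation commute. So the
  autocorrelation acting on \<open>wsum trap\<close> equals the trapezoid acting on
  \<open>wsum (cross E E)\<close>, the constant 1, which returns the trapezoid's value 1 at 0. The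
  subtracted 1 contributes \<open>corr E E 0 = 1\<close> as well.\<close>

lemma conv_E_defect: "conv (\<lambda>n. cross E E (freq n) / 12) defect x = 0"
proof -
  obtain B where B: "wsummable trap B"
    by (rule wsummable_trap)
  define G where "G x = 2 * (LINT t|lborel. corr E E t * corr wide narrow t * expo x t)" for x
  note E = E_borel E_borel E_sub2 E_sub2
  have "((\<lambda>n. 2 * (cross E E (freq n) / 12 * cross wide narrow (x - freq n))) has_sum G x) UNIV" for x
    unfolding G_def using E wide_narrow by (intro has_sum_cmult_right cross_convolution)
  then have g1: "((\<lambda>n. cross E E (freq n) / 12 * trap (x - freq n)) has_sum G x) UNIV" for x
    by (simp add: trap_def mult.left_commute)
  have "((\<lambda>n. 2 * (cross wide narrow (freq n) / 12 * cross E E (x - freq n))) has_sum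
      2 * (LINT t|lborel. corr wide narrow t * corr E E t * expo x t)) UNIV" for x
    using E wide_narrow by (intro has_sum_cmult_right cross_convolution)
  then have g2: "((\<lambda>n. (2 * (cross wide narrow (freq n) / 12)) * cross E E (x - freq n)) has_sum G x) UNIV" for x
    by (simp add: G_def mult.assoc mult.commute[of "complex_of_real (corr E E _)"])
  have c2: "(\<lambda>n. cmod (2 * (cross wide narrow (freq n) / 12))) summable_on UNIV"
    using summable_on_cmult_right[OF cross_coeff(1)[OF wide_narrow], of 2] by (simp add: norm_mult)
  have "conv (\<lambda>n. cross E E (freq n) / 12) (wsum trap) x = wsum G x"
    using cross_coeff(1)[OF E] B g1 by (rule wsum_conv)
  also have "\<dots> = conv (\<lambda>n. 2 * (cross wide narrow (freq n) / 12)) (wsum (cross E E)) x"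
    using c2 wsummable_E g2 by (rule wsum_conv[symmetric])
  also have "\<dots> = (\<Sum>\<^sub>\<infinity>n. 2 * (cross wide narrow (freq n) / 12))"
    by (simp add: conv_def wsum_E)
  also have "\<dots> = 2 * of_real (corr wide narrow 0)"
    using cross_coeff(2)[OF wide_narrow] by (intro infsumI has_sum_cmult_right)
  finally have "conv (\<lambda>n. cross E E (freq n) / 12) (wsum trap) x = 1"
    by (simp add: corr_wide_narrow)
  moreover have "corr E E 0 = 1"
    using E_measure by (subst corr_eq_length) auto
  ultimately show ?thesis
    unfolding defect_def using conv_diff_const[OF cross_coeff[OF E] wsum_bound[OF B], where k = 1 and x = x] by simp
qed

text \<open>Differences of points of {0..1} lie in [-1, 1], where the trapezoid is 1; so smoothing
  by \<open>trap\<close> leaves \<open>cross X Y\<close> unchanged.\<close>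

lemma conv_cross_defect:
  assumes XY: "X \<in> sets borel" "Y \<in> sets borel" "X \<subseteq> {0..1}" "Y \<subseteq> {0..1}"
  shows "conv (\<lambda>n. cross X Y (freq n) / 12) defect x = wsum (cross X Y) x - corr X Y 0"
proof -
  obtain B where B: "wsummable trap B"
    by (rule wsummable_trap)
  have XY2: "X \<in> sets borel" "Y \<in> sets borel" "X \<subseteq> {-2..2}" "Y \<subseteq> {-2..2}"
    using XY by auto
  have g: "((\<lambda>n. cross X Y (freq n) / 12 * trap (x - freq n)) has_sum cross X Y x) UNIV" for x
  proof -
    have "2 * (complex_of_real (corr X Y t) * complex_of_real (corr wide narrow t) * expo x t) = corr X Y t * expo x t" for t
    proof (cases "\<bar>t\<bar> \<le> 1")
      case False
      then have "corr X Y t = 0"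
        using XY(3,4) by (intro corr_eq_0) force
      then show ?thesis
        by simp
    qed (simp add: corr_wide_narrow)
    then have "2 * (LINT t|lborel. complex_of_real (corr X Y t) * complex_of_real (corr wide narrow t) * expo x t) = cross X Y x"
      unfolding cross_eq[OF XY2] integral_mult_right_zero[symmetric] by (simp only:)
    moreover have "((\<lambda>n. 2 * (cross X Y (freq n) / 12 * cross wide narrow (x - freq n))) has_sum
        2 * (LINT t|lborel. corr X Y t * corr wide narrow t * expo x t)) UNIV"
      using XY2 wide_narrow by (intro has_sum_cmult_right cross_convolution)
    ultimately show ?thesis
      by (simp add: trap_def mult.left_commute)
  qed
  have "conv (\<lambda>n. cross X Y (freq n) / 12) (wsum trap) x = wsum (cross X Y) x"
    using cross_coeff(1)[OF XY2] B g by (rule wsum_conv)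
  then show ?thesis
    unfolding defect_def using conv_diff_const[OF cross_coeff[OF XY2] wsum_bound[OF B], where k = 1 and x = x] by simp
qed

lemma has_sum_sum:
  fixes f :: "'j \<Rightarrow> 'k \<Rightarrow> complex"
  assumes "finite J" "\<And>j. j \<in> J \<Longrightarrow> (f j has_sum s j) A"
  shows "((\<lambda>n. \<Sum>j\<in>J. f j n) has_sum (\<Sum>j\<in>J. s j)) A"
  using assms by (induction J rule: finite_induct) (auto intro: has_sum_add)

text \<open>[0, a] is cut into \<open>K\<close> pieces of length at most \<open>r0\<close>. The
  correlation of pieces i and j is supported within \<open>r\<close> of \<open>(i - j) * r\<close>,
  a point of [-a, a], so it annihilates \<open>defect\<close>; summing over all pairs, so does the
  autocorrelation of [0, a].\<close>

lemma tiling_short_interval: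
  assumes a: "0 < a" "a < 1"
  shows "((\<lambda>i. w i * (cmod (ft {0..a} (x - p i)))\<^sup>2) has_sum a) I"
proof (rule wiener_local[OF E_borel E_sub E_measure \<epsilon>_pos less_imp_le[OF a(1)] a(2)])
  fix r0 :: real
  assume r0: "r0 > 0" and W: "annihilation_scale E a r0"
  obtain B where B: "wsummable trap B"
    by (rule wsummable_trap)
  have U: "cmod (defect x) \<le> B + 1" for x
    using norm_triangle_ineq4[of "wsum trap x" 1] wsum_bound[OF B, of x] by (simp add: defect_def)
  obtain K :: nat where K: "a / r0 < real K"
    using reals_Archimedean2 by blast
  have K0: "K > 0"
    using K a r0 by (cases K) (auto simp: divide_less_0_iff)
  define r where "r = a / real K"
  have r: "0 < r" "r \<le> r0" and Kr: "real K * r = a"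
    using a K K0 r0 by (auto simp: r_def field_simps)
  define X where "X i = {real i * r..real (Suc i) * r}" for i
  have X_in: "0 \<le> u \<and> u \<le> a" if "u \<in> X i" "i < K" for i u
  proof -
    have "real (Suc i) * r \<le> real K * r"
      using that r by (intro mult_right_mono) auto
    moreover have "0 \<le> real i * r"
      using r by simp
    moreover have "real i * r \<le> u" "u \<le> real (Suc i) * r"
      using that(1) by (simp_all add: X_def)
    ultimately show ?thesis
      unfolding Kr by linarith
  qed
  have zero: "conv (\<lambda>n. cross (X i) (X j) (freq n) / 12) defect x = 0" if ij: "i < K" "j < K" for i j x
  proof (rule W[unfolded annihilation_scale_def, rule_format, OF r, where t = "(real i - real j) * r" and K = "B + 1"])
    have "\<bar>real i - real j\<bar> * r \<le> real K * r"
      using ij r by (intro mult_right_mono) auto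
    then show "\<bar>(real i - real j) * r\<bar> \<le> a"
      using r Kr by (simp add: abs_mult)
    show "X i \<subseteq> {-2..2}" "X j \<subseteq> {-2..2}"
      using X_in ij a by force+
    show "\<bar>u - v - (real i - real j) * r\<bar> \<le> r" if "u \<in> X i" "v \<in> X j" for u v
      using that by (auto simp: X_def algebra_simps abs_le_iff)
  qed (auto simp: X_def U conv_E_defect)
  have Xs: "X i \<in> sets borel" "i < K \<Longrightarrow> X i \<subseteq> {-2..2}" for i
    using X_in[of _ i] a by (force simp: X_def)+
  have ft_sum: "ft {0..a} y = (\<Sum>i<K. ft (X i) y)" for y
    using ft_interval_sum[of r K y] r by (simp add: Kr X_def)
  have cross_sum: "cross {0..a} {0..a} y = (\<Sum>(i, j)\<in>{..<K} \<times> {..<K}. cross (X i) (X j) y)" for y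
    unfolding cross_def ft_sum cnj_sum sum_product sum.cartesian_product by simp
  have "((\<lambda>n. \<Sum>z\<in>{..<K} \<times> {..<K}. cross (X (fst z)) (X (snd z)) (freq n) / 12 * defect (x - freq n)) has_sum
      (\<Sum>z\<in>{..<K} \<times> {..<K}. 0)) UNIV"
  proof (rule has_sum_sum)
    fix z assume "z \<in> {..<K} \<times> {..<K}"
    then have "fst z < K" "snd z < K"
      by auto
    then show "((\<lambda>n. cross (X (fst z)) (X (snd z)) (freq n) / 12 * defect (x - freq n)) has_sum 0) UNIV"
      using conv_has_sum[OF cross_coeff(1)[of "X (fst z)" "X (snd z)"], of defect "B + 1" x, OF Xs(1) Xs(1) Xs(2) Xs(2) U] zero
      by simp
  qed simp
  then have "conv (\<lambda>n. cross {0..a} {0..a} (freq n) / 12) defect x = 0"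
    unfolding conv_def
    by (simp add: cross_sum case_prod_unfold sum_divide_distrib sum_distrib_right infsumI)
  moreover have "corr {0..a} {0..a} 0 = a"
    using a by (subst corr_eq_length) auto
  ultimately have ws: "wsum (cross {0..a} {0..a}) x = a"
    using conv_cross_defect[of "{0..a}" "{0..a}" x] a by simp
  have "wsummable (cross {0..a} {0..a}) (((a - 0 + 1) * (a - 0 + 1)) * decay_const)"
    using a by (intro wsummable_decay cross_interval_bound) auto
  from wsum_has_sum[OF this, of x] have "((\<lambda>i. complex_of_real (w i * (cmod (ft {0..a} (x - p i)))\<^sup>2)) has_sum of_real a) I"
    unfolding ws by (simp add: cross_def complex_norm_square del: of_real_power)
  then show ?thesis
    by (simp only: has_sum_of_real_iff)
qed

text \<open>The limit a to 1 in \<open>tiling_short_interval\<close>. For the upper bound finite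
  sums suffice; the lower bound also requires that no mass escapes to infinity, which the quadratic
  decay prevents uniformly in \<open>a\<close>.\<close>

lemma tiling_unit_interval: "((\<lambda>i. w i * sinc2 (x - p i)) has_sum 1) I"
proof -
  have close: "\<bar>sinc2 y - (cmod (ft {0..a} y))\<^sup>2\<bar> \<le> 2 * (1 - a)" if a: "0 < a" "a < 1" for a y
  proof -
    have m: "cmod (ft {0..1} y) \<le> 1" "cmod (ft {0..a} y) \<le> 1" "cmod (ft {a..1} y) \<le> 1 - a"
      using cmod_ft_le[of "{0..1}" y] cmod_ft_le[of "{0..a}" y] cmod_ft_le[of "{a..1}" y] a by auto
    have "\<bar>cmod (ft {0..1} y) - cmod (ft {0..a} y)\<bar> \<le> 1 - a"
      using norm_triangle_ineq3[of "ft {0..1} y" "ft {0..a} y"] ft_interval_split[of 0 a 1 y] a m(3) by simp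
    moreover have "\<bar>cmod (ft {0..1} y) + cmod (ft {0..a} y)\<bar> \<le> 2"
      using m by simp
    ultimately have "\<bar>cmod (ft {0..1} y) + cmod (ft {0..a} y)\<bar> * \<bar>cmod (ft {0..1} y) - cmod (ft {0..a} y)\<bar> \<le> 2 * (1 - a)"
      by (intro mult_mono) auto
    moreover have "sinc2 y - (cmod (ft {0..a} y))\<^sup>2
        = (cmod (ft {0..1} y) + cmod (ft {0..a} y)) * (cmod (ft {0..1} y) - cmod (ft {0..a} y))"
      by (simp add: power2_eq_square algebra_simps)
    ultimately show ?thesis
      by (simp only: abs_mult)
  qed
  have close_le: "sinc2 y \<le> (cmod (ft {0..a} y))\<^sup>2 + 2 * (1 - a)" "(cmod (ft {0..a} y))\<^sup>2 \<le> sinc2 y + 2 * (1 - a)"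
    if "0 < a" "a < 1" for a y
    using close[OF that, of y] by linarith+
  have choose_a: "\<exists>a. 0 < a \<and> a < 1 \<and> 2 * (1 - a) * W \<le> e \<and> 1 - a \<le> e" if "e > 0" "W \<ge> 0" for e W :: real
  proof (intro exI conjI)
    \<comment> \<open>\<open>?d * (2 * W + 1)\<close> being at most \<open>e\<close> yields both
      required bounds at once, also for \<open>W = 0\<close>.\<close>
    let ?d = "min (1/2) (e / (2 * W + 1))"
    have d: "0 < ?d" "?d \<le> 1 / 2" "?d * (2 * W + 1) \<le> e"
      using that by (auto simp: min_mult_distrib_right)
    then show "0 < 1 - ?d" "1 - ?d < 1"
      by auto
    have "?d * (2 * W + 1) = 2 * ?d * W + ?d"
      by (simp add: distrib_left)
    moreover have "2 * ?d * W \<ge> 0"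
      using d(1) that by (intro mult_nonneg_nonneg) auto
    ultimately have "2 * ?d * W \<le> e" "?d \<le> e"
      using d by linarith+
    then show "2 * (1 - (1 - ?d)) * W \<le> e" "1 - (1 - ?d) \<le> e"
      by simp_all
  qed
  show ?thesis
  proof (rule has_sum_nonnegI)
    fix S assume S: "finite S" "S \<subseteq> I"
    define W where "W = sum w S"
    have W: "W \<ge> 0"
      using S(2) w_nonneg by (auto simp: W_def intro: sum_nonneg)
    show "(\<Sum>i\<in>S. w i * sinc2 (x - p i)) \<le> 1"
    proof (rule field_le_epsilon)
      fix e :: real assume "e > 0"
      then obtain a where a: "0 < a" "a < 1" "2 * (1 - a) * W \<le> e"
        using choose_a[OF _ W] by blast
      have "(\<Sum>i\<in>S. w i * sinc2 (x - p i)) \<le> (\<Sum>i\<in>S. w i * ((cmod (ft {0..a} (x - p i)))\<^sup>2 + 2 * (1 - a)))"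
        using S(2) w_nonneg by (intro sum_mono mult_left_mono close_le[OF a(1,2)]) auto
      also have "\<dots> = (\<Sum>i\<in>S. w i * (cmod (ft {0..a} (x - p i)))\<^sup>2) + 2 * (1 - a) * W"
        by (simp add: distrib_left sum.distrib W_def sum_distrib_right mult.commute)
      also have "(\<Sum>i\<in>S. w i * (cmod (ft {0..a} (x - p i)))\<^sup>2) \<le> a"
        using S w_nonneg by (intro finite_sum_le_has_sum[OF tiling_short_interval[OF a(1,2)]]) auto
      finally show "(\<Sum>i\<in>S. w i * sinc2 (x - p i)) \<le> 1 + e"
        using a by linarith
    qed
  next
    fix e :: real assume e: "e > 0"
    let ?d = "\<lambda>i. w i * (1 / (1 + (x - p i)\<^sup>2))"
    have d: "((\<lambda>i. 4 * ?d i) has_sum 4 * infsum ?d I) I"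
      using weighted_decay_summable by (intro has_sum_cmult_right has_sum_infsum)
    have "e / 4 > 0"
      using e by simp
    from has_sum_finite_lower[OF d this] obtain S where S: "finite S" "S \<subseteq> I"
      and S': "\<And>T. finite T \<Longrightarrow> S \<subseteq> T \<Longrightarrow> T \<subseteq> I \<Longrightarrow> \<bar>(\<Sum>i\<in>T. 4 * ?d i) - 4 * infsum ?d I\<bar> < e / 4"
      by blast
    define W where "W = sum w S"
    have W: "W \<ge> 0"
      using S(2) w_nonneg by (auto simp: W_def intro: sum_nonneg)
    have "e / 4 > 0"
      using e by simp
    then obtain a where a: "0 < a" "a < 1" "2 * (1 - a) * W \<le> e / 4" "1 - a \<le> e / 4"
      using choose_a[OF _ W] by blast
    let ?g = "\<lambda>i. w i * (cmod (ft {0..a} (x - p i)))\<^sup>2"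
    \<comment> \<open>A majorant independent of \<open>a\<close>: this is why \<open>S\<close> could
      be fixed before \<open>a\<close> was chosen.\<close>
    have gd: "?g i \<le> 4 * ?d i" if "i \<in> I" for i
    proof -
      have "(cmod (ft {0..a} (x - p i)))\<^sup>2 = cmod (cross {0..a} {0..a} (x - p i))"
        by (simp add: cross_def norm_mult power2_eq_square)
      also have "\<dots> \<le> (a - 0 + 1) * (a - 0 + 1) / (1 + (x - p i)\<^sup>2)"
        using a by (intro cross_interval_bound) auto
      also have "\<dots> \<le> 4 / (1 + (x - p i)\<^sup>2)"
        using a mult_mono[of "a + 1" 2 "a + 1" 2] by (intro divide_right_mono) auto
      finally have "(cmod (ft {0..a} (x - p i)))\<^sup>2 \<le> 4 / (1 + (x - p i)\<^sup>2)" .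
      from mult_left_mono[OF this w_nonneg[OF that]] show ?thesis
        by (simp add: mult.commute)
    qed
    have "(?g has_sum a - sum ?g S) (I - S)"
      using has_sum_Diff[OF tiling_short_interval[OF a(1,2)] has_sum_finite[OF S(1)] S(2)] by simp
    moreover have "((\<lambda>i. 4 * ?d i) has_sum 4 * infsum ?d I - (\<Sum>i\<in>S. 4 * ?d i)) (I - S)"
      using has_sum_Diff[OF d has_sum_finite[OF S(1)] S(2)] by simp
    ultimately have "a - sum ?g S \<le> 4 * infsum ?d I - (\<Sum>i\<in>S. 4 * ?d i)"
      by (rule has_sum_mono) (use gd in auto)
    then have "a - sum ?g S < e / 4"
      using S'[OF S(1) order_refl S(2)] by linarith
    moreover have "sum ?g S \<le> (\<Sum>i\<in>S. w i * (sinc2 (x - p i) + 2 * (1 - a)))"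
      using S(2) w_nonneg by (intro sum_mono mult_left_mono close_le[OF a(1,2)]) auto
    moreover have "(\<Sum>i\<in>S. w i * (sinc2 (x - p i) + 2 * (1 - a))) = (\<Sum>i\<in>S. w i * sinc2 (x - p i)) + 2 * (1 - a) * W"
      by (simp add: distrib_left sum.distrib W_def sum_distrib_right mult.commute)
    ultimately have "1 - e < (\<Sum>i\<in>S. w i * sinc2 (x - p i))"
      using a e by linarith
    with S show "\<exists>S. finite S \<and> S \<subseteq> I \<and> 1 - e < (\<Sum>i\<in>S. w i * sinc2 (x - p i))"
      by blast
  qed (use w_nonneg in auto)
qed

end

section \<open>Product domains\<close>

lemma lebesgue_borel_core:
  fixes A :: "'a::euclidean_space set"
  assumes "A \<in> sets lebesgue"
  obtains B N where "B \<in> sets borel" "B \<subseteq> A" "A - B \<subseteq> N" "N \<in> null_sets lborel"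
proof -
  obtain S N N' where "A = S \<union> N" "N \<subseteq> N'" "N' \<in> null_sets lborel" "S \<in> sets lborel"
    using assms by (rule sets_completionE)
  then show ?thesis
    by (intro that[of S N']) auto
qed

lemma
  fixes g :: "'a::euclidean_space \<Rightarrow> 'b::{banach, second_countable_topology}"
  assumes A: "A \<in> sets lebesgue" and B: "B \<in> sets borel" "B \<subseteq> A" "A - B \<subseteq> N" "N \<in> null_sets lborel"
    and g: "g \<in> borel_measurable borel"
  shows integral_lebesgue_on_core: "(LINT x|lebesgue_on A. g x) = (LINT x|lborel. indicator B x *\<^sub>R g x)"
    and integrable_lebesgue_on_core: "integrable (lebesgue_on A) g \<longleftrightarrow> integrable lborel (\<lambda>x. indicator B x *\<^sub>R g x)"
proof -
  have gm [measurable]: "g \<in> borel_measurable lebesgue"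
    using g by (simp add: measurable_completion)
  have m': "(\<lambda>x. indicator B x *\<^sub>R g x) \<in> borel_measurable lborel"
    using g B(1) by (auto intro!: borel_measurable_scaleR)
  have m: "(\<lambda>x. indicator A x *\<^sub>R g x) \<in> borel_measurable lebesgue" "(\<lambda>x. indicator B x *\<^sub>R g x) \<in> borel_measurable lebesgue"
    using A measurable_completion[OF m'] by (auto intro!: borel_measurable_scaleR)
  have "AE x in lborel. x \<notin> N"
    using B(4) by (rule AE_not_in)
  then have "AE x in lebesgue. x \<notin> N"
    by (rule AE_completion)
  then have ae: "AE x in lebesgue. indicator A x *\<^sub>R g x = indicator B x *\<^sub>R g x"
    by eventually_elim (use B(2,3) in \<open>auto simp: indicator_def\<close>)
  show "(LINT x|lebesgue_on A. g x) = (LINT x|lborel. indicator B x *\<^sub>R g x)"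
    using A integral_cong_AE[OF m ae] integral_completion[OF m'] by (simp add: integral_restrict_space)
  show "integrable (lebesgue_on A) g \<longleftrightarrow> integrable lborel (\<lambda>x. indicator B x *\<^sub>R g x)"
    using A integrable_cong_AE[OF m ae] integrable_completion[OF m'] by (simp add: integrable_restrict_space)
qed

text \<open>Fubini is applied to Borel cores of \<open>E\<close> and \<open>F\<close>. What they
  miss of \<open>E \<times> F\<close> lies in the union of two strips over null sets, which is again
  null.\<close>

lemma
  fixes f :: "'a::euclidean_space \<times> 'b::euclidean_space \<Rightarrow> 'c::{banach, second_countable_topology}"
  assumes E: "E \<in> sets lebesgue" "bounded E" and F: "F \<in> sets lebesgue" "bounded F"
    and EF: "E \<times> F \<in> sets lebesgue" and f: "f \<in> borel_measurable borel" "\<And>z. norm (f z) \<le> C"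
  shows integral_times: "(LINT z|lebesgue_on (E \<times> F). f z) = (LINT x|lebesgue_on E. LINT y|lebesgue_on F. f (x, y))"
    and integrable_times: "integrable (lebesgue_on E) (\<lambda>x. LINT y|lebesgue_on F. f (x, y))"
proof -
  obtain E0 N1 where E0: "E0 \<in> sets borel" "E0 \<subseteq> E" "E - E0 \<subseteq> N1" "N1 \<in> null_sets lborel"
    using E(1) by (rule lebesgue_borel_core)
  obtain F0 N2 where F0: "F0 \<in> sets borel" "F0 \<subseteq> F" "F - F0 \<subseteq> N2" "N2 \<in> null_sets lborel"
    using F(1) by (rule lebesgue_borel_core)
  have [measurable]: "E0 \<in> sets borel" "F0 \<in> sets borel"
    using E0 F0 by auto
  have fp [measurable]: "f \<in> borel_measurable (lborel \<Otimes>\<^sub>M lborel)"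
    using f(1) unfolding lborel_prod by simp
  have N: "N1 \<times> UNIV \<union> UNIV \<times> N2 \<in> null_sets lborel"
  proof -
    have "N1 \<times> UNIV \<in> null_sets (lborel \<Otimes>\<^sub>M lborel)" "UNIV \<times> N2 \<in> null_sets (lborel \<Otimes>\<^sub>M lborel)"
      using E0(4) F0(4) by (auto simp: null_sets_def lborel.emeasure_pair_measure_Times)
    then show ?thesis
      by (auto simp: lborel_prod)
  qed
  have EF0: "E0 \<times> F0 \<in> sets borel" "E0 \<times> F0 \<subseteq> E \<times> F" "E \<times> F - E0 \<times> F0 \<subseteq> N1 \<times> UNIV \<union> UNIV \<times> N2"
    using E0 F0 by (auto intro: borel_Times)
  define h where "h x y = indicator E0 x *\<^sub>R indicator F0 y *\<^sub>R f (x, y)" for x y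
  have hm: "case_prod h \<in> borel_measurable (lborel \<Otimes>\<^sub>M lborel)"
    unfolding h_def by measurable
  have bounded_fin: "emeasure lborel S < \<infinity>" if "bounded S" for S :: "'d::euclidean_space set"
    using that by (rule emeasure_bounded_finite)
  have hi: "integrable (lborel \<Otimes>\<^sub>M lborel) (case_prod h)"
  proof (rule integrableI_bounded_set[of "E0 \<times> F0" _ _ C])
    show "emeasure (lborel \<Otimes>\<^sub>M lborel) (E0 \<times> F0) < \<infinity>"
      using bounded_fin[OF bounded_subset[OF E(2) E0(2)]] bounded_fin[OF bounded_subset[OF F(2) F0(2)]]
      by (simp add: lborel.emeasure_pair_measure_Times ennreal_mult_less_top)
    show "AE z in lborel \<Otimes>\<^sub>M lborel. z \<in> E0 \<times> F0 \<longrightarrow> norm (case_prod h z) \<le> C"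
      using f(2) by (auto simp: h_def)
    show "AE z in lborel \<Otimes>\<^sub>M lborel. z \<notin> E0 \<times> F0 \<longrightarrow> case_prod h z = 0"
      by (auto simp: h_def indicator_def)
  qed (use hm in auto)
  have fx: "(\<lambda>y. f (x, y)) \<in> borel_measurable borel" for x
    using f(1) by (intro measurable_compose[OF _ f(1)]) (auto intro!: borel_measurable_continuous_onI continuous_intros)
  define G where "G x = (LINT y|lebesgue_on F. f (x, y))" for x
  have G: "G x = (LINT y|lborel. indicator F0 y *\<^sub>R f (x, y))" for x
    unfolding G_def by (rule integral_lebesgue_on_core[OF F(1) F0 fx])
  have Gm: "G \<in> borel_measurable borel"
  proof -
    have "(\<lambda>x. LINT y|lborel. indicator F0 y *\<^sub>R f (x, y)) \<in> borel_measurable lborel"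
      by measurable
    then show ?thesis
      by (simp add: G[abs_def])
  qed
  have hG: "(LINT y|lborel. h x y) = indicator E0 x *\<^sub>R G x" for x
    unfolding h_def G by (rule integral_scaleR_right)
  show "integrable (lebesgue_on E) (\<lambda>x. LINT y|lebesgue_on F. f (x, y))"
    using lborel_pair.integrable_fst'[OF hi] integrable_lebesgue_on_core[OF E(1) E0 Gm]
    by (simp add: hG G_def[abs_def])
  have "(LINT z|lebesgue_on (E \<times> F). f z) = (LINT z|lborel. indicator (E0 \<times> F0) z *\<^sub>R f z)"
    by (rule integral_lebesgue_on_core[OF EF EF0 N f(1)])
  also have "\<dots> = (LINT z|(lborel \<Otimes>\<^sub>M lborel). case_prod h z)"
    unfolding lborel_prod by (intro Bochner_Integration.integral_cong) (auto simp: h_def indicator_def)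
  also have "\<dots> = (LINT x|lborel. LINT y|lborel. h x y)"
    using lborel_pair.integral_fst'[OF hi] by simp
  also have "\<dots> = (LINT x|lebesgue_on E. G x)"
    unfolding hG by (rule integral_lebesgue_on_core[OF E(1) E0 Gm, symmetric])
  finally show "(LINT z|lebesgue_on (E \<times> F). f z) = (LINT x|lebesgue_on E. LINT y|lebesgue_on F. f (x, y))"
    by (simp add: G_def)
qed

lemma expo_Pair: "expo (a, b) (x, y) = expo a x * expo b y"
  by (simp add: expo_def exp_add[symmetric] algebra_simps)

lemma ft_times:
  fixes E :: "'a::euclidean_space set" and F :: "'b::euclidean_space set"
  assumes E: "E \<in> sets lebesgue" "bounded E" and F: "F \<in> sets lebesgue" "bounded F"
    and EF: "E \<times> F \<in> sets lebesgue"
  shows "ft (E \<times> F) (a, b) = ft E a * ft F b"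
proof -
  have "ft (E \<times> F) (a, b) = (LINT x|lebesgue_on E. LINT y|lebesgue_on F. expo (a, b) (x, y))"
    unfolding ft_lebesgue_on[OF EF] by (rule integral_times[OF E F EF, where C = 1]) auto
  then show ?thesis
    by (simp add: expo_Pair ft_lebesgue_on E F)
qed

section \<open>From a spectrum of the product to spectra of the factors\<close>

locale product_spectrum =
  fixes \<epsilon> :: real and E :: "real set" and F :: "'b::euclidean_space set" and \<Lambda> :: "(real \<times> 'b) set"
  assumes \<epsilon>: "\<epsilon> > 0"
    and E: "E \<in> sets lebesgue" "E \<subseteq> {0..3/2 - \<epsilon>}" "measure lebesgue E = 1"
    and F: "F \<in> sets lebesgue" "bounded F" "measure lebesgue F = 1"
    and EF: "E \<times> F \<in> sets lebesgue" and spec: "is_spectrum (E \<times> F) \<Lambda>"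
begin

lemma bounded_E: "bounded E"
  using bounded_subset[OF bounded_closed_interval E(2)] .

lemma lmeasurable_EF: "E \<in> lmeasurable" "F \<in> lmeasurable" "E \<times> F \<in> lmeasurable"
  using E F EF bounded_E by (auto intro!: bounded_set_imp_lmeasurable bounded_Times)

lemma ft_EF: "ft (E \<times> F) z = ft E (fst z) * ft F (snd z)"
  using ft_times[OF E(1) bounded_E F(1,2) EF, of "fst z" "snd z"] by simp

lemma ft_E0: "ft E 0 = 1" and ft_F0: "ft F 0 = 1"
  using E F by (simp_all add: ft_0)

lemma measure_EF: "measure lebesgue (E \<times> F) = 1"
proof -
  have "complex_of_real (measure lebesgue (E \<times> F)) = 1"
    using ft_0[OF EF] by (simp add: ft_EF ft_E0 ft_F0)
  then show ?thesis
    by simp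
qed

abbreviation weight :: "'b \<Rightarrow> real \<times> 'b \<Rightarrow> real" where
  "weight y l \<equiv> (cmod (ft F (y - snd l)))\<^sup>2"

lemma product_tiling: "((\<lambda>l. weight y l * (cmod (ft E (x - fst l)))\<^sup>2) has_sum 1) \<Lambda>"
  using spectrum_tiling[OF lmeasurable_EF(3) _ spec, of "(x, y)"]
  by (simp add: measure_EF ft_EF norm_mult power_mult_distrib mult.commute)

lemma orthogonal:
  assumes "l \<in> \<Lambda>" "k \<in> \<Lambda>" "l \<noteq> k"
  shows "ft E (fst l - fst k) = 0 \<or> ft F (snd l - snd k) = 0"
  using is_spectrum_orth[OF EF spec assms] by (simp add: ft_EF)

text \<open>With \<open>y\<close> frozen, \<open>product_tiling\<close> is a weighted tiling of the
  line. \<open>E\<close> is exchanged for a Borel core, which has the same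
  \<open>ft\<close>.\<close>

lemma sinc2_product_tiling: "((\<lambda>l. weight y l * sinc2 (x - fst l)) has_sum 1) \<Lambda>"
proof -
  obtain B N where B: "B \<in> sets borel" "B \<subseteq> E" "E - B \<subseteq> N" "N \<in> null_sets lborel"
    using E(1) by (rule lebesgue_borel_core)
  have ft_B: "ft B x = ft E x" for x
  proof -
    have "expo x \<in> borel_measurable borel"
      by measurable
    from integral_lebesgue_on_core[OF E(1) B this] show ?thesis
      by (simp add: ft_lebesgue_on[OF E(1)] ft_lborel[OF B(1)] scaleR_conv_of_real of_real_indicator)
  qed
  have "complex_of_real (measure lebesgue B) = 1"
    using ft_0[of B] ft_B[of 0] B(1) by (simp add: ft_E0)
  then have "measure lborel B = 1"
    using B(1) by (simp add: measure_completion)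
  then interpret weighted_tiling \<Lambda> "weight y" fst B \<epsilon>
    using B E(2) \<epsilon> product_tiling by unfold_locales (auto simp: ft_B)
  show ?thesis
    by (rule tiling_unit_interval)
qed

text \<open>In the tiling evaluated at the point \<open>l\<close> itself, the term of
  \<open>l\<close> already equals 1, so every other term vanishes; and \<open>sinc2\<close> vanishes
  only at nonzero integers.\<close>

lemma integral_difference:
  assumes l: "l \<in> \<Lambda>" and k: "k \<in> \<Lambda>" and "l \<noteq> k" and ne: "ft F (snd l - snd k) \<noteq> 0"
  shows "fst l - fst k \<in> \<int>" "fst l \<noteq> fst k" "ft E (fst l - fst k) = 0"
proof -
  have "(\<Sum>j\<in>{l, k}. weight (snd l) j * sinc2 (fst l - fst j)) \<le> 1"
    using l k by (intro finite_sum_le_has_sum[OF sinc2_product_tiling]) auto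
  then have "weight (snd l) k * sinc2 (fst l - fst k) \<le> 0"
    using \<open>l \<noteq> k\<close> by (simp add: ft_F0 sinc2_0)
  then have z: "sinc2 (fst l - fst k) = 0"
    using ne by (simp add: mult_le_0_iff)
  then show "fst l - fst k \<in> \<int>"
    using sinc2_pos[of "fst l - fst k"] by auto
  show "fst l \<noteq> fst k"
    using z sinc2_0 by auto
  show "ft E (fst l - fst k) = 0"
    using orthogonal[OF l k \<open>l \<noteq> k\<close>] ne by blast
qed

definition fiber :: "real \<Rightarrow> (real \<times> 'b) set" where
  "fiber s = {l \<in> \<Lambda>. fst l = s}"

text \<open>Evaluated at \<open>fst l + of_int n\<close>, every term of positive weight has
  \<open>sinc2\<close> at an integer, hence 0 or 1; exactly the fiber survives.\<close>

lemma fiber_tiling: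
  assumes l: "l \<in> \<Lambda>"
  shows "(weight (snd l) has_sum 1) (fiber (fst l + of_int n))"
proof -
  have "((\<lambda>k. weight (snd l) k * sinc2 (fst l + of_int n - fst k)) has_sum 1) \<Lambda>"
    by (rule sinc2_product_tiling)
  also have "?this \<longleftrightarrow> (weight (snd l) has_sum 1) (fiber (fst l + of_int n))"
  proof (rule has_sum_cong_neutral)
    fix k assume k: "k \<in> \<Lambda> - fiber (fst l + of_int n)"
    show "weight (snd l) k * sinc2 (fst l + of_int n - fst k) = 0"
    proof (cases "ft F (snd l - snd k) = 0")
      case False
      have "fst l - fst k \<in> \<int>"
        using integral_difference(1)[OF l _ _ False] k by (cases "l = k") auto
      then obtain j where j: "fst l - fst k = of_int j"
        by (rule Ints_cases)
      then have eq: "fst l + of_int n - fst k = of_int (j + n)"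
        by simp
      have "j + n \<noteq> 0"
      proof
        assume "j + n = 0"
        then have "fst k = fst l + of_int n"
          using j by (simp add: algebra_simps)
        then show False
          using k by (simp add: fiber_def)
      qed
      then show ?thesis
        unfolding eq using sinc2_int[of "j + n"] by simp
    qed simp
  next
    fix k assume "k \<in> \<Lambda> \<inter> fiber (fst l + of_int n)"
    then show "weight (snd l) k * sinc2 (fst l + of_int n - fst k) = weight (snd l) k"
      by (simp add: fiber_def sinc2_0)
  qed (auto simp: fiber_def)
  finally show ?thesis .
qed

lemma \<Lambda>_nonempty: "\<Lambda> \<noteq> {}"
proof
  assume "\<Lambda> = {}"
  from product_tiling[of 0 0] have "((\<lambda>l. weight 0 l * (cmod (ft E (0 - fst l)))\<^sup>2) has_sum 1) {}"
    unfolding \<open>\<Lambda> = {}\<close> .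
  from has_sum_unique[OF this has_sum_empty] show False
    by simp
qed

text \<open>The weights on the fiber at distance \<open>n\<close> sum to 1, so some point there is
  not orthogonal to \<open>l\<close> through \<open>F\<close>; orthogonality must then come from
  \<open>E\<close>.\<close>

lemma ft_E_int:
  assumes "n \<noteq> 0"
  shows "ft E (of_int n) = 0"
proof -
  obtain l where l: "l \<in> \<Lambda>"
    using \<Lambda>_nonempty by blast
  have "\<exists>k\<in>fiber (fst l + of_int n). weight (snd l) k \<noteq> 0"
  proof (rule ccontr)
    assume "\<not> (\<exists>k\<in>fiber (fst l + of_int n). weight (snd l) k \<noteq> 0)"
    then have "(weight (snd l) has_sum 0) (fiber (fst l + of_int n))"
      by (intro has_sum_0) blast
    with fiber_tiling[OF l, of n] show False
      using has_sum_unique by fastforce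
  qed
  then obtain k where k: "k \<in> \<Lambda>" "fst k = fst l + of_int n" "ft F (snd l - snd k) \<noteq> 0"
    by (auto simp: fiber_def)
  have "l \<noteq> k"
    using k(2) assms by auto
  from integral_difference(3)[OF l k(1) this k(3)] have "ft E (- of_int n) = 0"
    by (simp add: k(2))
  then show ?thesis
    by (simp add: ft_minus)
qed

lemma spectrum_E: "is_spectrum E (range of_int)"
proof (rule is_spectrumI[OF lmeasurable_EF(1) bounded_E])
  show orth: "ft E (l - k) = 0" if "l \<in> range of_int" "k \<in> range of_int" "l \<noteq> k" for l k
  proof -
    from that obtain i j where "l = of_int i" "k = of_int j" "i \<noteq> j"
      by auto
    then show ?thesis
      using ft_E_int[of "i - j"] by simp
  qed
  fix x
  show "closed_span (lebesgue_on E) (range of_int) expo (expo x)"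
  proof (rule closed_span_tiling[OF lmeasurable_EF(1) E(3) orth])
    fix e :: real assume e: "e > 0"
    obtain l where l: "l \<in> \<Lambda>"
      using \<Lambda>_nonempty by blast
    let ?w = "weight (snd l)" and ?g = "\<lambda>k. (cmod (ft E (x + fst l - fst k)))\<^sup>2"
    obtain S where S: "finite S" "S \<subseteq> \<Lambda>" and
      S': "\<And>T. finite T \<Longrightarrow> S \<subseteq> T \<Longrightarrow> T \<subseteq> \<Lambda> \<Longrightarrow> \<bar>(\<Sum>k\<in>T. ?w k * ?g k) - 1\<bar> < e"
      using has_sum_finite_lower[OF product_tiling[of "snd l" "x + fst l"] e] by blast
    \<comment> \<open>The floor is exact whenever the weight is nonzero; the remaining indices
      contribute nothing.\<close>
    define n where "n k = \<lfloor>fst k - fst l\<rfloor>" for k :: "real \<times> 'b"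
    have n: "fst k = fst l + of_int (n k)" if "k \<in> S" "?w k \<noteq> 0" for k
    proof (cases "l = k")
      case False
      have "fst l - fst k \<in> \<int>"
        using integral_difference(1)[OF l _ False] that S(2) by auto
      then have "fst k - fst l \<in> \<int>"
        using minus_in_Ints_iff[of "fst l - fst k"] by simp
      then show ?thesis
        by (simp add: n_def)
    qed (simp add: n_def)
    have "1 - e < (\<Sum>k\<in>S. ?w k * ?g k)"
      using S'[OF S(1) order_refl S(2)] by linarith
    also have "\<dots> = (\<Sum>j\<in>n ` S. \<Sum>k\<in>{k\<in>S. n k = j}. ?w k * ?g k)"
      using S(1) by (intro sum.group[symmetric]) auto
    \<comment> \<open>All contributing points of a group share the value of \<open>ft E\<close>,
      since the tiling was evaluated at \<open>x + fst l\<close>, and their weights sum to at most 1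
      by \<open>fiber_tiling\<close>.\<close>
    also have "\<dots> \<le> (\<Sum>j\<in>n ` S. (cmod (ft E (x - of_int j)))\<^sup>2)"
    proof (rule sum_mono)
      fix j
      let ?T = "{k \<in> S. n k = j}"
      have "(\<Sum>k\<in>?T. ?w k * ?g k) = (\<Sum>k\<in>?T \<inter> fiber (fst l + of_int j). ?w k * ?g k)"
        using S n by (intro sum.mono_neutral_right) (auto simp: fiber_def)
      also have "\<dots> = (\<Sum>k\<in>?T \<inter> fiber (fst l + of_int j). ?w k) * (cmod (ft E (x - of_int j)))\<^sup>2"
        unfolding sum_distrib_right by (intro sum.cong refl) (auto simp: fiber_def)
      also have "\<dots> \<le> 1 * (cmod (ft E (x - of_int j)))\<^sup>2"
        using S(1) by (intro mult_right_mono finite_sum_le_has_sum[OF fiber_tiling[OF l, of j]]) auto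
      finally show "(\<Sum>k\<in>?T. ?w k * ?g k) \<le> (cmod (ft E (x - of_int j)))\<^sup>2"
        by simp
    qed
    also have "\<dots> = (\<Sum>r\<in>of_int ` n ` S. (cmod (ft E (x - r)))\<^sup>2)"
      by (subst sum.reindex) (auto simp: inj_on_def)
    finally show "\<exists>S. finite S \<and> S \<subseteq> range of_int \<and> 1 - e < (\<Sum>r\<in>S. (cmod (ft E (x - r)))\<^sup>2)"
      using S(1) by (intro exI[of _ "of_int ` n ` S"]) auto
  qed
qed

definition slice :: "(real \<times> 'b) set" where
  "slice = {l \<in> \<Lambda>. 0 \<le> fst l \<and> fst l < 1}"

text \<open>Without orthogonality on \<open>F\<close> the first coordinates would differ by a
  nonzero integer, impossible within [0, 1).\<close>

lemma slice_orth:
  assumes "a \<in> snd ` slice" "b \<in> snd ` slice" "a \<noteq> b"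
  shows "ft F (a - b) = 0"
proof (rule ccontr)
  assume ne: "ft F (a - b) \<noteq> 0"
  obtain l k where l: "l \<in> \<Lambda>" "0 \<le> fst l" "fst l < 1" "a = snd l" and k: "k \<in> \<Lambda>" "0 \<le> fst k" "fst k < 1" "b = snd k"
    using assms by (auto simp: slice_def)
  have "l \<noteq> k"
    using assms(3) l k by auto
  note d = integral_difference[OF l(1) k(1) this ne[unfolded l(4) k(4)]]
  from d(1) obtain j where j: "fst l - fst k = of_int j"
    by (rule Ints_cases)
  have "\<bar>real_of_int j\<bar> < 1"
    using l k unfolding j[symmetric] by linarith
  then have "j = 0"
    by linarith
  with j d(2) show False
    by simp
qed

lemma closed_span_slice:
  assumes l: "l \<in> \<Lambda>"
  shows "closed_span (lebesgue_on F) (snd ` slice) expo (expo (snd l))"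
proof (rule closed_span_tiling[OF lmeasurable_EF(2) F(3) slice_orth])
  fix e :: real assume e: "e > 0"
  \<comment> \<open>The fractional part of \<open>fst l\<close>: the one integer translate of
    \<open>fst l\<close> whose fiber lies in the slice.\<close>
  define s where "s = fst l + of_int (- \<lfloor>fst l\<rfloor>)"
  have s: "0 \<le> s" "s < 1"
    unfolding s_def by (simp_all, linarith+)
  obtain S where S: "finite S" "S \<subseteq> fiber s" and
    S': "\<And>T. finite T \<Longrightarrow> S \<subseteq> T \<Longrightarrow> T \<subseteq> fiber s \<Longrightarrow> \<bar>(\<Sum>k\<in>T. weight (snd l) k) - 1\<bar> < e"
    using has_sum_finite_lower[OF fiber_tiling[OF l, of "- \<lfloor>fst l\<rfloor>"] e] unfolding s_def[symmetric] by blast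
  have "inj_on snd S"
    by (rule inj_onI) (use S(2) in \<open>auto simp: fiber_def prod_eq_iff\<close>)
  then have "(\<Sum>b\<in>snd ` S. (cmod (ft F (snd l - b)))\<^sup>2) = (\<Sum>k\<in>S. weight (snd l) k)"
    by (simp add: sum.reindex)
  also have "\<dots> > 1 - e"
    using S'[OF S(1) order_refl S(2)] by linarith
  finally have "1 - e < (\<Sum>b\<in>snd ` S. (cmod (ft F (snd l - b)))\<^sup>2)" .
  moreover have "snd ` S \<subseteq> snd ` slice"
    using S(2) s by (auto simp: fiber_def slice_def)
  ultimately show "\<exists>S. finite S \<and> S \<subseteq> snd ` slice \<and> 1 - e < (\<Sum>b\<in>S. (cmod (ft F (snd l - b)))\<^sup>2)"
    using S(1) by blast
qed

text \<open>All \<open>expo (snd l)\<close>, \<open>l \<in> \<Lambda>\<close>, lie in the closed span of the slice. An approximation of \<open>expo (0, y)\<close> on \<open>E \<times> F\<close> by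
  \<open>\<Lambda>\<close> restricts, for some \<open>x \<in> E\<close>, to one of \<open>expo y\<close> on \<open>F\<close> by these.\<close>

lemma spectrum_F: "is_spectrum F (snd ` slice)"
proof (rule is_spectrumI[OF lmeasurable_EF(2) F(2) slice_orth])
  interpret finite_measure "lebesgue_on F"
    using lmeasurable_EF(2) by (rule finite_measure_lebesgue_on)
  interpret E: finite_measure "lebesgue_on E"
    using lmeasurable_EF(1) by (rule finite_measure_lebesgue_on)
  fix y
  show "closed_span (lebesgue_on F) (snd ` slice) expo (expo y)"
  proof (rule closed_span_limit)
    fix e :: real assume e: "e > 0"
    have "closed_span (lebesgue_on (E \<times> F)) \<Lambda> expo (expo (0, y))"
      using lmeasurable_EF(3) spec bmeas_expo by (rule is_spectrum_closed_span)
    then obtain S c where S: "finite S" "S \<subseteq> \<Lambda>"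
      "sqn (lebesgue_on (E \<times> F)) (\<lambda>z. expo (0, y) z - (\<Sum>l\<in>S. c l * expo l z)) < e"
      using e by (rule closed_spanD)
    define g where "g x t = (\<Sum>l\<in>S. c l * expo (fst l) x * expo (snd l) t)" for x t
    define f where "f z = (cmod (expo (0, y) z - (\<Sum>l\<in>S. c l * expo l z)))\<^sup>2" for z
    have fg: "f (x, t) = (cmod (expo y t - g x t))\<^sup>2" for x t
    proof -
      have "expo l (x, t) = expo (fst l) x * expo (snd l) t" for l :: "real \<times> 'b"
        using expo_Pair[of "fst l" "snd l" x t] by simp
      then show ?thesis
        by (simp add: f_def g_def mult.assoc expo_Pair)
    qed
    have fm: "f \<in> borel_measurable borel"
      unfolding f_def by measurable
    have fb: "norm (f z) \<le> (1 + (\<Sum>l\<in>S. cmod (c l)))\<^sup>2" for z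
    proof -
      have "cmod (\<Sum>l\<in>S. c l * expo l z) \<le> (\<Sum>l\<in>S. cmod (c l))"
        by (rule sum_norm_le) (simp add: norm_mult)
      then have "cmod (expo (0, y) z - (\<Sum>l\<in>S. c l * expo l z)) \<le> 1 + (\<Sum>l\<in>S. cmod (c l))"
        using norm_triangle_ineq4[of "expo (0, y) z" "\<Sum>l\<in>S. c l * expo l z"] by simp
      then show ?thesis
        by (simp add: f_def power_mono)
    qed
    define \<phi> where "\<phi> x = sqn (lebesgue_on F) (\<lambda>t. expo y t - g x t)" for x
    have \<phi>: "\<phi> x = (LINT t|lebesgue_on F. f (x, t))" for x
      by (simp add: \<phi>_def sqn_def fg)
    have "(LINT x|lebesgue_on E. \<phi> x) < e"
      using S(3) integral_times[OF E(1) bounded_E F(1,2) EF fm fb] by (simp add: \<phi> sqn_def f_def)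
    moreover have "integrable (lebesgue_on E) \<phi>"
      using integrable_times[OF E(1) bounded_E F(1,2) EF fm fb] by (simp add: \<phi>[abs_def])
    moreover have "(LINT x|lebesgue_on E. e) = e"
      using E by (simp add: measure_lebesgue_on_space)
    \<comment> \<open>\<open>E\<close> has measure 1, so the average of \<open>\<phi>\<close> over
      \<open>E\<close> is below \<open>e\<close>, and some value must be.\<close>
    ultimately have "\<exists>x\<in>E. \<phi> x < e"
      using integral_mono[of "lebesgue_on E" "\<lambda>_. e" \<phi>] by (force simp: not_less)
    then obtain x where x: "\<phi> x < e"
      by blast
    have b: "bmeas (lebesgue_on F) (\<lambda>t. c l * expo (fst l) x * expo (snd l) t)" for l
      by (intro bmeas_mult bmeas_expo bmeas_const)
    have bg: "bmeas (lebesgue_on F) (g x)"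
      unfolding g_def using b by (rule bmeas_sum)
    have "closed_span (lebesgue_on F) (snd ` slice) expo (g x)"
      unfolding g_def using S(1,2)
    proof (induction S rule: finite_induct)
      case empty
      show ?case
        by (auto simp: closed_span_def sqn_def intro!: exI[of _ "{}"])
    next
      case (insert l S)
      then have "closed_span (lebesgue_on F) (snd ` slice) expo
          (\<lambda>t. c l * expo (fst l) x * expo (snd l) t + (\<Sum>l\<in>S. c l * expo (fst l) x * expo (snd l) t))"
        by (intro closed_span_add closed_span_cmult closed_span_slice bmeas_expo b bmeas_sum) auto
      with insert show ?case
        by simp
    qed
    then show "\<exists>g. bmeas (lebesgue_on F) g \<and> closed_span (lebesgue_on F) (snd ` slice) expo g \<and>
        integrable (lebesgue_on F) (\<lambda>t. (cmod (expo y t - g t))\<^sup>2) \<and> sqn (lebesgue_on F) (\<lambda>t. expo y t - g t) < e"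
      using bg x bmeas_integrable_sq[OF bmeas_diff[OF bmeas_expo bg]] by (intro exI[of _ "g x"]) (auto simp: \<phi>_def)
  qed (rule bmeas_expo)
qed

end

theorem theorem1p3:
  fixes \<epsilon> :: real and E :: "real set" and F :: "(real ^ 'm) set"
  assumes "\<epsilon> > 0"
    and "E \<in> sets lebesgue" and "E \<subseteq> {0 .. 3/2 - \<epsilon>}" and "emeasure lebesgue E = 1"
    and "F \<in> sets lebesgue" and "bounded F" and "emeasure lebesgue F = 1"
    and "spectral (E \<times> F)"
  shows "spectral E \<and> spectral F"
proof -
  obtain \<Lambda> where \<Lambda>: "countable \<Lambda>" "is_spectrum (E \<times> F) \<Lambda>"
    using assms(8) unfolding spectral_def by blast
  interpret product_spectrum \<epsilon> E F \<Lambda>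
    using assms \<Lambda> by unfold_locales (auto simp: spectral_def measure_def)
  have "countable (snd ` slice)"
    using \<Lambda>(1) by (auto simp: slice_def intro: countable_subset)
  moreover have "countable (range real_of_int)"
    by simp
  ultimately show ?thesis
    unfolding spectral_def using spectrum_E spectrum_F assms(2,4-7) bounded_E by (metis zero_less_one)
qed

end
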